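(* Let $(X_t)_{t\ge0}$ be a one-dimensional Lévy process such that $X_t$ has a transition density $p_t$ with respect to Lebesgue measure for all $t>0$. Let $g:\mathbb{R}\to(0,\infty)$ be a Borel measurable function which grows at most exponentially, i.e. $|g(x)|\le c e^{\kappa|x|}$ for all $x\in\mathbb{R}$ with some constants $c>0$, $\kappa\geq 0$. Assume that $\mathbb{E}e^{\kappa|X_t|}<\infty$ for all $t\geq 0$ and that either (a) $p_t>0$ on $\mathbb{R}$ for some $t>0$, or (b) $p_t=0$ on $(-\infty,0)$ and $p_t>0$ on $(0,\infty)$ for some $t>0$. If the process $g(X_t)/\mathbb{E}g(X_t)$, $t\ge0$, is a martingale, then there are a continuous function $\tilde g$ and a constant $\alpha\in\mathbb{R}$ such that $g=\tilde g$ Lebesgue almost everywhere and $$\frac{A\tilde g(x)}{\tilde g(x)}=\alpha,$$ where $A$ denotes the (weakly extended) generator of $(X_t)_{t\ge0}$. The equation $\mathbb{E}\exp(\lambda X_t)=\exp(\alpha t)$, $t>0$, admits at most two (in case (b): at most one) solutions $\lambda=\lambda_1,\lambda_2\in\mathbb{R}$. If there are solutions, then $g(x)=ae^{\lambda_1x}+be^{\lambda_2x}$ for Lebesgue almost every $x\in\mathbb{R}$, for suitable constants $a,b\ge0$ (with $\lambda_1=\lambda_2$ if there is only one solution); otherwise there is only the trivial solution $g\equiv0$.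
   Context: A Lévy process is a real-valued càdlàg process with stationary and independent increments and $X_0=0$ a.s.; its law is determined by $\mathbb{E}e^{i\xi X_t}=e^{-t\psi(\xi)}$ with $\psi(\xi)=-ib\xi+\frac12\sigma^2\xi^2+\int_{y\ne0}(1-e^{iy\xi}+iy\xi\mathbf{1}_{(0,1)}(|y|))\,\nu(dy)$, where $b\in\mathbb{R}$, $\sigma^2\ge0$ and $\nu$ is a measure on $\mathbb{R}\setminus\{0\}$ with $\int\min\{y^2,1\}\,\nu(dy)<\infty$. Martingales are with respect to the natural filtration $\mathcal{F}_t=\sigma(X_s:s\le t)$. The generator acts on $u\in C_c^\infty(\mathbb{R})$ by $Au(x)=bu'(x)+\frac12\sigma^2u''(x)+\int_{y\ne0}[u(x+y)-u(x)-yu'(x)\mathbf{1}_{(0,1)}(|y|)]\,\nu(dy)$; its formal adjoint $A^*$ is the generator of the Lévy process $(-X_t)_{t\ge0}$. The weakly extended generator is defined by $\langle Ag,\phi\rangle:=\langle g,A^*\phi\rangle=\int gA^*\phi\,dx$ for $\phi\in C_c^\infty(\mathbb{R})$; thus $A\tilde g/\tilde g=\alpha$ is understood as $A\tilde g=\alpha\tilde g$, i.e. $\int\tilde g\,A^*\phi\,dx=\alpha\int\tilde g\,\phi\,dx$ for all $\phi\in C_c^\infty(\mathbb{R})$.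
   Formalization: In case (b) the identities for g (with g̃ and with the exponentials) are asserted for Lebesgue almost every x>0 instead of x in ℝ: X started at 0 never sees g on (−∞,0), e.g. a gamma process with g=1 on [0,∞) and g=2 on (−∞,0) refutes the original. *)

theory Defs
  imports "HOL-Probability.Probability"
begin

section \<open>Levy processes\<close>

text \<open>Only the values \<^term>\<open>X t\<close> with \<^prop>\<open>0 \<le> t\<close> matter; real time is used as index type.\<close>

locale levy_process = prob_space M
  for M :: "'a measure" and X :: "real \<Rightarrow> 'a \<Rightarrow> real" +
  assumes measurable_X: "0 \<le> t \<Longrightarrow> X t \<in> borel_measurable M"
    and X_zero: "AE \<omega> in M. X 0 \<omega> = 0"
    and right_continuous:
      "\<omega> \<in> space M \<Longrightarrow> 0 \<le> t \<Longrightarrow> continuous (at_right t) (\<lambda>s. X s \<omega>)"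
    and left_limits:
      "\<omega> \<in> space M \<Longrightarrow> 0 < t \<Longrightarrow> \<exists>l. ((\<lambda>s. X s \<omega>) \<longlongrightarrow> l) (at_left t)"
    and stationary_increments:
      "0 \<le> s \<Longrightarrow> 0 \<le> h \<Longrightarrow>
        distr M borel (\<lambda>\<omega>. X (s + h) \<omega> - X s \<omega>) = distr M borel (\<lambda>\<omega>. X h \<omega> - X 0 \<omega>)"
    and independent_increments:
      "0 \<le> \<tau> 0 \<Longrightarrow> (\<And>i. i < n \<Longrightarrow> \<tau> i \<le> \<tau> (Suc i)) \<Longrightarrow>
        indep_vars (\<lambda>_. borel) (\<lambda>i \<omega>. X (\<tau> (Suc i)) \<omega> - X (\<tau> i) \<omega>) {..<(n::nat)}"

definition levy_measure :: "real measure \<Rightarrow> bool" where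
  "levy_measure \<nu> \<longleftrightarrow>
     sets \<nu> = sets borel \<and> emeasure \<nu> {0} = 0 \<and> (\<integral>\<^sup>+ y. ennreal (min (y\<^sup>2) 1) \<partial>\<nu>) < \<infinity>"

text \<open>A measure on the punctured line is encoded as a Borel measure on the whole line without
  mass at 0, so integrals over \<open>y \<noteq> 0\<close> are plain integrals against it.\<close>

definition levy_exponent :: "real \<Rightarrow> real \<Rightarrow> real measure \<Rightarrow> real \<Rightarrow> complex" where
  "levy_exponent b \<sigma>2 \<nu> \<xi> =
     - \<i> * complex_of_real (b * \<xi>) + complex_of_real (\<sigma>2 * \<xi>\<^sup>2 / 2)
     + (CLINT y|\<nu>. 1 - iexp (y * \<xi>)
          + \<i> * complex_of_real (y * \<xi> * indicator {0<..<1} \<bar>y\<bar>))"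

definition levy_triplet ::
  "'a measure \<Rightarrow> (real \<Rightarrow> 'a \<Rightarrow> real) \<Rightarrow> real \<Rightarrow> real \<Rightarrow> real measure \<Rightarrow> bool" where
  "levy_triplet M X b \<sigma>2 \<nu> \<longleftrightarrow>
     0 \<le> \<sigma>2 \<and> levy_measure \<nu> \<and>
     (\<forall>t\<ge>0. \<forall>\<xi>. char (distr M borel (X t)) \<xi> = exp (- complex_of_real t * levy_exponent b \<sigma>2 \<nu> \<xi>))"

section \<open>Martingales\<close>

definition natural_filtration ::
  "'a measure \<Rightarrow> (real \<Rightarrow> 'a \<Rightarrow> real) \<Rightarrow> real \<Rightarrow> 'a measure" where
  "natural_filtration M X t =
     sigma (space M) {X s -` B \<inter> space M |s B. 0 \<le> s \<and> s \<le> t \<and> B \<in> sets borel}"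

definition martingale ::
  "'a measure \<Rightarrow> (real \<Rightarrow> 'a measure) \<Rightarrow> (real \<Rightarrow> 'a \<Rightarrow> real) \<Rightarrow> bool" where
  "martingale M F Y \<longleftrightarrow>
     filtration (space M) F \<and> (\<forall>t\<ge>0. subalgebra M (F t)) \<and>
     (\<forall>t\<ge>0. Y t \<in> borel_measurable (F t) \<and> integrable M (Y t)) \<and>
     (\<forall>s t. 0 \<le> s \<and> s \<le> t \<longrightarrow> (AE \<omega> in M. real_cond_exp M (F s) (Y t) \<omega> = Y s \<omega>))"

section \<open>The generator and its weak extension\<close>

definition test_function :: "(real \<Rightarrow> real) \<Rightarrow> bool" where
  "test_function \<phi> \<longleftrightarrow>
     (\<forall>n x. ((deriv ^^ n) \<phi>) field_differentiable at x) \<and> compact (closure {x. \<phi> x \<noteq> 0})"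

definition generator ::
  "real \<Rightarrow> real \<Rightarrow> real measure \<Rightarrow> (real \<Rightarrow> real) \<Rightarrow> real \<Rightarrow> real" where
  "generator b \<sigma>2 \<nu> u x =
     b * deriv u x + \<sigma>2 / 2 * deriv (deriv u) x
     + (LINT y|\<nu>. u (x + y) - u x - y * deriv u x * indicator {0<..<1} \<bar>y\<bar>)"

text \<open>If \<open>X\<close> has the triplet \<open>(b, \<sigma>2, \<nu>)\<close>, then the triplet of \<open>- X\<close> is \<open>(- b, \<sigma>2, \<nu>')\<close> with
  \<open>\<nu>'\<close> the reflection of \<open>\<nu>\<close>.\<close>

definition adjoint_generator ::
  "real \<Rightarrow> real \<Rightarrow> real measure \<Rightarrow> (real \<Rightarrow> real) \<Rightarrow> real \<Rightarrow> real" where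
  "adjoint_generator b \<sigma>2 \<nu> = generator (- b) \<sigma>2 (distr \<nu> borel uminus)"

text \<open>\<open>A f = h\<close> for the weakly extended generator \<open>A\<close>. Integrability is demanded
  explicitly because the Bochner integral of a non-integrable function is 0.\<close>

definition weak_generator_eq ::
  "real \<Rightarrow> real \<Rightarrow> real measure \<Rightarrow> (real \<Rightarrow> real) \<Rightarrow> (real \<Rightarrow> real) \<Rightarrow> bool" where
  "weak_generator_eq b \<sigma>2 \<nu> f h \<longleftrightarrow>
     (\<forall>\<phi>. test_function \<phi> \<longrightarrow>
        integrable lborel (\<lambda>x. f x * adjoint_generator b \<sigma>2 \<nu> \<phi> x) \<and>
        integrable lborel (\<lambda>x. h x * \<phi> x) \<and>
        (LINT x|lborel. f x * adjoint_generator b \<sigma>2 \<nu> \<phi> x) = (LINT x|lborel. h x * \<phi> x))"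

section \<open>Transition densities\<close>

definition transition_density ::
  "'a measure \<Rightarrow> (real \<Rightarrow> 'a \<Rightarrow> real) \<Rightarrow> (real \<Rightarrow> real \<Rightarrow> real) \<Rightarrow> bool" where
  "transition_density M X p \<longleftrightarrow>
     (\<forall>t>0. (\<forall>x. 0 \<le> p t x) \<and> distributed M lborel (X t) (\<lambda>x. ennreal (p t x)))"

definition positive_on_line :: "(real \<Rightarrow> real \<Rightarrow> real) \<Rightarrow> bool" where
  "positive_on_line p \<longleftrightarrow> (\<exists>t>0. \<forall>x. 0 < p t x)"

definition positive_on_half_line :: "(real \<Rightarrow> real \<Rightarrow> real) \<Rightarrow> bool" where
  "positive_on_half_line p \<longleftrightarrow> (\<exists>t>0. (\<forall>x<0. p t x = 0) \<and> (\<forall>x>0. 0 < p t x))"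

text \<open>The part of the line that the process, started at 0, can reach. In the half-line case the
  process is a subordinator and never sees the values of a function on \<open>(-\<infinity>, 0)\<close>, so no
  statement about \<open>g (X t)\<close> can determine \<open>g\<close> there: for a gamma process, every bounded positive
  Borel function \<open>g\<close> with \<open>g = 1\<close> on \<open>[0, \<infinity>)\<close> yields the constant martingale 1.\<close>

definition state_space :: "(real \<Rightarrow> real \<Rightarrow> real) \<Rightarrow> real set" where
  "state_space p = (if positive_on_half_line p then {0<..} else UNIV)"

definition exponential_solutions ::
  "'a measure \<Rightarrow> (real \<Rightarrow> 'a \<Rightarrow> real) \<Rightarrow> real \<Rightarrow> real set" where
  "exponential_solutions M X \<alpha> =
     {l. \<forall>t>0. integrable M (\<lambda>\<omega>. exp (l * X t \<omega>)) \<and>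
               (LINT \<omega>|M. exp (l * X t \<omega>)) = exp (\<alpha> * t)}"

end

theory Submission
  imports Defs
begin

text \<open>
Let \<open>P\<close> be convolution with the law \<open>\<mu>\<close> of \<open>X T\<close>, where \<open>T = 2 t\<close> and \<open>p t\<close> is the
positive density. The martingale property between \<open>t\<close> and \<open>t + T\<close> gives \<open>P g = C g\<close> almost
everywhere on the state space \<open>I\<close>, and \<open>\<mu> = p t * p t\<close> dominates a multiple of Lebesgue
measure on every compact interval of \<open>I\<close>.

Replace \<open>g\<close> by the smooth function \<open>W(x) = \<integral>\<^sub>0\<^sup>\<infinity> s e\<^bsup>-Ks\<^esup> g(x + s) ds\<close>, which satisfies \<open>P W = C W\<close>
on \<open>I\<close>, and put \<open>l = sup W'/W\<close>. Then \<open>l W - W'\<close> is nonnegative and harmonic; at points where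
\<open>W'/W\<close> is nearly maximal it is small, hence small on whole neighbourhoods, and the translates
of \<open>W\<close> along such points converge to \<open>e\<^bsup>ly\<^esup>\<close> after normalisation. By Fatou \<open>\<integral> e\<^bsup>ly\<^esup> d\<mu> \<le> C\<close>, and
then by dominated convergence equality holds. On the half line \<open>W e\<^bsup>-lx\<^esup>\<close> is monotone and
harmonic for a tilted probability measure, so it is constant. On the line one also has
\<open>l' = inf W'/W\<close>, and a maximum principle for \<open>W - a e\<^bsup>lx\<^esup> - a' e\<^bsup>l'x\<^esup>\<close> divided by \<open>e\<^bsup>lx\<^esup> + e\<^bsup>l'x\<^esup>\<close>
shows that \<open>W\<close> is a mixture of the two exponentials. Inverting the smoothing recovers \<open>g\<close>.

For the generator, Gaussians \<open>e\<^bsup>my - ay\<^sup>2/2\<^esup>\<close> are Fourier transforms, so Dynkin's formula holds for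
them. As \<open>e\<^bsup>ly\<^esup> - e\<^bsup>ly - y\<^sup>2/2\<^esup>\<close> is nonnegative and vanishes to second order at 0, its small-time
expectations bound the exponential moment of \<open>\<nu>\<close>; letting \<open>a\<close> tend to 0 in Dynkin's formula
identifies \<open>\<alpha>\<close> with the Laplace exponent at \<open>l\<close>. Fubini and integration by parts do the rest.
\<close>

section \<open>Maximal exponential growth rate of a positive harmonic function\<close>

text \<open>The martingale property yields an identity only almost everywhere, only on the state
  space, and for a merely measurable \<open>g\<close>. Smoothing therefore uses a kernel on the
  nonnegative half line: shifts to the right never leave \<open>I\<close>. The kernel
  \<open>s e^{-Ks}\<close> is the convolution square of \<open>e^{-Ks}\<close>, that is, the
  resolvent of the translations applied twice. One application turns the almost everywhere identity
  into one at every point of \<open>I\<close> and gives a continuous \<open>V\<close>; the second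
  gives a differentiable \<open>W\<close> with \<open>W' = K W - V\<close>. As \<open>V\<close> is
  positive and harmonic, \<open>W'\<close> is harmonic too and \<open>W' <= K W\<close> comes for
  free.

  Doubling the time has a similar reason: \<open>p t\<close> is positive but need not be bounded
  below on any interval, whereas its convolution square is.

  The classification uses the single time step \<open>T\<close>, so exponential moments come out at
  time \<open>T\<close> only. Multiplicativity in time, together with right-continuity of the paths
  at 0, spreads them to all times; this is where \<open>\<alpha>\<close> arises, as
  \<open>ln C / T\<close>.\<close>

definition locally_minorized :: "real measure \<Rightarrow> real set \<Rightarrow> bool" where
  "locally_minorized \<mu> I \<longleftrightarrow> (\<forall>u\<in>I. \<forall>v\<in>I. \<exists>c>0. \<forall>h\<in>borel_measurable borel.
     ennreal c * (\<integral>\<^sup>+y. h y * indicator {u..v} y \<partial>lborel) \<le> (\<integral>\<^sup>+y. h y \<partial>\<mu>))"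

text \<open>Turns a bound on a \<open>\<mu>\<close>-integral into a Lebesgue bound on
  \<open>[u, v]\<close>, with \<open>c\<close> chosen before \<open>E\<close> and \<open>B\<close>.
  For a nonnegative harmonic function, whose \<open>\<mu>\<close>-average around \<open>x\<close> is
  \<open>C\<close> times its value at \<open>x\<close>, it says that a small value at one point
  forces a small mean nearby: a Harnack inequality in mean.\<close>

lemma locally_minorized_bound:
  assumes "locally_minorized \<mu> I" "u \<in> I" "v \<in> I"
  obtains c where "c > 0" "\<And>E B. E \<in> borel_measurable borel \<Longrightarrow> (AE y in \<mu>. 0 \<le> E y) \<Longrightarrow> integrable \<mu> E \<Longrightarrow>
     (\<integral>y. E y \<partial>\<mu>) \<le> B \<Longrightarrow> (\<integral>\<^sup>+y. ennreal (E y) * indicator {u..v} y \<partial>lborel) \<le> ennreal (B / c)"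
proof -
  obtain c where c: "c > 0" and m: "\<And>h. h \<in> borel_measurable borel \<Longrightarrow>
     ennreal c * (\<integral>\<^sup>+y. h y * indicator {u..v} y \<partial>lborel) \<le> (\<integral>\<^sup>+y. h y \<partial>\<mu>)"
    using assms unfolding locally_minorized_def by meson
  show thesis
  proof (rule that[OF c])
    fix E :: "real \<Rightarrow> real" and B :: real
    assume E: "E \<in> borel_measurable borel" "AE y in \<mu>. 0 \<le> E y" "integrable \<mu> E" "(\<integral>y. E y \<partial>\<mu>) \<le> B"
    let ?N = "\<integral>\<^sup>+y. ennreal (E y) * indicator {u..v} y \<partial>lborel"
    have "ennreal c * ?N \<le> (\<integral>\<^sup>+y. ennreal (E y) \<partial>\<mu>)"
      by (rule m) (use E in measurable)
    also have "\<dots> = ennreal (\<integral>y. E y \<partial>\<mu>)" by (rule nn_integral_eq_integral) (use E in auto)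
    also have "\<dots> \<le> ennreal B" using E by (simp add: ennreal_leI)
    finally have *: "ennreal c * ?N \<le> ennreal B" .
    have "?N = ennreal (1/c) * (ennreal c * ?N)"
      using c by (simp add: mult.assoc[symmetric] ennreal_mult[symmetric])
    also have "\<dots> \<le> ennreal (1/c) * ennreal B" by (intro mult_left_mono *) auto
    also have "\<dots> = ennreal (B / c)" using c by (simp add: ennreal_mult'[symmetric])
    finally show "?N \<le> ennreal (B / c)" .
  qed
qed

text \<open>Near-maximisers \<open>x n\<close> of \<open>W1 / W\<close> are shifted to \<open>x n + d\<close> because \<open>\<mu>\<close> is only
  minorized on compact subsets of the possibly half-open \<open>I\<close>; assumption \<open>low\<close> keeps \<open>W (x n + d)\<close>
  comparable with \<open>W (x n)\<close>.\<close>

lemma exists_maximal_exponent: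
  fixes I :: "real set" and \<mu> :: "real measure" and W W1 :: "real \<Rightarrow> real"
  assumes I: "is_interval I" "{0<..} \<subseteq> I" "\<And>x y. x \<in> I \<Longrightarrow> y \<in> I \<Longrightarrow> x + y \<in> I"
    and AE_I: "AE y in \<mu>. y \<in> I"
    and minor: "locally_minorized \<mu> I"
    and Wpos: "\<And>x. 0 < W x"
    and deriv: "\<And>x. (W has_real_derivative W1 x) (at x)"
    and W1m: "W1 \<in> borel_measurable borel"
    and bdd: "\<And>x. x \<in> I \<Longrightarrow> W1 x \<le> L * W x"
    and Cpos: "0 < C"
    and eqW: "\<And>x. x \<in> I \<Longrightarrow> has_bochner_integral \<mu> (\<lambda>y. W (x + y)) (C * W x)"
    and eqW1: "\<And>x. x \<in> I \<Longrightarrow> has_bochner_integral \<mu> (\<lambda>y. W1 (x + y)) (C * W1 x)"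
    and low: "\<And>M. \<exists>d>0. \<exists>c>0. \<forall>x\<in>I. - M * W x \<le> W1 x \<longrightarrow> c * W x \<le> W (x + d)"
  obtains l z where "\<And>x. x \<in> I \<Longrightarrow> W1 x \<le> l * W x" "\<And>n. z n \<in> I"
    "\<And>y. y \<in> I \<Longrightarrow> (\<lambda>n::nat. W (z n + y) / W (z n)) \<longlonglongrightarrow> exp (l * y)"
proof -
  have Ine: "I \<noteq> {}" using I(2) by auto
  define l where "l = (SUP x\<in>I. W1 x / W x)"
  have bddA: "bdd_above ((\<lambda>x. W1 x / W x) ` I)"
    by (rule bdd_aboveI[of _ L]) (use bdd Wpos in \<open>auto simp: divide_le_eq\<close>)
  have le: "W1 x \<le> l * W x" if "x \<in> I" for x
  proof -
    have "W1 x / W x \<le> l" unfolding l_def by (rule cSUP_upper[OF that bddA])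
    then show ?thesis using Wpos[of x] by (simp add: divide_le_eq)
  qed
  have "\<exists>x\<in>I. l - 1 / Suc n < W1 x / W x" for n
    using less_cSUP_iff[OF Ine bddA, of "l - 1 / Suc n"] by (simp flip: l_def)
  then obtain x where x: "\<And>n. x n \<in> I" and xl: "\<And>n. l - 1 / Suc n < W1 (x n) / W (x n)" by metis
  have xl': "l * W (x n) - W1 (x n) \<le> W (x n) / Suc n" for n
  proof -
    have "(l - 1 / Suc n) * W (x n) \<le> W1 (x n)"
      using xl[of n] Wpos[of "x n"] by (simp add: less_divide_eq)
    then show ?thesis by (simp add: left_diff_distrib)
  qed
  obtain d c where d: "d > 0" and c: "c > 0"
    and dc: "\<And>x. x \<in> I \<Longrightarrow> - (\<bar>l\<bar> + 1) * W x \<le> W1 x \<Longrightarrow> c * W x \<le> W (x + d)"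
    using low[of "\<bar>l\<bar> + 1"] by blast
  have dI: "d \<in> I" using d I(2) by auto
  define z where "z n = x n + d" for n
  have zI: "z n \<in> I" for n unfolding z_def by (rule I(3)[OF x dI])
  have Wz: "c * W (x n) \<le> W (z n)" for n
    unfolding z_def
  proof (rule dc[OF x])
    \<comment> \<open>Since \<open>1 / Suc n <= 1\<close>, near-maximisers satisfy
      \<open>W1 / W >= l - 1\<close>, which is why \<open>low\<close> was invoked with
      \<open>M = |l| + 1\<close>.\<close>
    have "W (x n) / Suc n \<le> W (x n)" using Wpos[of "x n"] by (simp add: divide_le_eq)
    then have "(l - 1) * W (x n) \<le> W1 (x n)" using xl'[of n] by (simp add: left_diff_distrib)
    moreover have "- (\<bar>l\<bar> + 1) * W (x n) \<le> (l - 1) * W (x n)"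
      by (rule mult_right_mono) (use Wpos[of "x n"] in \<open>auto\<close>)
    ultimately show "- (\<bar>l\<bar> + 1) * W (x n) \<le> W1 (x n)" by linarith
  qed
  have contW: "continuous_on UNIV W"
    using deriv by (meson DERIV_isCont continuous_at_imp_continuous_on)
  have Wm: "W \<in> borel_measurable borel" by (rule borel_measurable_continuous_onI[OF contW])
  define D where "D s = l * W s - W1 s" for s
  have Dm[measurable]: "D \<in> borel_measurable borel" unfolding D_def using Wm W1m by measurable
  have lim: "(\<lambda>n. W (z n + y) / W (z n)) \<longlonglongrightarrow> exp (l * y)" if y: "y \<in> I" for y
  proof -
    \<comment> \<open>\<open>y\<close> may be negative when \<open>I\<close> is the whole line;
      ordering the two endpoints treats both signs at once.\<close>
    define u where "u = min d (d + y)"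
    define v where "v = max d (d + y)"
    have uv: "u \<in> I" "v \<in> I" "u \<le> v" unfolding u_def v_def using dI I(3)[OF dI y] by (auto simp: min_def max_def)
    obtain cm where cm: "cm > 0" and mm: "\<And>E B. E \<in> borel_measurable borel \<Longrightarrow> (AE y in \<mu>. 0 \<le> E y) \<Longrightarrow> integrable \<mu> E \<Longrightarrow>
     (\<integral>y. E y \<partial>\<mu>) \<le> B \<Longrightarrow> (\<integral>\<^sup>+y. ennreal (E y) * indicator {u..v} y \<partial>lborel) \<le> ennreal (B / cm)"
      using locally_minorized_bound[OF minor uv(1,2)] by metis
    define E where "E = exp (\<bar>l\<bar> * (\<bar>u\<bar> + \<bar>v\<bar>))"
    have E0: "E > 0" unfolding E_def by simp
    define Q where "Q = exp (l * d) * E * C / (cm * c)"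
    \<comment> \<open>The oscillation of \<open>W(s) e^{-ls}\<close> between \<open>x n + d\<close>
      and \<open>x n + d + y\<close> is the integral of \<open>D(s) e^{-ls}\<close>, and harmonicity
      of \<open>D\<close> bounds it by the tiny \<open>D (x n)\<close>. The constant
      \<open>Q\<close> collects the exponential factors, \<open>C\<close>, the minorization constant
      and \<open>c\<close>; it does not depend on \<open>n\<close>.\<close>
    have key: "\<bar>W (z n + y) / W (z n) * exp (- l * y) - 1\<bar> \<le> Q / Suc n" for n
    proof -
      let ?k = "\<lambda>s. W (x n + s) * exp (- l * (x n + s))"
      let ?r = "W (x n) / Suc n"
      have inI: "x n + s \<in> I" if "s \<in> I" for s using I(3)[OF x that] .
      have uvI: "s \<in> I" if "s \<in> {u..v}" for s
        by (rule mem_is_interval_1_I[OF I(1) uv(1,2)]) (use that in auto)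
      have D0: "0 \<le> D (x n + s)" if "s \<in> {u..v}" for s
        using le[OF inI[OF uvI[OF that]]] unfolding D_def by simp
      have der: "((\<lambda>s. - ?k s) has_real_derivative D (x n + s) * exp (- l * (x n + s))) (at s)" for s
      proof -
        have "((\<lambda>s. W (x n + s)) has_real_derivative W1 (x n + s)) (at s)"
          using DERIV_shift[of W "W1 (x n + s)" "s" "x n"] deriv[of "x n + s"] by (simp add: add.commute)
        then show ?thesis
          by (auto intro!: derivative_eq_intros simp: D_def algebra_simps)
      qed
      have b1: "(\<integral>\<^sup>+s. ennreal (D (x n + s)) * indicator {u..v} s \<partial>lborel) \<le> ennreal (C * ?r / cm)"
      proof (rule mm)
        show "(\<lambda>y. D (x n + y)) \<in> borel_measurable borel" by measurable
        show "AE y in \<mu>. 0 \<le> D (x n + y)" using AE_I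
          by (rule AE_mp) (use le inI in \<open>auto simp: D_def\<close>)
        have hb: "has_bochner_integral \<mu> (\<lambda>y. D (x n + y)) (l * (C * W (x n)) - C * W1 (x n))"
          unfolding D_def by (intro has_bochner_integral_diff has_bochner_integral_mult_right eqW eqW1 x)
        then show "integrable \<mu> (\<lambda>y. D (x n + y))" by (rule integrable.intros)
        have "(\<integral>y. D (x n + y) \<partial>\<mu>) = C * (l * W (x n) - W1 (x n))"
          using has_bochner_integral_integral_eq[OF hb] by (simp add: right_diff_distrib)
        also have "\<dots> \<le> C * ?r" using xl'[of n] Cpos by (intro mult_left_mono) auto
        finally show "(\<integral>y. D (x n + y) \<partial>\<mu>) \<le> C * ?r" .
      qed
      have ftc: "(\<integral>\<^sup>+s. ennreal (D (x n + s) * exp (- l * (x n + s))) * indicator {u..v} s \<partial>lborel)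
          = ennreal (- ?k v - - ?k u)"
        by (rule nn_integral_FTC_Icc) (use D0 der uv in \<open>auto\<close>)
      have "- ?k u \<le> - ?k v"
        by (rule DERIV_nonneg_imp_nondecreasing[OF uv(3)])
           (use der D0 in \<open>metis atLeastAtMost_iff exp_ge_zero mult_nonneg_nonneg\<close>)
      then have kuv: "?k v \<le> ?k u" by simp
      have "ennreal (?k u - ?k v) = (\<integral>\<^sup>+s. ennreal (D (x n + s) * exp (- l * (x n + s))) * indicator {u..v} s \<partial>lborel)"
        unfolding ftc by simp
      also have "\<dots> \<le> (\<integral>\<^sup>+s. ennreal (exp (- l * x n) * E) * (ennreal (D (x n + s)) * indicator {u..v} s) \<partial>lborel)"
      proof (rule nn_integral_mono)
        fix s
        show "ennreal (D (x n + s) * exp (- l * (x n + s))) * indicator {u..v} s \<le> ennreal (exp (- l * x n) * E) * (ennreal (D (x n + s)) * indicator {u..v} s)"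
        proof (cases "s \<in> {u..v}")
          case True
          have "- l * s \<le> \<bar>l\<bar> * \<bar>s\<bar>" by (metis abs_ge_self abs_minus_cancel abs_mult)
          also have "\<dots> \<le> \<bar>l\<bar> * (\<bar>u\<bar> + \<bar>v\<bar>)" using True by (intro mult_left_mono) auto
          finally have "exp (- l * s) \<le> E" unfolding E_def by simp
          then have "exp (- l * x n) * exp (- l * s) \<le> exp (- l * x n) * E" by simp
          then have "exp (- l * (x n + s)) \<le> exp (- l * x n) * E" by (simp add: exp_add[symmetric] algebra_simps)
          then have "D (x n + s) * exp (- l * (x n + s)) \<le> D (x n + s) * (exp (- l * x n) * E)"
            using D0[OF True] by (intro mult_left_mono)
          then have "ennreal (D (x n + s) * exp (- l * (x n + s))) \<le> ennreal (D (x n + s) * (exp (- l * x n) * E))"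
            by (rule ennreal_leI)
          then show ?thesis using True D0[OF True] E0 by (simp add: ennreal_mult' mult.commute)
        qed simp
      qed
      also have "\<dots> = ennreal (exp (- l * x n) * E) * (\<integral>\<^sup>+s. ennreal (D (x n + s)) * indicator {u..v} s \<partial>lborel)"
        by (rule nn_integral_cmult) measurable
      also have "\<dots> \<le> ennreal (exp (- l * x n) * E) * ennreal (C * ?r / cm)"
        by (rule mult_left_mono[OF b1]) simp
      also have "\<dots> = ennreal (exp (- l * x n) * E * (C * ?r / cm))"
        by (rule ennreal_mult'[symmetric]) (use E0 in simp)
      finally have "?k u - ?k v \<le> exp (- l * x n) * E * (C * ?r / cm)"
        by (rule ennreal_le_iff[THEN iffD1, rotated])
          (use Cpos cm Wpos[of "x n"] E0 in \<open>simp add: less_imp_le\<close>)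
      \<comment> \<open>The ratios are normalised at the shifted point \<open>z n\<close>, so
        \<open>W (x n)\<close> is exchanged for \<open>W (z n)\<close>; \<open>low\<close> pays for
        this with the factor \<open>1 / c\<close>.\<close>
      also have "\<dots> \<le> exp (- l * x n) * E * (C * (W (z n) / c / Suc n) / cm)"
      proof -
        have "W (x n) \<le> W (z n) / c" using Wz[of n] c by (simp add: field_simps)
        then show ?thesis using Cpos cm E0
          by (intro mult_left_mono divide_right_mono) auto
      qed
      finally have kk: "?k u - ?k v \<le> exp (- l * x n) * E * (C * (W (z n) / c / Suc n) / cm)" .
      have "\<bar>?k (d + y) - ?k d\<bar> = ?k u - ?k v"
        using kuv unfolding u_def v_def by (auto simp: min_def max_def)
      then have k2: "\<bar>?k (d + y) - ?k d\<bar> \<le> exp (- l * x n) * E * (C * (W (z n) / c / Suc n) / cm)" using kk by simp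
      have e1: "exp (l * z n) * exp (- l * (x n + (d + y))) = exp (- l * y)"
        "exp (l * z n) * exp (- l * (x n + d)) = 1"
        unfolding z_def exp_add[symmetric] by (simp_all add: algebra_simps)
      have "exp (l * z n) / W (z n) * (?k (d + y) - ?k d)
        = W (z n + y) / W (z n) * (exp (l * z n) * exp (- l * (x n + (d + y)))) - W (z n) / W (z n) * (exp (l * z n) * exp (- l * (x n + d)))"
        unfolding z_def by (simp add: right_diff_distrib add.assoc mult_ac)
      also have "\<dots> = W (z n + y) / W (z n) * exp (- l * y) - 1"
        unfolding e1 using Wpos[of "z n"] by simp
      finally have "\<bar>W (z n + y) / W (z n) * exp (- l * y) - 1\<bar> = exp (l * z n) / W (z n) * \<bar>?k (d + y) - ?k d\<bar>"
        using Wpos[of "z n"] by (metis abs_mult abs_of_pos exp_gt_zero divide_pos_pos)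
      also have "\<dots> \<le> exp (l * z n) / W (z n) * (exp (- l * x n) * E * (C * (W (z n) / c / Suc n) / cm))"
        by (rule mult_left_mono[OF k2]) (use Wpos[of "z n"] in simp)
      also have "\<dots> = exp (l * z n) * exp (- l * x n) * (E * C / (cm * c) / Suc n)"
        using Wpos[of "z n"] by (simp add: divide_simps)
      also have "exp (l * z n) * exp (- l * x n) = exp (l * d)" unfolding z_def exp_add[symmetric] by (simp add: algebra_simps)
      finally show ?thesis unfolding Q_def by (simp add: mult.assoc)
    qed
    have "(\<lambda>n. Q / Suc n) \<longlonglongrightarrow> 0"
      by (rule LIMSEQ_Suc[OF lim_const_over_n])
    then have "(\<lambda>n. W (z n + y) / W (z n) * exp (- l * y) - 1) \<longlonglongrightarrow> 0"
      by (rule Lim_null_comparison[rotated]) (use key in \<open>auto intro!: always_eventually\<close>)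
    then have "(\<lambda>n. (W (z n + y) / W (z n) * exp (- l * y) - 1 + 1) * exp (l * y)) \<longlonglongrightarrow> (0 + 1) * exp (l * y)"
      by (intro tendsto_intros)
    then show ?thesis by (simp add: mult.assoc exp_add[symmetric])
  qed
  show thesis by (rule that[OF le zI lim])
qed

section \<open>Classification of smooth positive harmonic functions\<close>

text \<open>The derivative of \<open>W(s) e^{-ls}\<close> is \<open>(W1 - l W) e^{-ls}\<close>, so
  the differential inequality is monotonicity of the tilted function. Applied to \<open>- W\<close>
  it also gives the lower estimates.\<close>

lemma exp_growth_bound:
  fixes W W1 :: "real \<Rightarrow> real"
  assumes deriv: "\<And>x. (W has_real_derivative W1 x) (at x)"
    and le: "\<And>s. x \<le> s \<Longrightarrow> s \<le> y \<Longrightarrow> W1 s \<le> l * W s" and xy: "x \<le> y"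
  shows "W y * exp (- l * y) \<le> W x * exp (- l * x)"
proof -
  have "- (W x * exp (- l * x)) \<le> - (W y * exp (- l * y))"
  proof (rule DERIV_nonneg_imp_nondecreasing[OF xy])
    fix s assume s: "x \<le> s" "s \<le> y"
    have "((\<lambda>s. - (W s * exp (- l * s))) has_real_derivative (l * W s - W1 s) * exp (- l * s)) (at s)"
      by (auto intro!: derivative_eq_intros deriv simp: algebra_simps)
    then show "\<exists>d. ((\<lambda>s. - (W s * exp (- l * s))) has_real_derivative d) (at s) \<and> 0 \<le> d"
      using le[OF s] by (intro exI[of _ "(l * W s - W1 s) * exp (- l * s)"]) auto
  qed
  then show ?thesis by simp
qed

lemma exp_shift_le:
  fixes A B l x y :: real
  assumes "A * exp (- l * (x + y)) \<le> B * exp (- l * x)"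
  shows "A \<le> B * exp (l * y)"
proof -
  have "exp (- l * x) = exp (l * y) * exp (- l * (x + y))"
    unfolding exp_add[symmetric] by (simp add: algebra_simps)
  then have "A * exp (- l * (x + y)) \<le> (B * exp (l * y)) * exp (- l * (x + y))"
    using assms by (simp add: mult.assoc)
  then show ?thesis by (simp add: mult_le_cancel_right)
qed

lemma antimono_tendsto_Inf:
  fixes k :: "real \<Rightarrow> real"
  assumes anti: "\<And>x y. x \<le> y \<Longrightarrow> k y \<le> k x" and bdd: "bdd_below (range k)"
  shows "(k \<longlongrightarrow> Inf (range k)) at_top"
proof (rule order_tendstoI)
  fix a assume "a < Inf (range k)"
  then show "\<forall>\<^sub>F x in at_top. a < k x"
    by (intro always_eventually allI) (meson bdd cINF_lower less_le_trans UNIV_I)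
next
  fix a assume "Inf (range k) < a"
  then obtain x where "k x < a" using cInf_lessD[of "range k" a] by auto
  then show "\<forall>\<^sub>F x in at_top. k x < a"
    by (intro eventually_at_top_linorderI[of x]) (meson anti le_less_trans)
qed

section \<open>Exponential moments as limits of normalised translates\<close>

context
  fixes \<mu> :: "real measure" and W :: "real \<Rightarrow> real" and C l :: real and z :: "nat \<Rightarrow> real"
  assumes sets_mu[measurable_cong]: "sets \<mu> = sets borel"
    and Wpos: "\<And>x. 0 < W x" and Wm[measurable]: "W \<in> borel_measurable borel" and Cpos: "0 < C"
    and eqz: "\<And>n. has_bochner_integral \<mu> (\<lambda>y. W (z n + y)) (C * W (z n))"
    and lim: "AE y in \<mu>. (\<lambda>n. W (z n + y) / W (z n)) \<longlonglongrightarrow> exp (l * y)"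
begin

lemma integral_ratio: "has_bochner_integral \<mu> (\<lambda>y. W (z n + y) / W (z n)) C"
  using has_bochner_integral_divide_zero[OF eqz[of n], of "W (z n)"] Wpos[of "z n"] by simp

text \<open>Each normalised translate integrates to \<open>C\<close>, and Fatou's lemma passes this
  bound to the limit. It precedes the value of the integral because the exponentials found
  integrable here later supply the majorant \<open>F\<close> of
  \<open>limit_exponential_integral\<close>.\<close>

lemma limit_exponential_integrable: "integrable \<mu> (\<lambda>y. exp (l * y))"
proof -
  have "(\<integral>\<^sup>+y. ennreal (exp (l * y)) \<partial>\<mu>) = (\<integral>\<^sup>+y. liminf (\<lambda>n. ennreal (W (z n + y) / W (z n))) \<partial>\<mu>)"
  proof (rule nn_integral_cong_AE)
    show "AE y in \<mu>. ennreal (exp (l * y)) = liminf (\<lambda>n. ennreal (W (z n + y) / W (z n)))"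
      using lim by eventually_elim (auto intro!: lim_imp_Liminf[symmetric] tendsto_ennrealI)
  qed
  also have "\<dots> \<le> liminf (\<lambda>n. \<integral>\<^sup>+y. ennreal (W (z n + y) / W (z n)) \<partial>\<mu>)"
    by (rule nn_integral_liminf) measurable
  also have "(\<lambda>n. \<integral>\<^sup>+y. ennreal (W (z n + y) / W (z n)) \<partial>\<mu>) = (\<lambda>n. ennreal C)"
  proof
    fix n
    have "integrable \<mu> (\<lambda>y. W (z n + y) / W (z n))" "(\<integral>y. W (z n + y) / W (z n) \<partial>\<mu>) = C"
      using integral_ratio[of n] by (auto simp: has_bochner_integral_iff)
    then show "(\<integral>\<^sup>+y. ennreal (W (z n + y) / W (z n)) \<partial>\<mu>) = ennreal C"
      by (subst nn_integral_eq_integral) (auto simp: less_imp_le[OF Wpos])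
  qed
  finally have "(\<integral>\<^sup>+y. ennreal (exp (l * y)) \<partial>\<mu>) \<le> ennreal C" by (simp add: Liminf_const)
  then show ?thesis by (intro integrableI_nonneg) (auto intro: le_less_trans)
qed

lemma limit_exponential_integral:
  assumes "integrable \<mu> F" "\<And>n. AE y in \<mu>. W (z n + y) / W (z n) \<le> F y"
  shows "has_bochner_integral \<mu> (\<lambda>y. exp (l * y)) C"
proof -
  have "(\<lambda>n. \<integral>y. W (z n + y) / W (z n) \<partial>\<mu>) \<longlonglongrightarrow> (\<integral>y. exp (l * y) \<partial>\<mu>)"
  proof (rule integral_dominated_convergence[OF _ _ assms(1) lim])
    fix n
    show "AE y in \<mu>. norm (W (z n + y) / W (z n)) \<le> F y"
      using assms(2)[of n] by eventually_elim (use Wpos in \<open>auto simp: less_imp_le\<close>)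
  qed measurable
  moreover have "(\<integral>y. W (z n + y) / W (z n) \<partial>\<mu>) = C" for n
    using integral_ratio[of n] by (auto simp: has_bochner_integral_iff)
  ultimately have "(\<integral>y. exp (l * y) \<partial>\<mu>) = C" by (simp add: LIMSEQ_const_iff)
  then show ?thesis using limit_exponential_integrable by (simp add: has_bochner_integral_iff)
qed

end

text \<open>Together with the minorization this provides a point of equality in any prescribed
  nondegenerate interval, which is what both rigidity arguments need.\<close>

lemma nonneg_nn_integral_zero_ex:
  fixes E :: "real \<Rightarrow> real"
  assumes [measurable]: "E \<in> borel_measurable borel"
    and le: "(\<integral>\<^sup>+y. ennreal (E y) * indicator {u..v} y \<partial>lborel) \<le> 0" and uv: "u < v"
  shows "\<exists>y\<in>{u..v}. E y \<le> 0"
proof (rule ccontr)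
  assume "\<not> ?thesis"
  then have pos: "\<And>y. y \<in> {u..v} \<Longrightarrow> 0 < E y" by force
  have "(\<integral>\<^sup>+y. ennreal (E y) * indicator {u..v} y \<partial>lborel) = 0" using le by simp
  then have "AE y in lborel. ennreal (E y) * indicator {u..v} y = 0"
    by (subst (asm) nn_integral_0_iff_AE) auto
  then have "AE y in lborel. y \<notin> {u..v}"
    by eventually_elim (use pos in \<open>fastforce simp: indicator_def\<close>)
  then have "emeasure lborel {u..v} = 0"
    by (subst (asm) AE_iff_measurable[of "{u..v}"]) auto
  then show False using uv by simp
qed

text \<open>On the half line only the upper bound \<open>W1 <= L W\<close> is at hand, and it is
  enough: \<open>\<mu>\<close> charges positive \<open>y\<close> only, where \<open>up\<close>
  dominates the ratios by \<open>e^{ly}\<close> itself.\<close>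

lemma one_sided_classification:
  fixes \<mu> :: "real measure" and W W1 :: "real \<Rightarrow> real"
  assumes sets_mu[measurable_cong]: "sets \<mu> = sets borel"
    and AE_I: "AE y in \<mu>. y \<in> {0<..}"
    and minor: "locally_minorized \<mu> {0<..}"
    and Wpos: "\<And>x. 0 < W x"
    and deriv: "\<And>x. (W has_real_derivative W1 x) (at x)"
    and W1m: "W1 \<in> borel_measurable borel"
    and bdd: "\<And>x. x > 0 \<Longrightarrow> W1 x \<le> L * W x"
    and Cpos: "0 < C"
    and eqW: "\<And>x. x > 0 \<Longrightarrow> has_bochner_integral \<mu> (\<lambda>y. W (x + y)) (C * W x)"
    and eqW1: "\<And>x. x > 0 \<Longrightarrow> has_bochner_integral \<mu> (\<lambda>y. W1 (x + y)) (C * W1 x)"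
    and low: "\<And>M. \<exists>d>0. \<exists>c>0. \<forall>x\<in>{0<..}. - M * W x \<le> W1 x \<longrightarrow> c * W x \<le> W (x + d)"
  obtains l a where "a > 0" "\<And>x. x > 0 \<Longrightarrow> W x = a * exp (l * x)" "has_bochner_integral \<mu> (\<lambda>y. exp (l * y)) C"
proof -
  have Wm[measurable]: "W \<in> borel_measurable borel"
    using deriv by (intro borel_measurable_continuous_onI) (meson DERIV_isCont continuous_at_imp_continuous_on)
  obtain l z where le: "\<And>x. x > 0 \<Longrightarrow> W1 x \<le> l * W x" and z: "\<And>n. z n > 0"
    and lim: "\<And>y. y > 0 \<Longrightarrow> (\<lambda>n::nat. W (z n + y) / W (z n)) \<longlonglongrightarrow> exp (l * y)"
  proof (rule exists_maximal_exponent[where L=L, OF _ _ _ AE_I minor Wpos deriv W1m _ Cpos _ _ low])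
    fix l z
    assume *: "\<And>x. x \<in> {0<..} \<Longrightarrow> W1 x \<le> l * W x" "\<And>n. z n \<in> {0<..}"
      "\<And>y. y \<in> {0<..} \<Longrightarrow> (\<lambda>n::nat. W (z n + y) / W (z n)) \<longlonglongrightarrow> exp (l * y)"
    show thesis by (rule that[of l z]) (use * in simp_all)
  qed (use bdd eqW eqW1 in \<open>simp_all add: is_interval_convex_1\<close>)
  let ?k = "\<lambda>x. W x * exp (- l * x)"
  have anti: "?k y \<le> ?k x" if "0 < x" "x \<le> y" for x y
    by (rule exp_growth_bound[OF deriv]) (use that le in auto)
  have up: "W (x + y) \<le> W x * exp (l * y)" if "x > 0" "y > 0" for x y
    by (rule exp_shift_le[OF anti]) (use that in auto)
  have limAE: "AE y in \<mu>. (\<lambda>n. W (z n + y) / W (z n)) \<longlonglongrightarrow> exp (l * y)"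
    using AE_I by eventually_elim (use lim in auto)
  have hbe: "has_bochner_integral \<mu> (\<lambda>y. exp (l * y)) C"
  proof (rule limit_exponential_integral[OF sets_mu Wpos Wm Cpos eqW[OF z] limAE])
    show "integrable \<mu> (\<lambda>y. exp (l * y))"
      by (rule limit_exponential_integrable[OF sets_mu Wpos Wm Cpos eqW[OF z] limAE])
    show "AE y in \<mu>. W (z n + y) / W (z n) \<le> exp (l * y)" for n
      using AE_I by eventually_elim (use up[OF z[of n]] Wpos[of "z n"] in \<open>auto simp: field_simps\<close>)
  qed
  have const: "?k (x + s) = ?k x" if x: "x > 0" and s: "s > 0" for x s
  proof -
    \<comment> \<open>\<open>E\<close> is the defect in \<open>W (x + y) <= W x * e^{ly}\<close>,
      scaled by \<open>e^{-lx}\<close>. Both sides integrate to \<open>C * W x\<close>, so the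
      integral of \<open>E\<close> is zero.\<close>
    define E where "E y = ?k x * exp (l * y) - exp (- l * x) * W (x + y)" for y
    have Em[measurable]: "E \<in> borel_measurable borel" unfolding E_def by measurable
    obtain cm where cm: "cm > 0" and mm: "\<And>E B. E \<in> borel_measurable borel \<Longrightarrow> (AE y in \<mu>. 0 \<le> E y) \<Longrightarrow> integrable \<mu> E \<Longrightarrow>
     (\<integral>y. E y \<partial>\<mu>) \<le> B \<Longrightarrow> (\<integral>\<^sup>+y. ennreal (E y) * indicator {s..s+1} y \<partial>lborel) \<le> ennreal (B / cm)"
      using locally_minorized_bound[OF minor, of s "s + 1"] s by auto
    have hE: "has_bochner_integral \<mu> E (?k x * C - exp (- l * x) * (C * W x))"
      unfolding E_def by (intro has_bochner_integral_diff has_bochner_integral_mult_right hbe eqW x)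
    have "(\<integral>\<^sup>+y. ennreal (E y) * indicator {s..s+1} y \<partial>lborel) \<le> ennreal (0 / cm)"
    proof (rule mm[OF Em])
      show "AE y in \<mu>. 0 \<le> E y" using AE_I
        by eventually_elim (use up[OF x] in \<open>auto simp: E_def mult_ac\<close>)
      show "integrable \<mu> E" "integral\<^sup>L \<mu> E \<le> 0"
        using hE by (auto simp: has_bochner_integral_iff)
    qed
    \<comment> \<open>Equality at one \<open>y >= s\<close> suffices: \<open>W(x) e^{-lx}\<close>
      decreases, so it is constant from \<open>x\<close> up to \<open>x + y\<close>, in particular
      up to \<open>x + s\<close>.\<close>
    then obtain y where y: "y \<in> {s..s+1}" "E y \<le> 0"
      using nonneg_nn_integral_zero_ex[of E s "s + 1"] by auto
    have e: "exp (- l * (x + y)) = exp (- l * x) * exp (- l * y)"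
      unfolding exp_add[symmetric] by (simp add: algebra_simps)
    have "?k x = (?k x * exp (l * y)) * exp (- l * y)"
      by (simp add: mult.assoc flip: exp_add)
    also have "\<dots> \<le> (exp (- l * x) * W (x + y)) * exp (- l * y)"
      using y unfolding E_def by (intro mult_right_mono) auto
    also have "\<dots> = ?k (x + y)" unfolding e by (simp only: mult_ac)
    finally have "?k x \<le> ?k (x + y)" .
    also have "?k (x + y) \<le> ?k (x + s)" by (rule anti) (use x s y in auto)
    finally show ?thesis using anti[of x "x + s"] x s by auto
  qed
  have Wk: "W x = ?k x * exp (l * x)" for x
    by (simp add: mult.assoc flip: exp_add)
  have k1: "?k x = ?k 1" if "x > 0" for x
    using const[of 1 "x - 1"] const[of x "1 - x"] that by (cases x "1::real" rule: linorder_cases) auto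
  have "W x = ?k 1 * exp (l * x)" if "x > 0" for x
    by (subst Wk[of x]) (simp only: k1[OF that])
  then show thesis by (rule that[OF mult_pos_pos[OF Wpos exp_gt_zero] _ hbe])
qed

lemma two_sided_classification:
  fixes \<mu> :: "real measure" and W W1 :: "real \<Rightarrow> real"
  assumes sets_mu[measurable_cong]: "sets \<mu> = sets borel"
    and minor: "locally_minorized \<mu> UNIV"
    and Wpos: "\<And>x. 0 < W x"
    and deriv: "\<And>x. (W has_real_derivative W1 x) (at x)"
    and W1m[measurable]: "W1 \<in> borel_measurable borel"
    and bdd: "\<And>x. \<bar>W1 x\<bar> \<le> L * W x"
    and Cpos: "0 < C"
    and eqW: "\<And>x. has_bochner_integral \<mu> (\<lambda>y. W (x + y)) (C * W x)"
    and eqW1: "\<And>x. has_bochner_integral \<mu> (\<lambda>y. W1 (x + y)) (C * W1 x)"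
  obtains l1 l2 a1 a2 where "a1 \<ge> 0" "a2 \<ge> 0" "\<And>x. W x = a1 * exp (l1 * x) + a2 * exp (l2 * x)"
    "has_bochner_integral \<mu> (\<lambda>y. exp (l1 * y)) C" "has_bochner_integral \<mu> (\<lambda>y. exp (l2 * y)) C"
proof -
  have contW: "continuous_on UNIV W"
    using deriv by (meson DERIV_isCont continuous_at_imp_continuous_on)
  then have Wm[measurable]: "W \<in> borel_measurable borel" by (rule borel_measurable_continuous_onI)
  \<comment> \<open>Stated for arbitrary \<open>W\<close> and \<open>\<mu>\<close>, so that it also
    serves \<open>W(-x)\<close> under the reflected measure; minus the maximal exponent there is a
    lower bound of \<open>W1 / W\<close>.\<close>
  have step: "\<exists>l z. (\<forall>x. W1 x \<le> l * W x) \<and> (\<forall>y. (\<lambda>n::nat. W (z n + y) / W (z n)) \<longlonglongrightarrow> exp (l * y))"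
    if sets_mu[measurable_cong]: "sets \<mu> = sets borel" and minor: "locally_minorized \<mu> UNIV"
     and Wpos: "\<And>x. 0 < W x"
     and deriv: "\<And>x. (W has_real_derivative W1 x) (at x)"
     and W1m[measurable]: "W1 \<in> borel_measurable borel"
     and bdd: "\<And>x. \<bar>W1 x\<bar> \<le> L * W x"
     and eqW: "\<And>x. has_bochner_integral \<mu> (\<lambda>y. W (x + y)) (C * W x)"
     and eqW1: "\<And>x. has_bochner_integral \<mu> (\<lambda>y. W1 (x + y)) (C * W1 x)"
    for W W1 and \<mu> :: "real measure"
  proof -
    \<comment> \<open>The two-sided bound keeps \<open>W\<close> from dropping by more than the
      factor \<open>e^{-L}\<close> over a unit step, so \<open>low\<close> holds with
      \<open>d = 1\<close> and one constant for all \<open>M\<close>.\<close>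
    have step1: "exp (- L) * W x \<le> W (x + 1)" for x
    proof -
      have "(- W (x + 1)) * exp (- (- L) * (x + 1)) \<le> (- W x) * exp (- (- L) * x)"
      proof (rule exp_growth_bound)
        show "((\<lambda>x. - W x) has_real_derivative - W1 x) (at x)" for x
          by (intro derivative_intros deriv)
        show "- W1 s \<le> - L * - W s" for s using bdd[of s] by auto
      qed simp
      from exp_shift_le[OF this] show ?thesis by (simp add: mult.commute)
    qed
    have low: "\<exists>d>0. \<exists>c>0. \<forall>x\<in>UNIV. - M * W x \<le> W1 x \<longrightarrow> c * W x \<le> W (x + d)" for M
      by (rule exI[of _ 1], rule conjI, simp, rule exI[of _ "exp (- L)"]) (simp add: step1)
    show ?thesis
    proof (rule exists_maximal_exponent[where L=L, OF _ _ _ _ minor Wpos deriv W1m _ Cpos eqW eqW1 low])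
      fix l z
      assume *: "\<And>x. x \<in> UNIV \<Longrightarrow> W1 x \<le> l * W x"
        "\<And>y. y \<in> UNIV \<Longrightarrow> (\<lambda>n::nat. W (z n + y) / W (z n)) \<longlonglongrightarrow> exp (l * y)"
      show ?thesis by (intro exI[of _ l] exI[of _ z]) (use * in simp)
    qed (use bdd in \<open>simp_all add: abs_le_iff\<close>)
  qed
  obtain l1 z1 where le1: "\<And>x. W1 x \<le> l1 * W x"
    and lim1: "\<And>y. (\<lambda>n::nat. W (z1 n + y) / W (z1 n)) \<longlonglongrightarrow> exp (l1 * y)"
    using step[OF sets_mu minor Wpos deriv W1m bdd eqW eqW1] by blast
  define \<mu>' where "\<mu>' = distr \<mu> borel uminus"
  have minor': "locally_minorized \<mu>' UNIV"
    unfolding locally_minorized_def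
  proof (intro ballI)
    fix u v :: real
    obtain c where c: "c > 0" and m: "\<And>h. h \<in> borel_measurable borel \<Longrightarrow>
       ennreal c * (\<integral>\<^sup>+y. h y * indicator {-v..-u} y \<partial>lborel) \<le> (\<integral>\<^sup>+y. h y \<partial>\<mu>)"
      using minor unfolding locally_minorized_def by (metis UNIV_I)
    show "\<exists>c>0. \<forall>h\<in>borel_measurable borel. ennreal c * (\<integral>\<^sup>+y. h y * indicator {u..v} y \<partial>lborel) \<le> (\<integral>\<^sup>+y. h y \<partial>\<mu>')"
    proof (intro exI[of _ c] conjI c ballI)
      fix h :: "real \<Rightarrow> ennreal" assume [measurable]: "h \<in> borel_measurable borel"
      have "(\<integral>\<^sup>+y. h y * indicator {u..v} y \<partial>lborel) = (\<integral>\<^sup>+y. h (- y) * indicator {u..v} (- y) \<partial>lborel)"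
        by (subst nn_integral_real_affine[where c="-1" and t=0]) auto
      also have "\<dots> = (\<integral>\<^sup>+y. h (- y) * indicator {-v..-u} y \<partial>lborel)"
        by (intro nn_integral_cong) (auto simp: indicator_def)
      finally show "ennreal c * (\<integral>\<^sup>+y. h y * indicator {u..v} y \<partial>lborel) \<le> (\<integral>\<^sup>+y. h y \<partial>\<mu>')"
        using m[of "\<lambda>y. h (- y)"] unfolding \<mu>'_def by (subst nn_integral_distr) auto
    qed
  qed
  have eq': "has_bochner_integral \<mu>' (\<lambda>y. f (- (x + y))) (C * f (- x))"
    if [measurable]: "f \<in> borel_measurable borel" and f: "\<And>x. has_bochner_integral \<mu> (\<lambda>y. f (x + y)) (C * f x)"
    for f and x :: real
    unfolding \<mu>'_def by (rule has_bochner_integral_distr) (use f[of "- x"] in \<open>auto\<close>)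
  have "\<exists>l z. (\<forall>x. - W1 (- x) \<le> l * W (- x)) \<and> (\<forall>y. (\<lambda>n::nat. W (- (z n + y)) / W (- z n)) \<longlonglongrightarrow> exp (l * y))"
  proof (rule step[where \<mu>=\<mu>'])
    show "sets \<mu>' = sets borel" unfolding \<mu>'_def by simp
    show "locally_minorized \<mu>' UNIV" by (rule minor')
    show "((\<lambda>x. W (- x)) has_real_derivative - W1 (- x)) (at x)" for x
      using DERIV_chain2[OF deriv[of "- x"] DERIV_minus[OF DERIV_ident]] by simp
    show "\<bar>- W1 (- x)\<bar> \<le> L * W (- x)" for x using bdd[of "- x"] by simp
    show "has_bochner_integral \<mu>' (\<lambda>y. W (- (x + y))) (C * W (- x))" for x by (rule eq'[OF Wm eqW])
    show "has_bochner_integral \<mu>' (\<lambda>y. - W1 (- (x + y))) (C * - W1 (- x))" for x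
      using has_bochner_integral_minus[OF eq'[OF W1m eqW1]] by simp
  qed (use Wpos in auto)
  then obtain l' z' where le': "\<And>x. - W1 (- x) \<le> l' * W (- x)"
    and lim': "\<And>y. (\<lambda>n::nat. W (- (z' n + y)) / W (- z' n)) \<longlonglongrightarrow> exp (l' * y)" by blast
  define l2 where "l2 = - l'"
  define z2 where "z2 n = - z' n" for n
  have le2: "l2 * W x \<le> W1 x" for x using le'[of "- x"] unfolding l2_def by simp
  have lim2: "(\<lambda>n::nat. W (z2 n + y) / W (z2 n)) \<longlonglongrightarrow> exp (l2 * y)" for y
    using lim'[of "- y"] unfolding z2_def l2_def by simp
  have l21: "l2 \<le> l1" using le1[of 0] le2[of 0] Wpos[of 0] by (meson mult_le_cancel_right_pos order_trans)
  let ?k1 = "\<lambda>x. W x * exp (- l1 * x)" and ?k2 = "\<lambda>x. W x * exp (- l2 * x)"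
  have anti1: "?k1 y \<le> ?k1 x" if "x \<le> y" for x y
    by (rule exp_growth_bound[OF deriv]) (use that le1 in auto)
  have mono2: "?k2 x \<le> ?k2 y" if "x \<le> y" for x y
  proof -
    have "(- W y) * exp (- l2 * y) \<le> (- W x) * exp (- l2 * x)"
      by (rule exp_growth_bound[where ?W1.0="\<lambda>x. - W1 x"]) (use that le2 in \<open>auto intro!: derivative_intros deriv\<close>)
    then show ?thesis by simp
  qed
  have up1: "W (x + y) \<le> W x * exp (l1 * y)" if "y \<ge> 0" for x y
    by (rule exp_shift_le[OF anti1]) (use that in auto)
  have up2: "W (x + y) \<le> W x * exp (l2 * y)" if "y \<le> 0" for x y
    by (rule exp_shift_le[OF mono2]) (use that in auto)
  \<comment> \<open>Each exponential dominates on one side only, the larger rate for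
    \<open>y >= 0\<close> and the smaller one for \<open>y <= 0\<close>; by the Fatou step their sum
    is a \<open>\<mu>\<close>-integrable majorant.\<close>
  have up: "W (x + y) / W x \<le> exp (l1 * y) + exp (l2 * y)" for x y
  proof -
    have "W (x + y) \<le> W x * (exp (l1 * y) + exp (l2 * y))"
      using up1[of y x] up2[of y x] Wpos[of x] by (cases "y \<ge> 0") (auto simp: distrib_left intro: order_trans add_increasing add_increasing2)
    then show ?thesis using Wpos[of x] by (simp add: divide_le_eq mult.commute)
  qed
  have int: "integrable \<mu> (\<lambda>y. exp (l1 * y) + exp (l2 * y))"
    using limit_exponential_integrable[OF sets_mu Wpos Wm Cpos eqW AE_I2[OF lim1]]
      limit_exponential_integrable[OF sets_mu Wpos Wm Cpos eqW AE_I2[OF lim2]] by (rule Bochner_Integration.integrable_add)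
  have hb1: "has_bochner_integral \<mu> (\<lambda>y. exp (l1 * y)) C"
    by (rule limit_exponential_integral[OF sets_mu Wpos Wm Cpos eqW AE_I2[OF lim1] int]) (use up in auto)
  have hb2: "has_bochner_integral \<mu> (\<lambda>y. exp (l2 * y)) C"
    by (rule limit_exponential_integral[OF sets_mu Wpos Wm Cpos eqW AE_I2[OF lim2] int]) (use up in auto)
  show thesis
  proof (cases "l1 = l2")
    case True
    have Wk: "W x = ?k1 x * exp (l1 * x)" for x
      by (simp add: mult.assoc flip: exp_add)
    have k1: "?k1 x = ?k1 0" for x
      using anti1[of x 0] anti1[of 0 x] mono2[of x 0] mono2[of 0 x] True by (cases "x \<le> 0") auto
    have "W x = W 0 * exp (l1 * x) + 0 * exp (l1 * x)" for x
      by (subst Wk[of x]) (simp only: k1[of x], simp)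
    then show thesis by (rule that[OF _ _ _ hb1 hb1, rotated 2]) (simp_all add: Wpos less_imp_le)
  next
    case False
    with l21 have l: "l2 < l1" by simp
    have ex: "a \<ge> 0 \<and> (k \<longlongrightarrow> a) at_top" if "\<And>x y. x \<le> y \<Longrightarrow> k y \<le> k x" "\<And>x. 0 \<le> k x" "a = Inf (range k)" for k :: "real \<Rightarrow> real" and a
      unfolding that(3) by (intro conjI antimono_tendsto_Inf bdd_belowI[of _ 0] cINF_greatest) (use that in auto)
    \<comment> \<open>\<open>W e^{-l1 x}\<close> decreases and \<open>W e^{-l2 x}\<close> increases,
      so the coefficients can be read off as limits at plus and minus infinity. This choice is
      exactly what makes \<open>h\<close> vanish at both ends.\<close>
    define a where "a = Inf (range ?k1)"
    have a: "a \<ge> 0" "(?k1 \<longlongrightarrow> a) at_top"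
      using ex[OF anti1 _ a_def] Wpos by (auto simp: less_imp_le)
    define b where "b = Inf (range (\<lambda>x. ?k2 (- x)))"
    have b: "b \<ge> 0" "((\<lambda>x. ?k2 (- x)) \<longlongrightarrow> b) at_top"
      using ex[OF mono2 _ b_def] Wpos by (auto simp: less_imp_le)
    define Z where "Z x = W x - a * exp (l1 * x) - b * exp (l2 * x)" for x
    define w where "w x = exp (l1 * x) + exp (l2 * x)" for x
    have wpos: "w x > 0" for x unfolding w_def by (simp add: add_pos_pos)
    define h where "h x = \<bar>Z x\<bar> / w x" for x
    have [measurable]: "Z \<in> borel_measurable borel" "w \<in> borel_measurable borel" "h \<in> borel_measurable borel"
      unfolding h_def Z_def w_def by measurable
    have ch: "continuous_on UNIV h"
      unfolding h_def Z_def w_def using contW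
      by (intro continuous_intros) (auto simp: add_pos_pos less_imp_neq[symmetric])
    define q where "q = l1 - l2"
    have e0: "((\<lambda>x. exp (- q * x)) \<longlongrightarrow> 0) at_top"
      using l unfolding q_def
      by (intro filterlim_compose[OF exp_at_bot] filterlim_tendsto_neg_mult_at_bot[OF tendsto_const _ filterlim_ident]) auto
    have h1: "(h \<longlongrightarrow> 0) at_top"
    proof -
      have hx: "h = (\<lambda>x. \<bar>?k1 x - a - b * exp (- q * x)\<bar> / (1 + exp (- q * x)))"
      proof
        fix x
        have e: "exp (l1 * x) * exp (- q * x) = exp (l2 * x)" "exp (- l1 * x) * exp (l1 * x) = 1"
          unfolding q_def exp_add[symmetric] by (auto simp: algebra_simps)
        have "Z x = exp (l1 * x) * (?k1 x - a - b * exp (- q * x))"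
          unfolding Z_def using e by (simp add: algebra_simps)
        moreover have "w x = exp (l1 * x) * (1 + exp (- q * x))" unfolding w_def using e by (simp add: algebra_simps)
        ultimately show "h x = \<bar>?k1 x - a - b * exp (- q * x)\<bar> / (1 + exp (- q * x))" unfolding h_def by (simp add: abs_mult)
      qed
      have "((\<lambda>x. \<bar>?k1 x - a - b * exp (- q * x)\<bar> / (1 + exp (- q * x))) \<longlongrightarrow> \<bar>a - a - b * 0\<bar> / (1 + 0)) at_top"
        by (intro tendsto_intros a e0) auto
      then show ?thesis unfolding hx by simp
    qed
    have h2: "((\<lambda>x. h (- x)) \<longlongrightarrow> 0) at_top"
    proof -
      have hx: "(\<lambda>x. h (- x)) = (\<lambda>x. \<bar>?k2 (- x) - b - a * exp (- q * x)\<bar> / (1 + exp (- q * x)))"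
      proof
        fix x
        have e: "exp (- (l2 * x)) * exp (- q * x) = exp (- (l1 * x))" "exp (l2 * x) * exp (- (l2 * x)) = 1"
          unfolding q_def exp_add[symmetric] by (auto simp: algebra_simps)
        have "Z (- x) = exp (- (l2 * x)) * (?k2 (- x) - b - a * exp (- q * x))"
          unfolding Z_def using e by (simp add: algebra_simps)
        moreover have "w (- x) = exp (- (l2 * x)) * (1 + exp (- q * x))" unfolding w_def using e by (simp add: algebra_simps)
        ultimately show "h (- x) = \<bar>?k2 (- x) - b - a * exp (- q * x)\<bar> / (1 + exp (- q * x))" unfolding h_def by (simp add: abs_mult)
      qed
      have "((\<lambda>x. \<bar>?k2 (- x) - b - a * exp (- q * x)\<bar> / (1 + exp (- q * x))) \<longlongrightarrow> \<bar>b - b - a * 0\<bar> / (1 + 0)) at_top"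
        by (intro tendsto_intros b e0) auto
      then show ?thesis unfolding hx by simp
    qed
    have Z0: "Z x1 = 0" for x1
    proof (rule ccontr)
      assume "Z x1 \<noteq> 0"
      then have hx1: "h x1 > 0" unfolding h_def using wpos[of x1] by simp
      obtain R1 where R1: "\<And>x. x \<ge> R1 \<Longrightarrow> h x < h x1 / 2"
        using order_tendstoD(2)[OF h1, of "h x1 / 2"] hx1 unfolding eventually_at_top_linorder by auto
      obtain R2 where R2: "\<And>x. x \<ge> R2 \<Longrightarrow> h (- x) < h x1 / 2"
        using order_tendstoD(2)[OF h2, of "h x1 / 2"] hx1 unfolding eventually_at_top_linorder by auto
      define R where "R = max \<bar>R1\<bar> \<bar>R2\<bar>"
      have R: "h x < h x1 / 2" if "\<bar>x\<bar> \<ge> R" for x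
        using R1[of x] R2[of "- x"] that unfolding R_def by (cases "x \<ge> 0") auto
      have x1R: "x1 \<in> {- R..R}" using R[of x1] hx1 by (cases "\<bar>x1\<bar> \<ge> R") auto
      have "compact {- R..R}" "{- R..R} \<noteq> {}" using x1R by auto
      then obtain x0 where x0: "x0 \<in> {- R..R}" "\<And>x. x \<in> {- R..R} \<Longrightarrow> h x \<le> h x0"
        using continuous_attains_sup[OF _ _ continuous_on_subset[OF ch subset_UNIV], of "{-R..R}"] by metis
      have hx0: "h x1 \<le> h x0" using x0 x1R by auto
      have hmax: "h x \<le> h x0" for x
        using x0(2)[of x] R[of x] hx0 hx1 by (cases "\<bar>x\<bar> \<ge> R") (auto simp: not_le abs_less_iff)
      \<comment> \<open>\<open>w\<close> is harmonic, and \<open>C * |Z x0|\<close> is at most the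
        average of \<open>|Z|\<close> around \<open>x0\<close>. At the maximum point
        \<open>x0\<close> of \<open>h\<close> the nonnegative \<open>E\<close> therefore has
        nonpositive integral.\<close>
      define E where "E y = h x0 * w (x0 + y) - \<bar>Z (x0 + y)\<bar>" for y
      have [measurable]: "E \<in> borel_measurable borel" unfolding E_def by measurable
      have E0: "0 \<le> E y" for y
        using hmax[of "x0 + y"] wpos[of "x0 + y"] unfolding E_def h_def[of "x0 + y"] by (simp add: divide_le_eq)
      have hbexp: "has_bochner_integral \<mu> (\<lambda>y. exp (l * (x + y))) (C * exp (l * x))"
        if "has_bochner_integral \<mu> (\<lambda>y. exp (l * y)) C" for l x
        using has_bochner_integral_mult_right[OF that, of "exp (l * x)"] by (simp add: exp_add distrib_left mult_ac)
      have hw: "has_bochner_integral \<mu> (\<lambda>y. w (x0 + y)) (C * exp (l1 * x0) + C * exp (l2 * x0))"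
        unfolding w_def by (intro has_bochner_integral_add hbexp hb1 hb2)
      have hZ: "has_bochner_integral \<mu> (\<lambda>y. Z (x0 + y)) (C * W x0 - a * (C * exp (l1 * x0)) - b * (C * exp (l2 * x0)))"
        unfolding Z_def by (intro has_bochner_integral_diff has_bochner_integral_mult_right hbexp hb1 hb2 eqW)
      have iw: "integrable \<mu> (\<lambda>y. w (x0 + y))" "(\<integral>y. w (x0 + y) \<partial>\<mu>) = C * w x0"
        using hw by (auto simp: has_bochner_integral_iff w_def distrib_left)
      have iZ: "integrable \<mu> (\<lambda>y. Z (x0 + y))" "(\<integral>y. Z (x0 + y) \<partial>\<mu>) = C * Z x0"
        using hZ by (auto simp: has_bochner_integral_iff Z_def algebra_simps)
      have iE: "integrable \<mu> E" unfolding E_def using iw iZ by auto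
      have "integral\<^sup>L \<mu> E = h x0 * (C * w x0) - (\<integral>y. \<bar>Z (x0 + y)\<bar> \<partial>\<mu>)"
        unfolding E_def using iw iZ by simp
      also have "\<dots> \<le> h x0 * (C * w x0) - C * \<bar>Z x0\<bar>"
        using integral_abs_bound[of \<mu> "\<lambda>y. Z (x0 + y)"] iZ Cpos by (simp add: abs_mult)
      also have "\<dots> = 0" unfolding h_def using wpos[of x0] by simp
      finally have E1: "integral\<^sup>L \<mu> E \<le> 0" .
      \<comment> \<open>Chosen so that \<open>x0 + y >= R\<close> for all \<open>y\<close> in
        \<open>[u, u + 1]\<close>: there \<open>h\<close> is below \<open>h x1 / 2\<close>, and
        equality with the maximum is impossible.\<close>
      define u where "u = R + \<bar>x0\<bar>"
      obtain cm where cm: "cm > 0" and mm: "\<And>E B. E \<in> borel_measurable borel \<Longrightarrow> (AE y in \<mu>. 0 \<le> E y) \<Longrightarrow> integrable \<mu> E \<Longrightarrow>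
         (\<integral>y. E y \<partial>\<mu>) \<le> B \<Longrightarrow> (\<integral>\<^sup>+y. ennreal (E y) * indicator {u..u+1} y \<partial>lborel) \<le> ennreal (B / cm)"
        using locally_minorized_bound[OF minor, of u "u + 1"] by auto
      have "(\<integral>\<^sup>+y. ennreal (E y) * indicator {u..u+1} y \<partial>lborel) \<le> ennreal (0 / cm)"
        by (rule mm) (use E0 iE E1 in auto)
      then obtain y where y: "y \<in> {u..u+1}" "E y \<le> 0"
        using nonneg_nn_integral_zero_ex[of E u "u + 1"] by auto
      have "\<bar>x0 + y\<bar> \<ge> R" using y unfolding u_def by auto
      then have "h (x0 + y) < h x0" using R[of "x0 + y"] hx0 hx1 by auto
      then have "E y > 0" using wpos[of "x0 + y"] unfolding E_def h_def[of "x0 + y"] by (simp add: divide_less_eq)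
      then show False using y by simp
    qed
    have "W x = a * exp (l1 * x) + b * exp (l2 * x)" for x using Z0[of x] unfolding Z_def by simp
    then show thesis by (rule that[OF a(1) b(1) _ hb1 hb2])
  qed
qed

section \<open>Smoothing by the resolvent of the translation semigroup\<close>

lemma set_integrable_tail:
  fixes f :: "real \<Rightarrow> real"
  assumes "integrable lborel (\<lambda>s. indicator {y..} s * f s)" and S: "S \<subseteq> {y..}" "S \<in> sets borel"
  shows "set_integrable lborel S f"
proof -
  have "set_integrable lborel {y..} f" using assms by (simp add: set_integrable_def)
  then show ?thesis by (rule set_integrable_subset) (use S in auto)
qed

text \<open>Cutting at a fixed right end \<open>b\<close> leaves the dependence on \<open>y\<close>
  in an integral over a bounded interval, where continuity and the fundamental theorem of calculus
  are available.\<close>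

lemma tail_split:
  fixes f :: "real \<Rightarrow> real"
  assumes int: "\<And>x. integrable lborel (\<lambda>s. indicator {x..} s * f s)" and yb: "y \<le> b"
  shows "(LINT s|lborel. indicator {y..} s * f s) = integral {y..b} f + (LINT s|lborel. indicator {b<..} s * f s)"
    "f integrable_on {y..b}"
proof -
  have i1: "set_integrable lborel {y..b} f" by (rule set_integrable_tail[OF int]) auto
  have i2: "set_integrable lborel {b<..} f" by (rule set_integrable_tail[OF int[of b]]) auto
  have "(LINT s|lborel. indicator {y..} s * f s) = (LINT s|lborel. indicator {y..b} s *\<^sub>R f s + indicator {b<..} s *\<^sub>R f s)"
    using yb by (intro Bochner_Integration.integral_cong) (auto simp: indicator_def)
  also have "\<dots> = (LINT s|lborel. indicator {y..b} s *\<^sub>R f s) + (LINT s|lborel. indicator {b<..} s *\<^sub>R f s)"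
    by (rule Bochner_Integration.integral_add) (use i1 i2 in \<open>auto simp: set_integrable_def\<close>)
  finally show "(LINT s|lborel. indicator {y..} s * f s) = integral {y..b} f + (LINT s|lborel. indicator {b<..} s * f s)"
    using set_borel_integral_eq_integral(2)[OF i1] by (simp add: set_lebesgue_integral_def)
  show "f integrable_on {y..b}" using set_borel_integral_eq_integral(1)[OF i1] .
qed

lemma tail_continuous:
  fixes f :: "real \<Rightarrow> real"
  assumes int: "\<And>x. integrable lborel (\<lambda>s. indicator {x..} s * f s)"
  shows "continuous_on UNIV (\<lambda>x. LINT s|lborel. indicator {x..} s * f s)"
proof (rule continuous_at_imp_continuous_on, rule ballI)
  fix x :: real
  have "continuous_on {x - 1..x + 1} (\<lambda>y. integral {y..x + 1} f + (LINT s|lborel. indicator {x + 1<..} s * f s))"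
    by (intro continuous_intros indefinite_integral_continuous_1' tail_split int) auto
  then have "continuous_on {x - 1..x + 1} (\<lambda>y. LINT s|lborel. indicator {y..} s * f s)"
    by (subst continuous_on_cong[OF refl tail_split(1)[OF int, where b="x + 1"]]) auto
  then show "isCont (\<lambda>y. LINT s|lborel. indicator {y..} s * f s) x"
    by (rule continuous_on_interior) auto
qed

lemma tail_derivative:
  fixes f :: "real \<Rightarrow> real"
  assumes int: "\<And>x. integrable lborel (\<lambda>s. indicator {x..} s * f s)" and cont: "continuous_on UNIV f"
  shows "((\<lambda>x. LINT s|lborel. indicator {x..} s * f s) has_real_derivative - f x) (at x)"
proof -
  have "((\<lambda>y. integral {y..x + 1} f + (LINT s|lborel. indicator {x + 1<..} s * f s)) has_real_derivative - f x + 0) (at x within {x - 1..x + 1})"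
    by (intro DERIV_add integral_has_real_derivative' DERIV_const continuous_on_subset[OF cont]) auto
  then have "((\<lambda>y. integral {y..x + 1} f + (LINT s|lborel. indicator {x + 1<..} s * f s)) has_real_derivative - f x) (at x)"
    by (subst (asm) at_within_interior) auto
  moreover have "eventually (\<lambda>y. (LINT s|lborel. indicator {y..} s * f s) = integral {y..x + 1} f + (LINT s|lborel. indicator {x + 1<..} s * f s)) (nhds x)"
    using eventually_nhds_in_open[of "{..<x + 1}" x] by (auto elim!: eventually_mono intro!: tail_split int)
  ultimately show ?thesis
    by (subst DERIV_cong_ev[OF refl _ refl]) auto
qed

lemma has_bochner_integral_exp_tail:
  fixes k x :: real assumes "k > 0"
  shows "has_bochner_integral lborel (\<lambda>s. indicator {x..} s * exp (- k * s)) (exp (- k * x) / k)"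
proof (rule has_bochner_integral_nn_integral)
  have l: "((\<lambda>s. - exp (- k * s) / k) \<longlongrightarrow> - 0 / k) at_top"
    using assms by (intro tendsto_intros filterlim_compose[OF exp_at_bot]
      filterlim_tendsto_neg_mult_at_bot[OF tendsto_const _ filterlim_ident]) auto
  have "(\<integral>\<^sup>+s. ennreal (exp (- k * s)) * indicator {x..} s \<partial>lborel) = ennreal (- 0 / k - - exp (- k * x) / k)"
  proof (rule nn_integral_FTC_atLeast[OF _ _ _ l])
    show "((\<lambda>s. - exp (- k * s) / k) has_real_derivative exp (- k * y)) (at y)" for y
      using assms by (auto intro!: derivative_eq_intros)
  qed auto
  moreover have "(\<integral>\<^sup>+s. ennreal (indicator {x..} s * exp (- k * s)) \<partial>lborel) = (\<integral>\<^sup>+s. ennreal (exp (- k * s)) * indicator {x..} s \<partial>lborel)"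
    by (intro nn_integral_cong) (auto simp: indicator_def)
  ultimately show "(\<integral>\<^sup>+s. ennreal (indicator {x..} s * exp (- k * s)) \<partial>lborel) = ennreal (exp (- k * x) / k)" by simp
qed (use assms in auto)

text \<open>\<open>resolvent K f x\<close> is the integral of \<open>exp (- K * s) * f (x + s)\<close> over \<open>s \<ge> 0\<close>. In this form
  the dependence on \<open>x\<close> sits in the domain of integration, so it gains one derivative over \<open>f\<close>.\<close>

definition resolvent :: "real \<Rightarrow> (real \<Rightarrow> real) \<Rightarrow> real \<Rightarrow> real" where
  "resolvent K f x = exp (K * x) * (LINT s|lborel. indicator {x..} s * (exp (- K * s) * f s))"

text \<open>The choice \<open>K = \<kappa> + 1\<close> gives
  \<open>e^{-Ks} f(x + s) <= c e^{\<kappa>|x|} e^{-s}\<close> for \<open>s >= 0\<close>, and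
  \<open>e^{-s}\<close> has mass 1 on the half line. So the resolvent obeys the same bound with the
  same \<open>c\<close> and \<open>\<kappa>\<close>, and the locale reproduces itself under
  smoothing.\<close>

locale exp_bounded_function =
  fixes f :: "real \<Rightarrow> real" and c \<kappa> K :: real
  assumes fm[measurable]: "f \<in> borel_measurable borel" and fpos: "\<And>x. 0 < f x"
    and fle: "\<And>x. f x \<le> c * exp (\<kappa> * \<bar>x\<bar>)" and kap: "0 \<le> \<kappa>" and K: "K = \<kappa> + 1"
begin

lemma c_pos: "c > 0"
  using fpos[of 0] fle[of 0] by simp

lemma nn_resolvent_le:
  "(\<integral>\<^sup>+s. indicator {0..} s * ennreal (exp (- K * s) * f (x + s)) \<partial>lborel) \<le> ennreal (c * exp (\<kappa> * \<bar>x\<bar>))"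
proof -
  have "(\<integral>\<^sup>+s. indicator {0..} s * ennreal (exp (- K * s) * f (x + s)) \<partial>lborel)
     \<le> (\<integral>\<^sup>+s. ennreal (c * exp (\<kappa> * \<bar>x\<bar>)) * ennreal (indicator {0..} s * exp (- 1 * s)) \<partial>lborel)"
  proof (rule nn_integral_mono)
    fix s
    show "indicator {0..} s * ennreal (exp (- K * s) * f (x + s)) \<le> ennreal (c * exp (\<kappa> * \<bar>x\<bar>)) * ennreal (indicator {0..} s * exp (- 1 * s))"
    proof (cases "s \<ge> 0")
      case True
      have "exp (- K * s) * f (x + s) \<le> exp (- K * s) * (c * exp (\<kappa> * \<bar>x + s\<bar>))"
        by (intro mult_left_mono fle) auto
      also have "\<dots> \<le> exp (- K * s) * (c * exp (\<kappa> * (\<bar>x\<bar> + s)))"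
        using True kap c_pos by (auto intro!: mult_left_mono)
      also have "\<dots> = c * exp (\<kappa> * \<bar>x\<bar>) * (exp (- K * s) * exp (\<kappa> * s))" by (simp add: distrib_left exp_add)
      also have "exp (- K * s) * exp (\<kappa> * s) = exp (- 1 * s)" unfolding exp_add[symmetric] K by (simp add: algebra_simps)
      finally have "exp (- K * s) * f (x + s) \<le> c * exp (\<kappa> * \<bar>x\<bar>) * exp (- 1 * s)" .
      then have "ennreal (exp (- K * s) * f (x + s)) \<le> ennreal (c * exp (\<kappa> * \<bar>x\<bar>) * exp (- 1 * s))" by (rule ennreal_leI)
      then show ?thesis using True c_pos by (simp add: ennreal_mult')
    qed simp
  qed
  also have "\<dots> = ennreal (c * exp (\<kappa> * \<bar>x\<bar>)) * (\<integral>\<^sup>+s. ennreal (indicator {0..} s * exp (- 1 * s)) \<partial>lborel)"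
    by (rule nn_integral_cmult) simp
  also have "(\<integral>\<^sup>+s. ennreal (indicator {0..} s * exp (- 1 * s)) \<partial>lborel) = ennreal 1"
    using has_bochner_integral_exp_tail[of 1 0] by (subst nn_integral_eq_integral) (auto simp: has_bochner_integral_iff)
  finally show ?thesis by simp
qed

lemma nn_tail:
  "(\<integral>\<^sup>+s. ennreal (indicator {x..} s * (exp (- K * s) * f s)) \<partial>lborel)
    = ennreal (exp (- K * x)) * (\<integral>\<^sup>+s. indicator {0..} s * ennreal (exp (- K * s) * f (x + s)) \<partial>lborel)"
proof -
  have "(\<integral>\<^sup>+s. ennreal (indicator {x..} s * (exp (- K * s) * f s)) \<partial>lborel)
    = (\<integral>\<^sup>+s. ennreal (indicator {x..} (x + s) * (exp (- K * (x + s)) * f (x + s))) \<partial>lborel)"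
    by (subst nn_integral_real_affine[where c=1 and t=x]) auto
  also have "\<dots> = (\<integral>\<^sup>+s. ennreal (exp (- K * x)) * (indicator {0..} s * ennreal (exp (- K * s) * f (x + s))) \<partial>lborel)"
  proof (rule nn_integral_cong)
    fix s
    have "exp (- K * (x + s)) = exp (- K * x) * exp (- K * s)" unfolding exp_add[symmetric] by (simp add: algebra_simps)
    then show "ennreal (indicator {x..} (x + s) * (exp (- K * (x + s)) * f (x + s))) = ennreal (exp (- K * x)) * (indicator {0..} s * ennreal (exp (- K * s) * f (x + s)))"
      by (auto simp: indicator_def ennreal_mult'[symmetric] mult.assoc)
  qed
  also have "\<dots> = ennreal (exp (- K * x)) * (\<integral>\<^sup>+s. indicator {0..} s * ennreal (exp (- K * s) * f (x + s)) \<partial>lborel)"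
    by (rule nn_integral_cmult) measurable
  finally show ?thesis .
qed

lemma tail_integrable: "integrable lborel (\<lambda>s. indicator {x..} s * (exp (- K * s) * f s))"
proof (rule integrableI_nonneg)
  show "(\<integral>\<^sup>+s. ennreal (indicator {x..} s * (exp (- K * s) * f s)) \<partial>lborel) < \<infinity>"
    unfolding nn_tail using nn_resolvent_le[of x] by (auto simp: ennreal_mult_less_top intro: le_less_trans)
qed (use fpos in \<open>auto simp: less_imp_le\<close>)

lemma ennreal_resolvent:
  "ennreal (resolvent K f x) = (\<integral>\<^sup>+s. indicator {0..} s * ennreal (exp (- K * s) * f (x + s)) \<partial>lborel)"
proof -
  have "ennreal (LINT s|lborel. indicator {x..} s * (exp (- K * s) * f s)) = (\<integral>\<^sup>+s. ennreal (indicator {x..} s * (exp (- K * s) * f s)) \<partial>lborel)"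
    by (rule nn_integral_eq_integral[symmetric, OF tail_integrable]) (use fpos in \<open>auto simp: less_imp_le\<close>)
  then have "ennreal (resolvent K f x) = (ennreal (exp (K * x)) * ennreal (exp (- K * x))) * (\<integral>\<^sup>+s. indicator {0..} s * ennreal (exp (- K * s) * f (x + s)) \<partial>lborel)"
    unfolding resolvent_def nn_tail by (simp add: ennreal_mult' mult.assoc)
  also have "ennreal (exp (K * x)) * ennreal (exp (- K * x)) = 1"
    by (simp add: ennreal_mult'[symmetric] exp_minus_inverse)
  finally show ?thesis by simp
qed

lemma resolvent_continuous: "continuous_on UNIV (resolvent K f)"
  unfolding resolvent_def by (intro continuous_intros tail_continuous tail_integrable)

lemma resolvent_measurable[measurable]: "resolvent K f \<in> borel_measurable borel"
  by (rule borel_measurable_continuous_onI[OF resolvent_continuous])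

lemma resolvent_pos: "0 < resolvent K f x"
proof -
  have "resolvent K f x \<ge> 0" unfolding resolvent_def by (intro mult_nonneg_nonneg integral_nonneg) (auto simp: less_imp_le fpos)
  moreover have "resolvent K f x \<noteq> 0"
  proof
    assume "resolvent K f x = 0"
    then have "(\<integral>\<^sup>+s. indicator {0..} s * ennreal (exp (- K * s) * f (x + s)) \<partial>lborel) = 0"
      using ennreal_resolvent[of x] by simp
    then have "AE s in lborel. indicator {0..} s * ennreal (exp (- K * s) * f (x + s)) = 0"
      by (subst (asm) nn_integral_0_iff_AE) auto
    then have "AE s in lborel. s \<notin> {0..1::real}"
    proof eventually_elim
      case (elim s)
      have "exp (- K * s) * f (x + s) > 0" using fpos by simp
      then have "ennreal (exp (- K * s) * f (x + s)) \<noteq> 0" by (simp only: ennreal_eq_0_iff not_le)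
      then show ?case using elim by (auto simp: indicator_def split: if_splits)
    qed
    then have "emeasure lborel {0..1::real} = 0"
      by (subst (asm) AE_iff_measurable[of "{0..1::real}"]) auto
    then show False by simp
  qed
  ultimately show ?thesis by simp
qed

lemma resolvent_le: "resolvent K f x \<le> c * exp (\<kappa> * \<bar>x\<bar>)"
  using nn_resolvent_le[of x] c_pos unfolding ennreal_resolvent[symmetric] by (subst (asm) ennreal_le_iff) auto

lemma exp_bounded_resolvent: "exp_bounded_function (resolvent K f) c \<kappa> K"
  by (rule exp_bounded_function.intro) (rule resolvent_measurable resolvent_pos resolvent_le kap K)+

text \<open>The resolvent equation \<open>K V - V' = f\<close>. It serves the second smoothing step,
  whose input is continuous; the first step is undone by comparing tails instead.\<close>

lemma resolvent_derivative:
  assumes "continuous_on UNIV f"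
  shows "(resolvent K f has_real_derivative K * resolvent K f x - f x) (at x)"
proof -
  have c: "continuous_on UNIV (\<lambda>s. exp (- K * s) * f s)" by (intro continuous_intros assms)
  have "(resolvent K f has_real_derivative K * exp (K * x) * (LINT s|lborel. indicator {x..} s * (exp (- K * s) * f s))
      + (- (exp (- K * x) * f x)) * exp (K * x)) (at x)"
    unfolding resolvent_def
    by (rule DERIV_mult, (auto intro!: derivative_eq_intros)[1], rule tail_derivative[OF tail_integrable c])
  then show ?thesis
  proof (rule DERIV_cong)
    have "exp (- K * x) * f x * exp (K * x) = f x"
      by (simp add: exp_minus field_simps)
    then show "K * exp (K * x) * (LINT s|lborel. indicator {x..} s * (exp (- K * s) * f s))
      + (- (exp (- K * x) * f x)) * exp (K * x) = K * resolvent K f x - f x"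
      unfolding resolvent_def by simp
  qed
qed

text \<open>Up to the factor \<open>e^{-Ku}\<close> the resolvent is a tail integral of a positive
  function. This is the half of a Harnack inequality that positivity alone provides.\<close>

lemma resolvent_antimono: "x \<le> y \<Longrightarrow> resolvent K f y * exp (- K * y) \<le> resolvent K f x * exp (- K * x)"
proof -
  assume "x \<le> y"
  then have "(LINT s|lborel. indicator {y..} s * (exp (- K * s) * f s)) \<le> (LINT s|lborel. indicator {x..} s * (exp (- K * s) * f s))"
    by (intro integral_mono tail_integrable) (auto simp: indicator_def less_imp_le fpos)
  moreover have "resolvent K f u * exp (- K * u) = (LINT s|lborel. indicator {u..} s * (exp (- K * s) * f s))" for u
    unfolding resolvent_def by (simp add: exp_minus field_simps)
  ultimately show ?thesis by simp
qed

text \<open>Tonelli exchanges \<open>\<mu>\<close> with the smoothing integral. Under the integral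
  over \<open>s\<close> an almost everywhere identity is enough, so the conclusion holds at every
  point of \<open>I\<close>; shifts by \<open>s >= 0\<close> stay in \<open>I\<close>.\<close>

lemma resolvent_harmonic:
  assumes sets_mu[measurable_cong]: "sets \<mu> = sets borel" and "prob_space \<mu>"
    and I: "{0<..} \<subseteq> I" "\<And>x y. x \<in> I \<Longrightarrow> 0 \<le> y \<Longrightarrow> x + y \<in> I" "I \<in> sets borel" and C: "0 \<le> C"
    and eq: "AE x in lborel. x \<in> I \<longrightarrow> (\<integral>\<^sup>+y. ennreal (f (x + y)) \<partial>\<mu>) = ennreal (C * f x)"
    and x: "x \<in> I"
  shows "(\<integral>\<^sup>+y. ennreal (resolvent K f (x + y)) \<partial>\<mu>) = ennreal (C * resolvent K f x)"
proof -
  interpret prob_space \<mu> by fact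
  interpret pair_sigma_finite lborel \<mu> ..
  note [measurable] = I(3)
  have "(\<integral>\<^sup>+y. ennreal (resolvent K f (x + y)) \<partial>\<mu>) = (\<integral>\<^sup>+y. (\<integral>\<^sup>+s. indicator {0..} s * ennreal (exp (- K * s) * f (x + y + s)) \<partial>lborel) \<partial>\<mu>)"
    by (simp add: ennreal_resolvent)
  also have "\<dots> = (\<integral>\<^sup>+s. (\<integral>\<^sup>+y. indicator {0..} s * ennreal (exp (- K * s) * f (x + y + s)) \<partial>\<mu>) \<partial>lborel)"
    by (rule Fubini') measurable
  also have "\<dots> = (\<integral>\<^sup>+s. ennreal C * (indicator {0..} s * ennreal (exp (- K * s) * f (x + s))) \<partial>lborel)"
  proof (rule nn_integral_cong_AE)
    have "AE s in lborel. x + 1 * s \<in> I \<longrightarrow> (\<integral>\<^sup>+y. ennreal (f (x + 1 * s + y)) \<partial>\<mu>) = ennreal (C * f (x + 1 * s))"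
      by (rule AE_borel_affine[OF _ _ eq]) auto
    then show "AE s in lborel. (\<integral>\<^sup>+y. indicator {0..} s * ennreal (exp (- K * s) * f (x + y + s)) \<partial>\<mu>)
       = ennreal C * (indicator {0..} s * ennreal (exp (- K * s) * f (x + s)))"
    proof eventually_elim
      case (elim s)
      show ?case
      proof (cases "s \<ge> 0")
        case True
        then have e: "(\<integral>\<^sup>+y. ennreal (f (x + s + y)) \<partial>\<mu>) = ennreal (C * f (x + s))" using elim I(2)[OF x] by simp
        have "(\<integral>\<^sup>+y. indicator {0..} s * ennreal (exp (- K * s) * f (x + y + s)) \<partial>\<mu>) = (\<integral>\<^sup>+y. ennreal (exp (- K * s)) * ennreal (f (x + s + y)) \<partial>\<mu>)"
          using True by (intro nn_integral_cong) (simp add: ennreal_mult'[symmetric] add_ac)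
        also have "\<dots> = ennreal (exp (- K * s)) * ennreal (C * f (x + s))"
          unfolding e[symmetric] by (rule nn_integral_cmult) measurable
        finally show ?thesis using True C fpos[of "x + s"] by (simp add: ennreal_mult'[symmetric] mult_ac less_imp_le)
      qed simp
    qed
  qed
  also have "\<dots> = ennreal C * ennreal (resolvent K f x)"
    unfolding ennreal_resolvent by (rule nn_integral_cmult) measurable
  finally show ?thesis using C by (simp add: ennreal_mult')
qed

end

text \<open>Equal tails mean that the measures with densities \<open>f\<close> and \<open>h\<close>
  agree on all rays, hence coincide, and densities are unique almost everywhere. Cutting off below
  at a point \<open>q\<close> of \<open>I\<close> keeps them finite and away from the region where
  nothing is known; countably many rational \<open>q\<close> exhaust \<open>I\<close>.\<close>

lemma AE_eq_of_tails_eq: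
  fixes f h :: "real \<Rightarrow> real"
  assumes [measurable]: "f \<in> borel_measurable borel" "h \<in> borel_measurable borel"
    and nn: "\<And>x. 0 \<le> f x" "\<And>x. 0 \<le> h x"
    and f: "\<And>x. x \<in> I \<Longrightarrow> has_bochner_integral lborel (\<lambda>s. indicator {x..} s * f s) (T x)"
    and h: "\<And>x. x \<in> I \<Longrightarrow> has_bochner_integral lborel (\<lambda>s. indicator {x..} s * h s) (T x)"
    and I: "\<And>x y. x \<in> I \<Longrightarrow> x \<le> y \<Longrightarrow> y \<in> I" "open I"
  shows "AE x in lborel. x \<in> I \<longrightarrow> f x = h x"
proof -
  have main: "AE x in lborel. x > q \<longrightarrow> f x = h x" if q: "q \<in> I" for q
  proof -
    define F where "F f = density lborel (\<lambda>s. ennreal (indicator {q<..} s * f s))" for f :: "real \<Rightarrow> real"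
    have em: "emeasure (F f) {x<..} = ennreal (T (max q x))"
      if [measurable]: "f \<in> borel_measurable borel" and nn: "\<And>x. 0 \<le> f x"
        and f: "\<And>x. x \<in> I \<Longrightarrow> has_bochner_integral lborel (\<lambda>s. indicator {x..} s * f s) (T x)" for f x
    proof -
      have m: "max q x \<in> I" by (rule I(1)[OF q]) simp
      have "emeasure (F f) {x<..} = (\<integral>\<^sup>+s. ennreal (indicator {q<..} s * f s) * indicator {x<..} s \<partial>lborel)"
        unfolding F_def by (subst emeasure_density) auto
      also have "\<dots> = (\<integral>\<^sup>+s. ennreal (indicator {max q x..} s * f s) \<partial>lborel)"
      proof (rule nn_integral_cong_AE)
        show "AE s in lborel. ennreal (indicator {q<..} s * f s) * indicator {x<..} s = ennreal (indicator {max q x..} s * f s)"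
          using AE_lborel_singleton[of "max q x"] by eventually_elim (auto simp: indicator_def max_def)
      qed
      also have "\<dots> = ennreal (T (max q x))"
        using f[OF m] nn by (subst nn_integral_eq_integral) (auto simp: has_bochner_integral_iff)
      finally show ?thesis .
    qed
    have "F f = F h"
      by (rule measure_eqI_lessThan) (simp_all add: em[OF assms(1) nn(1) f] em[OF assms(2) nn(2) h], simp_all add: F_def)
    then have "AE s in lborel. ennreal (indicator {q<..} s * f s) = ennreal (indicator {q<..} s * h s)"
      unfolding F_def by (subst (asm) sigma_finite_measure.density_unique_iff[OF sigma_finite_lborel]) auto
    then show ?thesis
      by eventually_elim (use nn in \<open>auto simp: indicator_def split: if_splits\<close>)
  qed
  have "AE x in lborel. \<forall>q\<in>\<rat> \<inter> I. x > q \<longrightarrow> f x = h x"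
    by (subst AE_ball_countable) (use main countable_rat in auto)
  then show ?thesis
  proof eventually_elim
    case (elim x)
    show ?case
    proof
      assume "x \<in> I"
      then obtain e where e: "e > 0" "ball x e \<subseteq> I" using I(2) open_contains_ball by metis
      obtain q where q: "q \<in> \<rat>" "x - e < q" "q < x" using Rats_dense_in_real[of "x - e" x] e by auto
      then have "q \<in> I" using e by (auto simp: subset_eq dist_real_def)
      then show "f x = h x" using elim q by auto
    qed
  qed
qed

text \<open>Guarantees \<open>K - l > 0\<close> for every exponential that really occurs, so that
  its tail integral converges.\<close>

lemma exponential_rate_le:
  fixes a c l \<kappa> :: real
  assumes a: "0 < a" and le: "\<And>x. x > 0 \<Longrightarrow> a * exp (l * x) \<le> c * exp (\<kappa> * x)"
  shows "l \<le> \<kappa>"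
proof (rule ccontr)
  assume "\<not> ?thesis"
  then have "l - \<kappa> > 0" by simp
  then have "filterlim (\<lambda>x. exp ((l - \<kappa>) * x)) at_top at_top"
    by (intro filterlim_compose[OF exp_at_top] filterlim_tendsto_pos_mult_at_top[OF tendsto_const _ filterlim_ident])
  then have "\<forall>\<^sub>F x in at_top. exp ((l - \<kappa>) * x) > c / a" by (simp add: filterlim_at_top_dense)
  then have "\<forall>\<^sub>F x in at_top. x > 0 \<and> exp ((l - \<kappa>) * x) > c / a"
    by (rule eventually_conj[OF eventually_gt_at_top])
  then obtain x where x: "x > 0" "exp ((l - \<kappa>) * x) > c / a"
    using eventually_happens'[OF trivial_limit_at_top_linorder] by blast
  have "exp (l * x) = exp ((l - \<kappa>) * x) * exp (\<kappa> * x)" unfolding exp_add[symmetric] by (simp add: algebra_simps)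
  then have "(a * exp ((l - \<kappa>) * x)) * exp (\<kappa> * x) \<le> c * exp (\<kappa> * x)" using le[OF x(1)] by (simp add: mult.assoc)
  then have "a * exp ((l - \<kappa>) * x) \<le> c" by simp
  then show False using x a by (simp add: field_simps)
qed

section \<open>Classification through the double resolvent\<close>

context exp_bounded_function
begin

abbreviation (input) V :: "real \<Rightarrow> real" where "V \<equiv> resolvent K f"
abbreviation (input) W :: "real \<Rightarrow> real" where "W \<equiv> resolvent K (resolvent K f)"

lemma double_resolvent_derivative: "(W has_real_derivative K * W x - V x) (at x)"
  by (rule exp_bounded_function.resolvent_derivative[OF exp_bounded_resolvent resolvent_continuous])

text \<open>The premise means \<open>V <= (K + M) W\<close> at \<open>x\<close>. Since
  \<open>V e^{-Ks}\<close> decreases, the slope \<open>- V e^{-Ks}\<close> of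
  \<open>W e^{-Ks}\<close> stays controlled to the right of \<open>x\<close>, and over the distance
  \<open>d = 1 / (2 N)\<close> at most half of the value is lost. It serves the half line, where
  \<open>resolvent_Harnack\<close> does not apply.\<close>

lemma double_resolvent_lower:
  "\<exists>d>0. \<exists>c>0. \<forall>x\<in>I. - M * W x \<le> K * W x - V x \<longrightarrow> c * W x \<le> W (x + d)"
proof -
  note Wpos = exp_bounded_function.resolvent_pos[OF exp_bounded_resolvent]
  define N where "N = K + \<bar>M\<bar> + 1"
  have N: "N > 0" "K > 0" unfolding N_def using K kap by auto
  define d where "d = 1 / (2 * N)"
  have d: "d > 0" "d * N = 1/2" unfolding d_def using N by auto
  have "1/2 * W x \<le> W (x + d)" if M: "- M * W x \<le> K * W x - V x" for x
  proof -
    let ?o = "\<lambda>s. W s * exp (- K * s)"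
    have "\<exists>z>x. z < x + d \<and> ?o (x + d) - ?o x = (x + d - x) * - (V z * exp (- K * z))"
    proof (rule MVT2)
      show "(?o has_real_derivative - (V z * exp (- K * z))) (at z)" for z
        by (auto intro!: derivative_eq_intros double_resolvent_derivative simp: algebra_simps)
    qed (use d in auto)
    then obtain z where z: "z > x" "?o (x + d) - ?o x = d * - (V z * exp (- K * z))" by auto
    have "V x \<le> (K + M) * W x" using M by (simp add: algebra_simps)
    also have "\<dots> \<le> N * W x" unfolding N_def by (intro mult_right_mono) (auto simp: less_imp_le Wpos)
    finally have VN: "V x \<le> N * W x" .
    have "d * (V z * exp (- K * z)) \<le> d * (V x * exp (- K * x))"
      using d z resolvent_antimono[of x z] by (intro mult_left_mono) auto
    also have "\<dots> \<le> d * (N * W x * exp (- K * x))"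
      using VN d by (intro mult_left_mono mult_right_mono) auto
    also have "\<dots> = (d * N) * ?o x" by simp
    finally have "1/2 * ?o x \<le> ?o (x + d)" using z unfolding d(2) by linarith
    then have "(1/2 * W x) * exp (- K * (x + d + - d)) \<le> W (x + d) * exp (- K * (x + d))" by simp
    from exp_shift_le[OF this] have "1/2 * W x \<le> W (x + d) * exp (K * - d)" .
    also have "\<dots> \<le> W (x + d) * 1" using N d Wpos by (intro mult_left_mono) (auto simp: less_imp_le)
    finally show ?thesis by simp
  qed
  then show ?thesis using d(1) by (intro exI[of _ d] conjI exI[of _ "1/2::real"]) auto
qed

text \<open>Just left of \<open>x\<close> the resolvent cannot be much smaller than at
  \<open>x\<close>. A point \<open>x + t\<close> with \<open>t\<close> in \<open>[0, 1]\<close> sees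
  \<open>[x - 1, x]\<close> through jumps in \<open>[-2, 0]\<close>, so
  \<open>V (x + t) >= q * V x\<close>; integrating over \<open>t\<close> bounds \<open>V x\<close>
  by a multiple of \<open>W x\<close>. The argument runs on negative jumps, hence on the whole
  line.\<close>

lemma resolvent_Harnack:
  assumes sets_mu[measurable_cong]: "sets \<mu> = sets borel" and minor: "locally_minorized \<mu> UNIV" and C: "0 < C"
    and eq: "\<And>x. has_bochner_integral \<mu> (\<lambda>y. V (x + y)) (C * V x)"
  obtains L where "L > 0" "\<And>x. V x \<le> L * W x"
proof -
  obtain cm where cm: "cm > 0" and mm: "\<And>E B. E \<in> borel_measurable borel \<Longrightarrow> (AE y in \<mu>. 0 \<le> E y) \<Longrightarrow> integrable \<mu> E \<Longrightarrow>
     (\<integral>y. E y \<partial>\<mu>) \<le> B \<Longrightarrow> (\<integral>\<^sup>+y. ennreal (E y) * indicator {-2..0} y \<partial>lborel) \<le> ennreal (B / cm)"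
    using locally_minorized_bound[OF minor, of "-2" 0] by auto
  define q where "q = exp (- K) * cm / C"
  have q: "q > 0" unfolding q_def using cm C by simp
  have K0: "K > 0" using K kap by simp
  have low: "q * V x \<le> V (x + t)" if t: "t \<in> {0..1}" for x t
  proof -
    \<comment> \<open>The window \<open>[-1-t, -t]\<close> has length 1 and consists of the jumps
      from \<open>x + t\<close> into \<open>[x - 1, x]\<close>.\<close>
    have "ennreal (exp (- K) * V x) = (\<integral>\<^sup>+y. ennreal (exp (- K) * V x) * indicator {-1-t..-t} y \<partial>lborel)"
      by (subst nn_integral_cmult_indicator) auto
    also have "\<dots> \<le> (\<integral>\<^sup>+y. ennreal (V (x + t + y)) * indicator {-2..0} y \<partial>lborel)"
    proof (rule nn_integral_mono)
      fix y
      show "ennreal (exp (- K) * V x) * indicator {-1-t..-t} y \<le> ennreal (V (x + t + y)) * indicator {-2..0} y"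
      proof (cases "y \<in> {-1-t..-t}")
        case True
        define r where "r = - (t + y)"
        have r: "0 \<le> r" "r \<le> 1" using True unfolding r_def by auto
        have "V x * exp (- K * (x - r + r)) \<le> V (x - r) * exp (- K * (x - r))"
          using resolvent_antimono[of "x - r" x] r by simp
        from exp_shift_le[OF this] have "V x \<le> V (x - r) * exp (K * r)" .
        also have "\<dots> \<le> V (x - r) * exp K" using r K0 resolvent_pos by (intro mult_left_mono) (auto simp: less_imp_le)
        finally have "exp (- K) * V x \<le> exp (- K) * (V (x - r) * exp K)" by (intro mult_left_mono) auto
        also have "x - r = x + t + y" unfolding r_def by simp
        also have "exp (- K) * (V (x + t + y) * exp K) = V (x + t + y)" by (simp add: exp_minus)
        finally show ?thesis using True t by (auto simp: indicator_def intro: ennreal_leI)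
      qed simp
    qed
    also have "\<dots> \<le> ennreal (C * V (x + t) / cm)"
      by (rule mm) (use eq[of "x + t"] resolvent_pos in \<open>auto simp: has_bochner_integral_iff less_imp_le\<close>)
    finally have "exp (- K) * V x \<le> C * V (x + t) / cm"
      using C cm resolvent_pos[of "x + t"] by (subst (asm) ennreal_le_iff) auto
    then show ?thesis unfolding q_def using C cm by (simp add: field_simps)
  qed
  have "V x \<le> (exp K / q) * W x" for x
  proof -
    have "ennreal (exp (- K) * (q * V x)) = (\<integral>\<^sup>+s. ennreal (exp (- K) * (q * V x)) * indicator {0..1::real} s \<partial>lborel)"
      by (subst nn_integral_cmult_indicator) auto
    also have "\<dots> \<le> (\<integral>\<^sup>+s. indicator {0..} s * ennreal (exp (- K * s) * V (x + s)) \<partial>lborel)"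
    proof (rule nn_integral_mono)
      fix s :: real
      show "ennreal (exp (- K) * (q * V x)) * indicator {0..1} s \<le> indicator {0..} s * ennreal (exp (- K * s) * V (x + s))"
      proof (cases "s \<in> {0..1}")
        case True
        have "exp (- K) * (q * V x) \<le> exp (- K * s) * V (x + s)"
          using low[OF True] True K0 q resolvent_pos[of x] by (intro mult_mono) auto
        then show ?thesis using True by (auto intro: ennreal_leI)
      qed simp
    qed
    also have "\<dots> = ennreal (W x)"
      by (rule exp_bounded_function.ennreal_resolvent[OF exp_bounded_resolvent, symmetric])
    finally have "exp (- K) * (q * V x) \<le> W x"
      using exp_bounded_function.resolvent_pos[OF exp_bounded_resolvent, of x] by (subst (asm) ennreal_le_iff) auto
    then show ?thesis using q by (simp add: exp_minus field_simps)
  qed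
  then show thesis using that[of "exp K / q"] q by simp
qed

text \<open>For \<open>l < K\<close> the resolvent of \<open>e^{lx}\<close> is
  \<open>e^{lx} / (K - l)\<close>, so each coefficient picks up \<open>(K - l)^2\<close> on the way
  back. The passage from \<open>W\<close> to \<open>V\<close> is differentiation; from
  \<open>V\<close> to the merely measurable \<open>f\<close> only tails can be compared, and the
  result holds almost everywhere.\<close>

lemma exponential_inversion:
  assumes I: "open I" "\<And>x y. x \<in> I \<Longrightarrow> x \<le> y \<Longrightarrow> y \<in> I" "{0<..} \<subseteq> I" and a: "0 \<le> a1" "0 \<le> a2"
    and W: "\<And>x. x \<in> I \<Longrightarrow> W x = a1 * exp (l1 * x) + a2 * exp (l2 * x)"
  shows "AE x in lborel. x \<in> I \<longrightarrow> f x = a1 * (K - l1)\<^sup>2 * exp (l1 * x) + a2 * (K - l2)\<^sup>2 * exp (l2 * x)"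
proof -
  have Vx: "V x = a1 * (K - l1) * exp (l1 * x) + a2 * (K - l2) * exp (l2 * x)" if x: "x \<in> I" for x
  proof -
    have "((\<lambda>x. a1 * exp (l1 * x) + a2 * exp (l2 * x)) has_real_derivative K * W x - V x) (at x)"
      by (rule has_field_derivative_transform_within_open[OF double_resolvent_derivative I(1) x W])
    moreover have "((\<lambda>x. a1 * exp (l1 * x) + a2 * exp (l2 * x)) has_real_derivative a1 * (l1 * exp (l1 * x)) + a2 * (l2 * exp (l2 * x))) (at x)"
      by (auto intro!: derivative_eq_intros)
    ultimately have "K * W x - V x = a1 * (l1 * exp (l1 * x)) + a2 * (l2 * exp (l2 * x))" by (rule DERIV_unique)
    then show ?thesis unfolding W[OF x] by (simp add: algebra_simps)
  qed
  have Wle: "W x \<le> c * exp (\<kappa> * x)" if "x > 0" for x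
    using exp_bounded_function.resolvent_le[OF exp_bounded_resolvent, of x] that by simp
  \<comment> \<open>A rate with coefficient zero is unconstrained; growth of \<open>W\<close>
    restricts only the others, which is why \<open>trm\<close> treats \<open>a = 0\<close>
    separately.\<close>
  have l1: "l1 \<le> \<kappa>" if "a1 \<noteq> 0"
  proof (rule exponential_rate_le[of a1 _ c])
    fix x :: real assume x: "x > 0"
    have "a1 * exp (l1 * x) \<le> W x" using W[of x] x I(3) a by auto
    then show "a1 * exp (l1 * x) \<le> c * exp (\<kappa> * x)" using Wle[OF x] by simp
  qed (use that a in auto)
  have l2: "l2 \<le> \<kappa>" if "a2 \<noteq> 0"
  proof (rule exponential_rate_le[of a2 _ c])
    fix x :: real assume x: "x > 0"
    have "a2 * exp (l2 * x) \<le> W x" using W[of x] x I(3) a by auto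
    then show "a2 * exp (l2 * x) \<le> c * exp (\<kappa> * x)" using Wle[OF x] by simp
  qed (use that a in auto)
  define t where "t a l s = a * (K - l)\<^sup>2 * exp (- (K - l) * s)" for a l s :: real
  have trm: "has_bochner_integral lborel (\<lambda>s. indicator {x..} s * t a l s) (a * (K - l) * exp (- (K - l) * x))"
    if "a \<noteq> 0 \<Longrightarrow> l \<le> \<kappa>" for a l x
  proof (cases "a = 0")
    case True then show ?thesis by (simp add: t_def has_bochner_integral_zero)
  next
    case False
    then have k: "K - l > 0" using that K by simp
    show ?thesis
      using has_bochner_integral_mult_right[OF has_bochner_integral_exp_tail[OF k, of x], of "a * (K - l)\<^sup>2"] k
      by (simp add: t_def power2_eq_square mult_ac)
  qed
  have ek: "exp (- K * s) * exp (l * s) = exp (- (K - l) * s)" for l s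
    unfolding exp_add[symmetric] by (simp add: algebra_simps)
  have "AE x in lborel. x \<in> I \<longrightarrow> exp (- K * x) * f x = t a1 l1 x + t a2 l2 x"
  proof (rule AE_eq_of_tails_eq[where T="\<lambda>x. exp (- K * x) * V x"])
    show "has_bochner_integral lborel (\<lambda>s. indicator {x..} s * (exp (- K * s) * f s)) (exp (- K * x) * V x)" if "x \<in> I" for x
    proof -
      have "exp (- K * x) * V x = (LINT s|lborel. indicator {x..} s * (exp (- K * s) * f s))"
        unfolding resolvent_def by (simp add: mult.assoc[symmetric] flip: exp_add)
      then show ?thesis using tail_integrable[of x] by (simp add: has_bochner_integral_iff)
    qed
    show "has_bochner_integral lborel (\<lambda>s. indicator {x..} s * (t a1 l1 s + t a2 l2 s)) (exp (- K * x) * V x)" if x: "x \<in> I" for x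
    proof -
      have "exp (- K * x) * V x = a1 * (K - l1) * exp (- (K - l1) * x) + a2 * (K - l2) * exp (- (K - l2) * x)"
        unfolding Vx[OF x] ek[symmetric] by (simp add: distrib_left mult_ac)
      then show ?thesis unfolding distrib_left
        by (simp only:) (rule has_bochner_integral_add[OF trm trm], erule l1, erule l2)
    qed
    show "(\<lambda>x. exp (- K * x) * f x) \<in> borel_measurable borel" by measurable
    show "(\<lambda>x. t a1 l1 x + t a2 l2 x) \<in> borel_measurable borel" unfolding t_def by measurable
  qed (use fpos I a in \<open>auto simp: less_imp_le t_def\<close>)
  then show ?thesis
  proof eventually_elim
    case (elim x)
    show ?case
    proof
      assume "x \<in> I"
      then have "exp (- K * x) * f x = exp (- K * x) * (a1 * (K - l1)\<^sup>2 * exp (l1 * x) + a2 * (K - l2)\<^sup>2 * exp (l2 * x))"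
        using elim unfolding t_def ek[symmetric] by (simp add: distrib_left mult_ac)
      then show "f x = a1 * (K - l1)\<^sup>2 * exp (l1 * x) + a2 * (K - l2)\<^sup>2 * exp (l2 * x)" by simp
    qed
  qed
qed

lemma harmonic_classification:
  assumes sets_mu[measurable_cong]: "sets \<mu> = sets borel" and prob: "prob_space \<mu>"
    and I: "I = UNIV \<or> I = {0<..}" and AE_I: "AE y in \<mu>. y \<in> I"
    and minor: "locally_minorized \<mu> I" and C: "0 < C"
    and eq: "AE x in lborel. x \<in> I \<longrightarrow> (\<integral>\<^sup>+y. ennreal (f (x + y)) \<partial>\<mu>) = ennreal (C * f x)"
  obtains l1 l2 a1 a2 where "0 \<le> a1" "0 \<le> a2"
    "AE x in lborel. x \<in> I \<longrightarrow> f x = a1 * exp (l1 * x) + a2 * exp (l2 * x)"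
    "has_bochner_integral \<mu> (\<lambda>y. exp (l1 * y)) C" "has_bochner_integral \<mu> (\<lambda>y. exp (l2 * y)) C"
proof -
  interpret V: exp_bounded_function "resolvent K f" c \<kappa> K by (rule exp_bounded_resolvent)
  have I': "{0<..} \<subseteq> I" "\<And>x y. x \<in> I \<Longrightarrow> 0 \<le> y \<Longrightarrow> x + y \<in> I" "I \<in> sets borel" "open I"
      "\<And>x y. x \<in> I \<Longrightarrow> x \<le> y \<Longrightarrow> y \<in> I"
    using I by auto
  have C0: "0 \<le> C" using C by simp
  have nnV: "(\<integral>\<^sup>+y. ennreal (V (x + y)) \<partial>\<mu>) = ennreal (C * V x)" if "x \<in> I" for x
    by (rule resolvent_harmonic[OF sets_mu prob I'(1-3) C0 eq that])
  have nnW: "(\<integral>\<^sup>+y. ennreal (W (x + y)) \<partial>\<mu>) = ennreal (C * W x)" if "x \<in> I" for x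
    by (rule V.resolvent_harmonic[OF sets_mu prob I'(1-3) C0 _ that]) (use nnV in auto)
  have eqV: "has_bochner_integral \<mu> (\<lambda>y. V (x + y)) (C * V x)" if "x \<in> I" for x
    by (rule has_bochner_integral_nn_integral) (use nnV[OF that] V.fpos C in \<open>auto simp: less_imp_le\<close>)
  have eqW: "has_bochner_integral \<mu> (\<lambda>y. W (x + y)) (C * W x)" if "x \<in> I" for x
    by (rule has_bochner_integral_nn_integral) (use nnW[OF that] V.resolvent_pos C in \<open>auto simp: less_imp_le\<close>)
  have eqW1: "has_bochner_integral \<mu> (\<lambda>y. K * W (x + y) - V (x + y)) (C * (K * W x - V x))" if "x \<in> I" for x
  proof -
    have "has_bochner_integral \<mu> (\<lambda>y. K * W (x + y) - V (x + y)) (K * (C * W x) - C * V x)"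
      by (intro has_bochner_integral_diff has_bochner_integral_mult_right eqV eqW that)
    then show ?thesis by (simp add: algebra_simps)
  qed
  have W1m: "(\<lambda>x. K * W x - V x) \<in> borel_measurable borel" by measurable
  \<comment> \<open>Positivity of \<open>V\<close> alone bounds \<open>W' / W\<close> above by
    \<open>K\<close>. A lower bound takes Harnack's inequality and is derived on the whole line
    only.\<close>
  have le: "K * W x - V x \<le> K * W x" for x using V.fpos[of x] by simp
  have "\<exists>l1 l2 a1 a2. 0 \<le> a1 \<and> 0 \<le> a2 \<and> (\<forall>x\<in>I. W x = a1 * exp (l1 * x) + a2 * exp (l2 * x)) \<and>
    has_bochner_integral \<mu> (\<lambda>y. exp (l1 * y)) C \<and> has_bochner_integral \<mu> (\<lambda>y. exp (l2 * y)) C"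
  proof (cases "I = UNIV")
    case True
    obtain L where L: "L > 0" "\<And>x. V x \<le> L * W x"
      using resolvent_Harnack[OF sets_mu _ C eqV] minor True by auto
    have bdd: "\<bar>K * W x - V x\<bar> \<le> (K + L) * W x" for x
    proof -
      have "0 \<le> K * W x" "0 \<le> L * W x" using V.resolvent_pos[of x] L K kap by auto
      then show ?thesis using L(2)[of x] V.fpos[of x] by (auto simp: distrib_right abs_le_iff)
    qed
    obtain l1 l2 a1 a2 where "a1 \<ge> 0" "a2 \<ge> 0" "\<And>x. W x = a1 * exp (l1 * x) + a2 * exp (l2 * x)"
      "has_bochner_integral \<mu> (\<lambda>y. exp (l1 * y)) C" "has_bochner_integral \<mu> (\<lambda>y. exp (l2 * y)) C"
      by (rule two_sided_classification[OF sets_mu _ V.resolvent_pos double_resolvent_derivative W1m bdd C eqW eqW1])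
        (use minor True in blast)+
    then show ?thesis by blast
  next
    case False
    then have I2: "I = {0<..}" using I by simp
    obtain l a where la: "a > 0" "\<And>x. x > 0 \<Longrightarrow> W x = a * exp (l * x)" "has_bochner_integral \<mu> (\<lambda>y. exp (l * y)) C"
    proof (rule one_sided_classification[OF sets_mu _ _ V.resolvent_pos double_resolvent_derivative W1m le C _ _ double_resolvent_lower])
      show "AE y in \<mu>. y \<in> {0<..}" "locally_minorized \<mu> {0<..}" using AE_I minor I2 by auto
    qed (use eqW eqW1 I2 in auto)
    show ?thesis
      by (intro exI[of _ l] exI[of _ a] exI[of _ "0::real"] conjI) (use la I2 in auto)
  qed
  then obtain l1 l2 a1 a2 where *: "0 \<le> a1" "0 \<le> a2" "\<And>x. x \<in> I \<Longrightarrow> W x = a1 * exp (l1 * x) + a2 * exp (l2 * x)"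
    "has_bochner_integral \<mu> (\<lambda>y. exp (l1 * y)) C" "has_bochner_integral \<mu> (\<lambda>y. exp (l2 * y)) C" by blast
  show thesis
    by (rule that[OF _ _ exponential_inversion[OF I'(4) I'(5) I'(1) *(1-3)] *(4,5)]) (use * in auto)
qed

end

section \<open>Laws of a Levy process and the martingale property\<close>

context levy_process
begin

abbreviation law :: "real \<Rightarrow> real measure" where "law t \<equiv> distr M borel (X t)"

declare measurable_X[measurable (raw)]

lemma prob_space_law: "0 \<le> t \<Longrightarrow> prob_space (law t)"
  by (rule prob_space_distr) measurable

lemma law_increment:
  assumes "0 \<le> s" "0 \<le> h"
  shows "distr M borel (\<lambda>\<omega>. X (s + h) \<omega> - X s \<omega>) = law h"
proof -
  note [measurable] = measurable_X[OF assms(1)] measurable_X[OF assms(2)] measurable_X[of 0, simplified]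
  have "distr M borel (\<lambda>\<omega>. X h \<omega> - X 0 \<omega>) = law h"
    by (rule distr_cong_AE) (use X_zero in auto)
  then show ?thesis using stationary_increments[OF assms] by simp
qed

lemma indep_increment:
  assumes s: "0 \<le> s" and h: "0 \<le> h"
  shows "indep_var borel (\<lambda>\<omega>. X s \<omega> - X 0 \<omega>) borel (\<lambda>\<omega>. X (s + h) \<omega> - X s \<omega>)"
proof -
  define \<tau> :: "nat \<Rightarrow> real" where "\<tau> i = (if i = 0 then 0 else if i = 1 then s else s + h)" for i
  let ?Y = "\<lambda>i \<omega>. X (\<tau> (Suc i)) \<omega> - X (\<tau> i) \<omega>"
  have "indep_vars (\<lambda>_. borel) ?Y {..<2}"
    by (rule independent_increments) (use s h in \<open>auto simp: \<tau>_def\<close>)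
  then have "indep_var (PiM {0} (\<lambda>_. borel)) (\<lambda>\<omega>. restrict (\<lambda>i. ?Y i \<omega>) {0}) (PiM {1} (\<lambda>_. borel)) (\<lambda>\<omega>. restrict (\<lambda>i. ?Y i \<omega>) {1})"
    by (rule indep_var_restrict) auto
  then have "indep_var borel ((\<lambda>f. f 0) \<circ> (\<lambda>\<omega>. restrict (\<lambda>i. ?Y i \<omega>) {0})) borel ((\<lambda>f. f 1) \<circ> (\<lambda>\<omega>. restrict (\<lambda>i. ?Y i \<omega>) {1}))"
    by (rule indep_var_compose) (auto intro!: measurable_component_singleton)
  moreover have "(\<lambda>f. f 0) \<circ> (\<lambda>\<omega>. restrict (\<lambda>i. ?Y i \<omega>) {0}) = (\<lambda>\<omega>. X s \<omega> - X 0 \<omega>)"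
    "(\<lambda>f. f 1) \<circ> (\<lambda>\<omega>. restrict (\<lambda>i. ?Y i \<omega>) {1}) = (\<lambda>\<omega>. X (s + h) \<omega> - X s \<omega>)"
    by (auto simp: \<tau>_def fun_eq_iff)
  ultimately show ?thesis by simp
qed

text \<open>The Markov property for nonnegative integrands: \<open>X s\<close> and the increment
  after \<open>s\<close> have the product law. Independence is available for
  \<open>X s - X 0\<close>, which equals \<open>X s\<close> almost surely.\<close>

lemma nn_integral_increment:
  assumes s: "0 \<le> s" and h: "0 \<le> h" and f[measurable]: "case_prod f \<in> borel_measurable (borel \<Otimes>\<^sub>M borel)"
  shows "(\<integral>\<^sup>+\<omega>. f (X s \<omega>) (X (s + h) \<omega> - X s \<omega>) \<partial>M) = (\<integral>\<^sup>+x. (\<integral>\<^sup>+y. f x y \<partial>law h) \<partial>law s)"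
proof -
  have sh: "0 \<le> s + h" using s h by simp
  note [measurable] = measurable_X[OF s] measurable_X[OF h] measurable_X[OF sh] measurable_X[of 0, simplified]
  interpret h: prob_space "law h" by (rule prob_space_law[OF h])
  let ?A = "\<lambda>\<omega>. X s \<omega> - X 0 \<omega>" and ?B = "\<lambda>\<omega>. X (s + h) \<omega> - X s \<omega>"
  have A: "distr M borel ?A = law s" using law_increment[of 0 s] s by simp
  have "(\<integral>\<^sup>+\<omega>. f (X s \<omega>) (?B \<omega>) \<partial>M) = (\<integral>\<^sup>+\<omega>. case_prod f (?A \<omega>, ?B \<omega>) \<partial>M)"
    by (rule nn_integral_cong_AE) (use X_zero in eventually_elim, simp)
  also have "\<dots> = (\<integral>\<^sup>+z. case_prod f z \<partial>distr M (borel \<Otimes>\<^sub>M borel) (\<lambda>\<omega>. (?A \<omega>, ?B \<omega>)))"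
    by (subst nn_integral_distr) auto
  also have "distr M (borel \<Otimes>\<^sub>M borel) (\<lambda>\<omega>. (?A \<omega>, ?B \<omega>)) = distr M borel ?A \<Otimes>\<^sub>M distr M borel ?B"
    using indep_increment[OF s h] unfolding indep_var_distribution_eq by simp
  also have "\<dots> = law s \<Otimes>\<^sub>M law h" unfolding A law_increment[OF s h] ..
  also have "(\<integral>\<^sup>+z. case_prod f z \<partial>(law s \<Otimes>\<^sub>M law h)) = (\<integral>\<^sup>+x. (\<integral>\<^sup>+y. f x y \<partial>law h) \<partial>law s)"
    by (subst h.nn_integral_fst[symmetric]) auto
  finally show ?thesis .
qed

lemma nn_integral_law_add:
  assumes s: "0 \<le> s" and h: "0 \<le> h" and [measurable]: "f \<in> borel_measurable borel"
  shows "(\<integral>\<^sup>+z. f z \<partial>law (s + h)) = (\<integral>\<^sup>+x. (\<integral>\<^sup>+y. f (x + y) \<partial>law h) \<partial>law s)"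
proof -
  have sh: "0 \<le> s + h" using s h by simp
  note [measurable] = measurable_X[OF sh]
  have "(\<integral>\<^sup>+z. f z \<partial>law (s + h)) = (\<integral>\<^sup>+\<omega>. f (X s \<omega> + (X (s + h) \<omega> - X s \<omega>)) \<partial>M)"
    by (subst nn_integral_distr) auto
  also have "\<dots> = (\<integral>\<^sup>+x. (\<integral>\<^sup>+y. f (x + y) \<partial>law h) \<partial>law s)"
    by (rule nn_integral_increment[OF s h, of "\<lambda>x y. f (x + y)"]) measurable
  finally show ?thesis .
qed

end

text \<open>A positive measurable \<open>p\<close> may come arbitrarily close to 0 on every
  interval, but on the bounded set \<open>B\<close> it is below a small level \<open>d\<close> only
  on a set \<open>S n\<close> of small measure. For \<open>z\<close> in \<open>[u, v]\<close> the
  points \<open>x\<close> of \<open>(0, a)\<close> at which \<open>p x\<close> or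
  \<open>p (z - x)\<close> is below the level fill at most half of \<open>(0, a)\<close>, so the
  convolution at \<open>z\<close> is at least \<open>d^2 * (a / 2)\<close>, uniformly in
  \<open>z\<close>.\<close>

lemma convolution_square_minorized:
  fixes p :: "real \<Rightarrow> real"
  assumes [measurable]: "p \<in> borel_measurable borel" and nn: "\<And>x. 0 \<le> p x"
    and I: "I = UNIV \<or> I = {0<..}" and pos: "\<And>x. x \<in> I \<Longrightarrow> 0 < p x"
    and sets: "sets \<mu> = sets borel"
    and eq: "\<And>h. h \<in> borel_measurable borel \<Longrightarrow> (\<integral>\<^sup>+z. h z \<partial>\<mu>) =
      (\<integral>\<^sup>+x. ennreal (p x) * (\<integral>\<^sup>+y. ennreal (p y) * h (x + y) \<partial>lborel) \<partial>lborel)"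
  shows "locally_minorized \<mu> I"
  unfolding locally_minorized_def
proof (intro ballI)
  fix u v assume u: "u \<in> I" and v: "v \<in> I"
  \<comment> \<open>On the half line \<open>a = u\<close> makes \<open>z - x\<close> positive for
    \<open>x < a\<close> and \<open>z >= u\<close>; on the line any length would do. The interval
    \<open>B\<close> below contains both \<open>x\<close> and \<open>z - x\<close> and lies in
    \<open>I\<close>.\<close>
  define a where "a = (if I = UNIV then 1 else u)"
  have a: "a > 0" unfolding a_def using I u by auto
  define B where "B = {min 0 (u - a)<..<max a v}"
  have BI: "B \<subseteq> I" unfolding B_def a_def using I u by (auto simp: min_def)
  define S where "S n = {x\<in>B. p x \<le> 1 / Suc n}" for n
  have [measurable]: "B \<in> sets borel" "S n \<in> sets borel" for n unfolding S_def B_def by measurable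
  have fin: "emeasure lborel (S n) \<noteq> \<infinity>" for n
  proof -
    have "emeasure lborel (S n) \<le> emeasure lborel B" by (rule emeasure_mono) (auto simp: S_def)
    also have "\<dots> < \<infinity>" unfolding B_def by (subst emeasure_lborel_Ioo) (use a in auto)
    finally show ?thesis by simp
  qed
  have "(\<lambda>n. emeasure lborel (S n)) \<longlonglongrightarrow> emeasure lborel (\<Inter>n. S n)"
  proof (rule Lim_emeasure_decseq)
    show "decseq S"
    proof (rule decseq_SucI)
      fix n
      have "(1::real) / Suc (Suc n) \<le> 1 / Suc n" by (simp add: frac_le)
      then show "S (Suc n) \<subseteq> S n" unfolding S_def by (auto intro: order_trans)
    qed
  qed (use fin in auto)
  also have "(\<Inter>n. S n) = {}"
  proof -
    have "\<exists>n. x \<notin> S n" for x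
    proof (cases "x \<in> B")
      case True
      then have "0 < p x" using BI pos by auto
      then obtain n where "1 / Suc n < p x" using nat_approx_posE by blast
      then show ?thesis unfolding S_def by (intro exI[of _ n]) auto
    qed (simp add: S_def)
    then show ?thesis by auto
  qed
  finally have "(\<lambda>n. emeasure lborel (S n)) \<longlonglongrightarrow> 0" by simp
  then have "\<forall>\<^sub>F n in sequentially. emeasure lborel (S n) < ennreal (a / 4)"
    by (rule order_tendstoD) (use a in simp)
  \<comment> \<open>The bad set is counted twice, for \<open>x\<close> and for \<open>z - x\<close>,
    hence a quarter of \<open>a\<close>.\<close>
  then obtain n where n: "emeasure lborel (S n) < ennreal (a / 4)"
    using eventually_happens'[OF sequentially_bot] by blast
  define d where "d = 1 / Suc n"
  have d: "d > 0" unfolding d_def by simp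
  have S: "S n = {x\<in>B. p x \<le> d}" unfolding S_def d_def ..
  define k where "k z = (\<integral>\<^sup>+x. ennreal (p x) * ennreal (p (z - x)) \<partial>lborel)" for z
  have [measurable]: "k \<in> borel_measurable borel" unfolding k_def by measurable
  have klow: "ennreal (d\<^sup>2 * (a / 2)) \<le> k z" if z: "z \<in> {u..v}" for z
  proof -
    define G where "G = {x\<in>{0<..<a}. d < p x \<and> d < p (z - x)}"
    have [measurable]: "G \<in> sets borel" unfolding G_def by measurable
    have zB: "z - x \<in> B" if "x \<in> {0<..<a}" for x using that z unfolding B_def by auto
    have xB: "x \<in> B" if "x \<in> {0<..<a}" for x using that z unfolding B_def by auto
    have "ennreal a = (\<integral>\<^sup>+x. indicator {0<..<a} x \<partial>lborel)" using a by simp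
    also have "\<dots> \<le> (\<integral>\<^sup>+x. indicator G x + (indicator (S n) x + indicator (S n) (z - x)) \<partial>lborel)"
    proof (rule nn_integral_mono)
      fix x
      show "indicator {0<..<a} x \<le> (indicator G x + (indicator (S n) x + indicator (S n) (z - x)) :: ennreal)"
        using zB[of x] xB[of x] by (auto simp: G_def S indicator_def)
    qed
    also have "\<dots> = emeasure lborel G + (emeasure lborel (S n) + (\<integral>\<^sup>+x. indicator (S n) (z - x) \<partial>lborel))"
      by (simp add: nn_integral_add)
    also have "(\<integral>\<^sup>+x. indicator (S n) (z - x) \<partial>lborel) = emeasure lborel (S n)"
      using nn_integral_real_affine[of "indicator (S n)" "-1" z] by simp
    also have "emeasure lborel G + (emeasure lborel (S n) + emeasure lborel (S n)) \<le> emeasure lborel G + (ennreal (a/4) + ennreal (a/4))"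
      using n by (intro add_left_mono add_mono) auto
    also have "ennreal (a/4) + ennreal (a/4) = ennreal (a/2)" using a by (simp flip: ennreal_plus)
    finally have "ennreal a \<le> emeasure lborel G + ennreal (a/2)" .
    then have "ennreal a - ennreal (a/2) \<le> emeasure lborel G + ennreal (a/2) - ennreal (a/2)" by (rule ennreal_minus_mono) simp
    then have G: "ennreal (a/2) \<le> emeasure lborel G" using a by (simp add: ennreal_minus)
    have "ennreal (d\<^sup>2 * (a / 2)) = ennreal (d\<^sup>2) * ennreal (a / 2)" by (rule ennreal_mult') simp
    also have "\<dots> \<le> ennreal (d\<^sup>2) * emeasure lborel G" by (rule mult_left_mono[OF G]) simp
    also have "\<dots> = (\<integral>\<^sup>+x. ennreal (d\<^sup>2) * indicator G x \<partial>lborel)" by (subst nn_integral_cmult_indicator) auto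
    also have "\<dots> \<le> k z" unfolding k_def
    proof (rule nn_integral_mono)
      fix x
      show "ennreal (d\<^sup>2) * indicator G x \<le> ennreal (p x) * ennreal (p (z - x))"
      proof (cases "x \<in> G")
        case True
        then have "d * d \<le> p x * p (z - x)" using d by (intro mult_mono) (auto simp: G_def)
        then show ?thesis using True nn by (simp add: power2_eq_square ennreal_mult'[symmetric] ennreal_leI)
      qed simp
    qed
    finally show ?thesis .
  qed
  show "\<exists>c>0. \<forall>h\<in>borel_measurable borel. ennreal c * (\<integral>\<^sup>+y. h y * indicator {u..v} y \<partial>lborel) \<le> (\<integral>\<^sup>+y. h y \<partial>\<mu>)"
  proof (intro exI[of _ "d\<^sup>2 * (a / 2)"] conjI ballI)
    show "0 < d\<^sup>2 * (a / 2)" using d a by simp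
    fix h :: "real \<Rightarrow> ennreal" assume [measurable]: "h \<in> borel_measurable borel"
    have "ennreal (d\<^sup>2 * (a / 2)) * (\<integral>\<^sup>+y. h y * indicator {u..v} y \<partial>lborel) = (\<integral>\<^sup>+y. ennreal (d\<^sup>2 * (a / 2)) * (h y * indicator {u..v} y) \<partial>lborel)"
      by (rule nn_integral_cmult[symmetric]) measurable
    also have "\<dots> \<le> (\<integral>\<^sup>+z. k z * h z \<partial>lborel)"
      by (rule nn_integral_mono) (use klow in \<open>auto simp: indicator_def intro!: mult_right_mono\<close>)
    also have "\<dots> = (\<integral>\<^sup>+z. (\<integral>\<^sup>+x. ennreal (p x) * (ennreal (p (z - x)) * h z) \<partial>lborel) \<partial>lborel)"
      unfolding k_def by (intro nn_integral_cong) (simp add: nn_integral_multc[symmetric] mult.assoc)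
    also have "\<dots> = (\<integral>\<^sup>+x. (\<integral>\<^sup>+z. ennreal (p x) * (ennreal (p (z - x)) * h z) \<partial>lborel) \<partial>lborel)"
      by (rule lborel_pair.Fubini') measurable
    also have "\<dots> = (\<integral>\<^sup>+x. ennreal (p x) * (\<integral>\<^sup>+y. ennreal (p y) * h (x + y) \<partial>lborel) \<partial>lborel)"
    proof (rule nn_integral_cong)
      fix x
      have "(\<integral>\<^sup>+z. ennreal (p x) * (ennreal (p (z - x)) * h z) \<partial>lborel) = ennreal (p x) * (\<integral>\<^sup>+z. ennreal (p (z - x)) * h z \<partial>lborel)"
        by (rule nn_integral_cmult) measurable
      also have "(\<integral>\<^sup>+z. ennreal (p (z - x)) * h z \<partial>lborel) = (\<integral>\<^sup>+y. ennreal (p y) * h (x + y) \<partial>lborel)"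
        by (subst nn_integral_real_affine[where c=1 and t=x]) auto
      finally show "(\<integral>\<^sup>+z. ennreal (p x) * (ennreal (p (z - x)) * h z) \<partial>lborel) = ennreal (p x) * (\<integral>\<^sup>+y. ennreal (p y) * h (x + y) \<partial>lborel)" .
    qed
    also have "\<dots> = (\<integral>\<^sup>+z. h z \<partial>\<mu>)" by (rule eq[symmetric]) measurable
    finally show "ennreal (d\<^sup>2 * (a / 2)) * (\<integral>\<^sup>+y. h y * indicator {u..v} y \<partial>lborel) \<le> (\<integral>\<^sup>+y. h y \<partial>\<mu>)" .
  qed
qed

context levy_process
begin

lemma density_measurable:
  assumes "transition_density M X p" "0 < t"
  shows "p t \<in> borel_measurable borel" "0 \<le> p t x" "law t = density lborel (\<lambda>x. ennreal (p t x))"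
proof -
  have d: "distributed M lborel (X t) (\<lambda>x. ennreal (p t x))" and nn: "\<And>x. 0 \<le> p t x"
    using assms unfolding transition_density_def by auto
  have "(\<lambda>x. ennreal (p t x)) \<in> borel_measurable lborel" using d unfolding distributed_def by auto
  then have "(\<lambda>x. enn2real (ennreal (p t x))) \<in> borel_measurable borel" by measurable
  then show "p t \<in> borel_measurable borel" using nn by simp
  show "0 \<le> p t x" by (rule nn)
  have "distr M lborel (X t) = density lborel (\<lambda>x. ennreal (p t x))"
    using d unfolding distributed_def by auto
  moreover have "distr M lborel (X t) = law t" by (rule distr_cong) auto
  ultimately show "law t = density lborel (\<lambda>x. ennreal (p t x))" by simp
qed

lemma law_double_minorized:
  assumes td: "transition_density M X p" and t: "0 < t"
    and I: "I = UNIV \<or> I = {0<..}" and pos: "\<And>x. x \<in> I \<Longrightarrow> 0 < p t x"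
  shows "locally_minorized (law (t + t)) I"
proof (rule convolution_square_minorized[OF _ _ I pos])
  note pt[measurable] = density_measurable(1)[OF td t]
  show "p t \<in> borel_measurable borel" "\<And>x. 0 \<le> p t x" by (rule density_measurable[OF td t])+
  show "sets (law (t + t)) = sets borel" by simp
  fix h :: "real \<Rightarrow> ennreal" assume [measurable]: "h \<in> borel_measurable borel"
  show "(\<integral>\<^sup>+z. h z \<partial>law (t + t)) = (\<integral>\<^sup>+x. ennreal (p t x) * (\<integral>\<^sup>+y. ennreal (p t y) * h (x + y) \<partial>lborel) \<partial>lborel)"
    using nn_integral_law_add[of t t h] t unfolding density_measurable(3)[OF td t]
    by (simp add: nn_integral_density)
qed

text \<open>The point 0, where \<open>p t\<close> is not prescribed, is null because the law has a
  density. At time \<open>t + t\<close> two positive increments add up.\<close>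

lemma AE_law_pos:
  assumes td: "transition_density M X p" and t: "0 < t" and z: "\<And>x. x < 0 \<Longrightarrow> p t x = 0"
  shows "AE x in law t. 0 < x" "AE x in law (t + t). 0 < x"
proof -
  note pt[measurable] = density_measurable(1)[OF td t]
  have t0: "0 \<le> t" and tt: "0 \<le> t + t" using t by auto
  have tt': "0 \<le> 2 * t" using t by simp
  note [measurable] = measurable_X[OF t0] measurable_X[OF tt] measurable_X[OF tt']
  show 1: "AE x in law t. 0 < x"
    unfolding density_measurable(3)[OF td t]
  proof (subst AE_density)
    show "AE x in lborel. 0 < ennreal (p t x) \<longrightarrow> 0 < x"
      using AE_lborel_singleton[of 0]
    proof eventually_elim
      case (elim x)
      then show ?case using z[of x] by (cases "x < 0") auto
    qed
  qed measurable
  have a: "AE \<omega> in M. 0 < X t \<omega>" using 1 by (subst (asm) AE_distr_iff) auto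
  have "AE x in distr M borel (\<lambda>\<omega>. X (t + t) \<omega> - X t \<omega>). 0 < x" unfolding law_increment[OF t0 t0] by (rule 1)
  then have "AE \<omega> in M. 0 < X (t + t) \<omega> - X t \<omega>" by (subst (asm) AE_distr_iff) auto
  with a have "AE \<omega> in M. 0 < X (t + t) \<omega>" by eventually_elim simp
  then show "AE x in law (t + t). 0 < x" by (subst AE_distr_iff) auto
qed

text \<open>Tested on the events that \<open>X s\<close> lies in \<open>B\<close>, the martingale
  property says that \<open>g\<close> averaged over the next increment and \<open>C * g\<close> have
  the same integral over every \<open>B\<close> under the law at time \<open>s\<close>. Hence they
  agree almost everywhere for that law, that is, Lebesgue almost everywhere where its density is
  positive. The constant is the ratio of the normalising expectations at \<open>s + h\<close> and
  \<open>s\<close>.\<close>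

lemma martingale_harmonic:
  assumes td: "transition_density M X p" and s: "0 < s" and h: "0 \<le> h"
    and gm[measurable]: "g \<in> borel_measurable borel" and gpos: "\<And>x. 0 < g x"
    and int: "\<And>t. 0 \<le> t \<Longrightarrow> integrable M (\<lambda>\<omega>. g (X t \<omega>))"
    and mart: "martingale M (natural_filtration M X) (\<lambda>t \<omega>. g (X t \<omega>) / (LINT \<omega>'|M. g (X t \<omega>')))"
  obtains C where "0 < C" "AE x in lborel. 0 < p s x \<longrightarrow> (\<integral>\<^sup>+y. ennreal (g (x + y)) \<partial>law h) = ennreal (C * g x)"
proof -
  define m where "m t = (LINT \<omega>|M. g (X t \<omega>))" for t
  have s0: "0 \<le> s" and sh: "0 \<le> s + h" using s h by auto
  note X[measurable] = measurable_X[OF s0] measurable_X[OF sh]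
  note [measurable] = density_measurable(1)[OF td s]
  have mpos: "0 < m t" if "0 \<le> t" for t
  proof -
    have "0 \<le> m t" unfolding m_def by (intro Bochner_Integration.integral_nonneg) (use gpos in \<open>auto simp: less_imp_le\<close>)
    moreover have "m t \<noteq> 0"
    proof
      assume "m t = 0"
      then have "AE \<omega> in M. g (X t \<omega>) = 0"
        unfolding m_def using int[OF that] by (subst (asm) integral_nonneg_eq_0_iff_AE) (use gpos in \<open>auto simp: less_imp_le\<close>)
      then have "AE \<omega> in M. False" by eventually_elim (use gpos in \<open>metis less_irrefl\<close>)
      then show False by simp
    qed
    ultimately show ?thesis by simp
  qed
  define C where "C = m (s + h) / m s"
  have C: "C > 0" unfolding C_def using mpos s0 sh by simp
  let ?F = "natural_filtration M X s"
  let ?Y = "\<lambda>t \<omega>. g (X t \<omega>) / m t"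
  have sub: "subalgebra M ?F" using mart s0 unfolding martingale_def by blast
  interpret fs: finite_measure_subalgebra M ?F
    by (unfold_locales) (rule sub)
  have ce: "AE \<omega> in M. real_cond_exp M ?F (?Y (s + h)) \<omega> = ?Y s \<omega>"
    using mart s0 h unfolding martingale_def m_def by auto
  have intY: "integrable M (?Y t)" if "0 \<le> t" for t using int[OF that] by simp
  have key: "(LINT \<omega>|M. indicator B (X s \<omega>) * g (X (s + h) \<omega>)) = C * (LINT \<omega>|M. indicator B (X s \<omega>) * g (X s \<omega>))"
    if B[measurable]: "B \<in> sets borel" for B
  proof -
    let ?A = "X s -` B \<inter> space M"
    have A: "?A \<in> sets ?F" unfolding natural_filtration_def 
      by (rule in_measure_of) (use s0 B in \<open>auto intro!: exI[of _ s] exI[of _ B]\<close>)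
    have "(LINT \<omega>:?A|M. ?Y (s + h) \<omega>) = (LINT \<omega>:?A|M. real_cond_exp M ?F (?Y (s + h)) \<omega>)"
      by (rule fs.real_cond_exp_intA[OF intY[OF sh] A])
    also have "\<dots> = (LINT \<omega>:?A|M. ?Y s \<omega>)"
      unfolding set_lebesgue_integral_def
      by (rule integral_cong_AE) (use ce in \<open>auto\<close>)
    finally have e: "(LINT \<omega>:?A|M. ?Y (s + h) \<omega>) = (LINT \<omega>:?A|M. ?Y s \<omega>)" .
    have r: "(LINT \<omega>:?A|M. ?Y t \<omega>) = (LINT \<omega>|M. indicator B (X s \<omega>) * g (X t \<omega>)) / m t" for t
      unfolding set_lebesgue_integral_def integral_divide_zero[symmetric]
      by (rule Bochner_Integration.integral_cong) (auto simp: indicator_def)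
    show ?thesis using e unfolding r C_def using mpos[OF s0] mpos[OF sh] by (simp add: field_simps)
  qed
  let ?P = "\<lambda>x. \<integral>\<^sup>+y. ennreal (g (x + y)) \<partial>law h"
  interpret h: prob_space "law h" by (rule prob_space_law[OF h])
  interpret s: prob_space "law s" by (rule prob_space_law[OF s0])
  have Pm[measurable]: "?P \<in> borel_measurable borel" by measurable
  have "density (law s) ?P = density (law s) (\<lambda>x. ennreal (C * g x))"
  proof (rule measure_eqI)
    fix B assume "B \<in> sets (density (law s) ?P)"
    then have B[measurable]: "B \<in> sets borel" by simp
    have "emeasure (density (law s) ?P) B = (\<integral>\<^sup>+x. (\<integral>\<^sup>+y. indicator B x * ennreal (g (x + y)) \<partial>law h) \<partial>law s)"
      by (subst emeasure_density) (auto intro!: nn_integral_cong simp: nn_integral_cmult mult.commute)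
    also have "\<dots> = (\<integral>\<^sup>+\<omega>. indicator B (X s \<omega>) * ennreal (g (X s \<omega> + (X (s + h) \<omega> - X s \<omega>))) \<partial>M)"
      by (rule nn_integral_increment[OF s0 h, symmetric]) measurable
    also have "\<dots> = (\<integral>\<^sup>+\<omega>. ennreal (indicator B (X s \<omega>) * g (X (s + h) \<omega>)) \<partial>M)"
      by (rule nn_integral_cong) (auto simp: indicator_def)
    also have "\<dots> = ennreal (LINT \<omega>|M. indicator B (X s \<omega>) * g (X (s + h) \<omega>))"
    proof (rule nn_integral_eq_integral)
      show "integrable M (\<lambda>\<omega>. indicator B (X s \<omega>) * g (X (s + h) \<omega>))"
        by (rule Bochner_Integration.integrable_bound[OF int[OF sh]]) (auto simp: indicator_def)
    qed (use gpos in \<open>auto simp: less_imp_le\<close>)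
    also have "\<dots> = ennreal C * ennreal (LINT \<omega>|M. indicator B (X s \<omega>) * g (X s \<omega>))"
      unfolding key[OF B] using C by (simp add: ennreal_mult')
    also have "ennreal (LINT \<omega>|M. indicator B (X s \<omega>) * g (X s \<omega>)) = (\<integral>\<^sup>+\<omega>. ennreal (indicator B (X s \<omega>) * g (X s \<omega>)) \<partial>M)"
    proof (rule nn_integral_eq_integral[symmetric])
      show "integrable M (\<lambda>\<omega>. indicator B (X s \<omega>) * g (X s \<omega>))"
        by (rule Bochner_Integration.integrable_bound[OF int[OF s0]]) (auto simp: indicator_def)
    qed (use gpos in \<open>auto simp: less_imp_le\<close>)
    also have "\<dots> = (\<integral>\<^sup>+x. ennreal (indicator B x * g x) \<partial>law s)"
      by (subst nn_integral_distr) auto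
    also have "ennreal C * \<dots> = (\<integral>\<^sup>+x. ennreal (C * g x) * indicator B x \<partial>law s)"
      by (subst nn_integral_cmult[symmetric]) (use C in \<open>auto intro!: nn_integral_cong simp: indicator_def ennreal_mult'\<close>)
    also have "\<dots> = emeasure (density (law s) (\<lambda>x. ennreal (C * g x))) B"
      by (subst emeasure_density) auto
    finally show "emeasure (density (law s) ?P) B = emeasure (density (law s) (\<lambda>x. ennreal (C * g x))) B" .
  qed simp
  then have "AE x in law s. ?P x = ennreal (C * g x)"
    by (subst (asm) s.density_unique_iff) auto
  then have "AE x in lborel. 0 < p s x \<longrightarrow> ?P x = ennreal (C * g x)"
    unfolding density_measurable(3)[OF td s] by (subst (asm) AE_density) auto
  then show thesis by (rule that[OF C])
qed

end

section \<open>Exponential moments\<close>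

text \<open>The lower bound extends from a short interval to \<open>[0, T]\<close>, and
  \<open>r T = 0\<close> makes \<open>r\<close> insensitive to multiples of \<open>T\<close>. So
  \<open>n r(t) = r(n t)\<close> stays bounded below in \<open>n\<close>, and \<open>r >= 0\<close>.
  The nonnegative values \<open>r t\<close> and \<open>r (k T - t)\<close> add up to 0, hence both
  vanish.\<close>

lemma additive_bounded_below_eq_zero:
  fixes r :: "real \<Rightarrow> real"
  assumes add: "\<And>s h. 0 \<le> s \<Longrightarrow> 0 \<le> h \<Longrightarrow> r (s + h) = r s + r h"
    and T: "T > 0" "r T = 0" and d: "d > 0" "\<And>t. 0 \<le> t \<Longrightarrow> t \<le> d \<Longrightarrow> - B \<le> r t" and t: "0 \<le> t"
  shows "r t = 0"
proof -
  have r0: "r 0 = 0" using add[of 0 0] by simp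
  have mult: "r (real n * s) = real n * r s" if "0 \<le> s" for n s
  proof (induction n)
    case (Suc n)
    have "r (real (Suc n) * s) = r (real n * s + s)" by (simp add: algebra_simps)
    also have "\<dots> = r (real n * s) + r s" using that by (intro add) auto
    finally show ?case using Suc by (simp add: algebra_simps)
  qed (simp add: r0)
  obtain m :: nat where m: "T / d < m" using reals_Archimedean2 by blast
  have m0: "m > 0" using m T(1) d(1) by (cases "m = 0") (auto simp: divide_less_0_iff)
  have low: "- (m * B) \<le> r u" if "0 \<le> u" "u \<le> T" for u
  proof -
    have "T < m * d" using m d by (simp add: divide_less_eq)
    then have "- B \<le> r (u / m)" using that m0 by (intro d) (auto simp: divide_le_eq mult.commute)
    then have "m * - B \<le> m * r (u / m)" by (intro mult_left_mono) auto
    also have "\<dots> = r u" using mult[of "u / m" m] that m0 by simp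
    finally show ?thesis by simp
  qed
  have nonneg: "0 \<le> r t" if t: "0 \<le> t" for t
  proof (rule ccontr)
    assume "\<not> ?thesis"
    then have neg: "- r t > 0" by simp
    obtain n :: nat where n: "(m * B) / (- r t) < n" using reals_Archimedean2 by blast
    then have "m * B < n * (- r t)" using neg by (simp only: pos_divide_less_eq)
    then have n1: "real n * r t < - (m * B)" by simp
    define k where "k = nat \<lfloor>n * t / T\<rfloor>"
    have q: "0 \<le> n * t / T" using t T by simp
    then have k: "real k = of_int \<lfloor>n * t / T\<rfloor>" unfolding k_def by simp
    have "real k \<le> n * t / T" "n * t / T < real k + 1" unfolding k by linarith+
    then have u: "0 \<le> n * t - k * T" "n * t - k * T \<le> T" using T by (auto simp: le_divide_eq divide_less_eq algebra_simps)
    have "r (n * t) = r (k * T + (n * t - k * T))" by simp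
    also have "\<dots> = r (k * T) + r (n * t - k * T)" using u T by (intro add) auto
    also have "r (k * T) = 0" using mult[of T k] T by simp
    finally have "r (n * t) \<ge> - (m * B)" using low[OF u] by simp
    then show False using mult[OF t, of n] n1 by simp
  qed
  obtain k :: nat where "t / T < k" using reals_Archimedean2 by blast
  then have k: "0 \<le> k * T - t" using T by (simp add: divide_less_eq)
  have "0 = r (t + (k * T - t))" using mult[of T k] T by simp
  also have "\<dots> = r t + r (k * T - t)" using t k by (rule add)
  finally show ?thesis using nonneg[OF t] nonneg[OF k] by linarith
qed

context levy_process
begin

text \<open>The moment \<open>f t\<close>, a priori possibly infinite, is multiplicative in time;
  being nonzero at the complementary time \<open>k T - t\<close>, it is finite at \<open>t\<close>.
  Fatou's lemma and right-continuity at 0 yield a lower bound near 0, and this one-sided regularity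
  is what the additive equation for \<open>ln F\<close> asks for.\<close>

lemma exp_moment_all_times:
  assumes T: "T > 0" and hb: "has_bochner_integral (law T) (\<lambda>y. exp (l * y)) C" and C: "C > 0"
    and t: "t \<ge> 0"
  shows "has_bochner_integral M (\<lambda>\<omega>. exp (l * X t \<omega>)) (exp (ln C / T * t))"
proof -
  define f where "f t = (\<integral>\<^sup>+y. ennreal (exp (l * y)) \<partial>law t)" for t
  have add: "f (s + h) = f s * f h" if "0 \<le> s" "0 \<le> h" for s h
  proof -
    have "f (s + h) = (\<integral>\<^sup>+x. (\<integral>\<^sup>+y. ennreal (exp (l * (x + y))) \<partial>law h) \<partial>law s)"
      unfolding f_def by (rule nn_integral_law_add[OF that]) measurable
    also have "\<dots> = (\<integral>\<^sup>+x. ennreal (exp (l * x)) * f h \<partial>law s)"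
      unfolding f_def by (intro nn_integral_cong) (simp add: distrib_left exp_add ennreal_mult' nn_integral_cmult)
    also have "\<dots> = f s * f h" unfolding f_def by (rule nn_integral_multc) measurable
    finally show ?thesis .
  qed
  have fM: "f t = (\<integral>\<^sup>+\<omega>. ennreal (exp (l * X t \<omega>)) \<partial>M)" if "0 \<le> t" for t
    unfolding f_def using measurable_X[OF that] by (subst nn_integral_distr) auto
  have f0: "f 0 = 1"
  proof -
    have "f 0 = (\<integral>\<^sup>+\<omega>. 1 \<partial>M)" unfolding fM[OF order_refl]
      by (rule nn_integral_cong_AE) (use X_zero in eventually_elim, simp)
    then show ?thesis by (simp add: emeasure_space_1)
  qed
  have fT: "f T = ennreal C"
    unfolding f_def using hb by (subst nn_integral_eq_integral) (auto simp: has_bochner_integral_iff)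
  have fn: "f (real n * T) = ennreal (C ^ n)" for n
  proof (induction n)
    case (Suc n)
    have "f (real (Suc n) * T) = f (real n * T + T)" by (simp add: algebra_simps)
    also have "\<dots> = f (real n * T) * f T" using T by (intro add) auto
    also have "\<dots> = ennreal (C ^ n) * ennreal C" unfolding Suc fT ..
    also have "\<dots> = ennreal (C ^ Suc n)" using C by (simp add: ennreal_mult'[symmetric] mult.commute)
    finally show ?case .
  qed (simp add: f0)
  have fne: "f t \<noteq> 0" if "0 \<le> t" for t
  proof
    assume "f t = 0"
    then have "AE \<omega> in M. ennreal (exp (l * X t \<omega>)) = 0"
      unfolding fM[OF that] using measurable_X[OF that] by (subst (asm) nn_integral_0_iff_AE) auto
    then have "AE \<omega> in M. False" by eventually_elim simp
    then show False by simp
  qed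
  have ftop: "f t \<noteq> \<infinity>" if t: "0 \<le> t" for t
  proof
    assume inf: "f t = \<infinity>"
    obtain k :: nat where "t / T < k" using reals_Archimedean2 by blast
    then have k: "0 \<le> k * T - t" using T by (simp add: divide_less_eq)
    have "f t * f (k * T - t) = ennreal (C ^ k)" using add[OF t k] fn[of k] by simp
    then show False using fne[OF k] unfolding inf by (simp add: ennreal_top_mult)
  qed
  define F where "F t = enn2real (f t)" for t
  have fF: "f t = ennreal (F t)" and Fpos: "F t > 0" if "0 \<le> t" for t
    unfolding F_def using ftop[OF that] fne[OF that] by (auto simp: less_top enn2real_positive_iff zero_less_iff_neq_zero)
  have Fadd: "F (s + h) = F s * F h" if "0 \<le> s" "0 \<le> h" for s h
    unfolding F_def add[OF that] by (rule enn2real_mult)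
  have "\<exists>d>0. \<forall>t. 0 \<le> t \<and> t \<le> d \<longrightarrow> ennreal (1/2) \<le> f t"
  proof (rule ccontr)
    assume neg: "\<not> ?thesis"
    have "\<exists>t. 0 \<le> t \<and> t \<le> 1 / Suc n \<and> f t < ennreal (1/2)" for n
      using neg by (metis not_le zero_less_divide_1_iff of_nat_0_less_iff zero_less_Suc)
    then obtain u where u: "\<And>n. 0 \<le> u n" "\<And>n. u n \<le> 1 / Suc n" "\<And>n. f (u n) < ennreal (1/2)" by metis
    have upos: "0 < u n" for n
    proof -
      have "u n \<noteq> 0"
      proof
        assume "u n = 0"
        then have "ennreal 1 < ennreal (1/2)" using u(3)[of n] unfolding f0[symmetric] by (simp add: f0)
        then show False by (subst (asm) ennreal_less_iff) auto
      qed
      then show ?thesis using u(1)[of n] by simp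
    qed
    have u0: "filterlim u (at_right 0) sequentially"
      unfolding filterlim_at
    proof
      show "\<forall>\<^sub>F n in sequentially. u n \<in> {0<..} \<and> u n \<noteq> 0" using upos by (intro always_eventually) (auto simp: less_imp_neq[symmetric])
      show "u \<longlonglongrightarrow> 0"
        by (rule tendsto_sandwich[OF _ _ tendsto_const LIMSEQ_Suc[OF lim_const_over_n[of 1]]]) (use u in auto)
    qed
    have lim: "AE \<omega> in M. (\<lambda>n. ennreal (exp (l * X (u n) \<omega>))) \<longlonglongrightarrow> ennreal 1"
      using X_zero AE_space
    proof eventually_elim
      case (elim \<omega>)
      have "((\<lambda>s. X s \<omega>) \<longlongrightarrow> X 0 \<omega>) (at_right 0)"
        using right_continuous[OF elim(2), of 0] by (simp add: continuous_within)
      then have "(\<lambda>n. X (u n) \<omega>) \<longlonglongrightarrow> 0" using elim(1) filterlim_compose[OF _ u0] by auto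
      then have "(\<lambda>n. exp (l * X (u n) \<omega>)) \<longlonglongrightarrow> exp (l * 0)" by (intro tendsto_intros)
      then show ?case by (intro tendsto_ennrealI) simp
    qed
    have mX[measurable]: "X (u n) \<in> borel_measurable M" for n using measurable_X[OF u(1)] .
    have "(1::ennreal) = (\<integral>\<^sup>+\<omega>. liminf (\<lambda>n. ennreal (exp (l * X (u n) \<omega>))) \<partial>M)"
    proof -
      have "(\<integral>\<^sup>+\<omega>. liminf (\<lambda>n. ennreal (exp (l * X (u n) \<omega>))) \<partial>M) = (\<integral>\<^sup>+\<omega>. 1 \<partial>M)"
        by (rule nn_integral_cong_AE) (use lim in eventually_elim, simp add: lim_imp_Liminf)
      then show ?thesis by (simp add: emeasure_space_1)
    qed
    also have "\<dots> \<le> liminf (\<lambda>n. \<integral>\<^sup>+\<omega>. ennreal (exp (l * X (u n) \<omega>)) \<partial>M)"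
      by (rule nn_integral_liminf) measurable
    also have "\<dots> \<le> ennreal (1/2)"
      unfolding fM[OF u(1), symmetric]
    proof (rule order_trans[OF Liminf_le_Limsup])
      show "limsup (\<lambda>n. f (u n)) \<le> ennreal (1/2)"
        by (rule Limsup_bounded) (use u(3) in \<open>auto simp: less_imp_le\<close>)
    qed simp
    finally have "ennreal 1 \<le> ennreal (1/2)" unfolding ennreal_1 .
    then show False by (subst (asm) ennreal_le_iff) auto
  qed
  then obtain d where d: "d > 0" "\<And>t. 0 \<le> t \<Longrightarrow> t \<le> d \<Longrightarrow> ennreal (1/2) \<le> f t" by blast
  have Flow: "1/2 \<le> F t" if "0 \<le> t" "t \<le> d" for t
  proof -
    have "ennreal (1/2) \<le> ennreal (F t)" using d(2)[OF that] unfolding fF[OF that(1)] .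
    then show ?thesis using Fpos[OF that(1)] by (subst (asm) ennreal_le_iff) auto
  qed
  \<comment> \<open>Subtracting \<open>a * t\<close> normalises the additive function
    \<open>ln F\<close> to vanish at \<open>T\<close>.\<close>
  define a where "a = ln C / T"
  have "ln (F t) - a * t = 0"
  proof (rule additive_bounded_below_eq_zero[of "\<lambda>t. ln (F t) - a * t" T d "ln 2 + \<bar>a\<bar> * d"])
    show "ln (F (s + h)) - a * (s + h) = ln (F s) - a * s + (ln (F h) - a * h)" if "0 \<le> s" "0 \<le> h" for s h
      using Fpos[OF that(1)] Fpos[OF that(2)] unfolding Fadd[OF that] by (simp add: ln_mult algebra_simps)
    show "ln (F T) - a * T = 0" using T C unfolding F_def a_def fT by simp
    show "- (ln 2 + \<bar>a\<bar> * d) \<le> ln (F t) - a * t" if "0 \<le> t" "t \<le> d" for t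
    proof -
      have "ln (1/2) \<le> ln (F t)" using Flow[OF that] by (subst ln_le_cancel_iff) (use Fpos[OF that(1)] in auto)
      moreover have "a * t \<le> \<bar>a\<bar> * d" using that by (intro mult_mono) auto
      ultimately show ?thesis by (simp add: ln_div)
    qed
  qed (use T d t in auto)
  then have "F t = exp (a * t)" using Fpos[OF t] by (metis eq_iff_diff_eq_0 exp_ln)
  then have "(\<integral>\<^sup>+\<omega>. ennreal (exp (l * X t \<omega>)) \<partial>M) = ennreal (exp (a * t))" using fF[OF t] fM[OF t] by simp
  then show ?thesis unfolding a_def[symmetric]
    using measurable_X[OF t] by (intro has_bochner_integral_nn_integral) auto
qed

end

section \<open>Convexity and the number of exponential solutions\<close>

lemma exp_gt_add_one:
  fixes x :: real assumes "x \<noteq> 0" shows "1 + x < exp x"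
proof (cases "1 + x / 2 \<ge> 0")
  case True
  have "0 < x\<^sup>2" using assms by simp
  then have "1 + x < (1 + x / 2)\<^sup>2" by (simp add: power2_eq_square algebra_simps)
  also have "\<dots> \<le> (exp (x / 2))\<^sup>2" using True exp_ge_add_one_self[of "x / 2"] by (intro power_mono) auto
  also have "\<dots> = exp x" by (simp add: exp_double[symmetric])
  finally show ?thesis .
next
  case False
  then have "1 + x < 0" by simp
  then show ?thesis using exp_gt_zero[of x] by linarith
qed

text \<open>Strict convexity of \<open>e^{lx}\<close> in \<open>l\<close>, multiplied by
  \<open>l3 - l1\<close>. Both outer values are compared with the tangent at \<open>l2\<close>; the
  weights make the linear terms cancel.\<close>

lemma exp_strictly_convex:
  fixes x :: real
  assumes "l1 < l2" "l2 < l3" "x \<noteq> 0"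
  shows "(l3 - l1) * exp (l2 * x) < (l3 - l2) * exp (l1 * x) + (l2 - l1) * exp (l3 * x)"
proof -
  have a: "(l1 - l2) * x \<noteq> 0" "(l3 - l2) * x \<noteq> 0" using assms by auto
  have "(l3 - l2) * (1 + (l1 - l2) * x) + (l2 - l1) * (1 + (l3 - l2) * x) < (l3 - l2) * exp ((l1 - l2) * x) + (l2 - l1) * exp ((l3 - l2) * x)"
    using assms exp_gt_add_one[OF a(1)] exp_gt_add_one[OF a(2)] by (intro add_strict_mono mult_strict_left_mono) auto
  also have "(l3 - l2) * (1 + (l1 - l2) * x) + (l2 - l1) * (1 + (l3 - l2) * x) = l3 - l1" by (simp add: algebra_simps)
  finally have "(l3 - l1) * exp (l2 * x) < ((l3 - l2) * exp ((l1 - l2) * x) + (l2 - l1) * exp ((l3 - l2) * x)) * exp (l2 * x)"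
    by (intro mult_strict_right_mono) auto
  also have "\<dots> = (l3 - l2) * (exp ((l1 - l2) * x) * exp (l2 * x)) + (l2 - l1) * (exp ((l3 - l2) * x) * exp (l2 * x))"
    by (simp add: algebra_simps)
  also have "exp ((l1 - l2) * x) * exp (l2 * x) = exp (l1 * x)" unfolding exp_add[symmetric] by (simp add: algebra_simps)
  also have "exp ((l3 - l2) * x) * exp (l2 * x) = exp (l3 * x)" unfolding exp_add[symmetric] by (simp add: algebra_simps)
  finally show ?thesis .
qed

lemma card_le_2_if_no_3_chain:
  fixes S :: "'a::linorder set"
  assumes "\<And>a b c. a \<in> S \<Longrightarrow> b \<in> S \<Longrightarrow> c \<in> S \<Longrightarrow> a < b \<Longrightarrow> b < c \<Longrightarrow> False"
  shows "finite S \<and> card S \<le> 2"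
proof (rule ccontr)
  assume "\<not> ?thesis"
  then have "infinite S \<or> 3 \<le> card S" by auto
  then obtain T where "T \<subseteq> S" "card T = 3"
    by (metis infinite_arbitrarily_large obtain_subset_with_card_n)
  then obtain a b c where "a \<in> S" "b \<in> S" "c \<in> S" "a \<noteq> b" "b \<noteq> c" "a \<noteq> c"
    by (auto simp: card_3_iff)
  then show False using assms by (metis linorder_neqE)
qed

context levy_process
begin

text \<open>\<open>X 1\<close> has a density and so is almost surely nonzero, which makes
  \<open>E e^{l X 1}\<close> strictly convex in \<open>l\<close>; a strictly convex function takes
  no value three times.\<close>

lemma exponential_solutions_card:
  assumes td: "transition_density M X p"
  shows "finite (exponential_solutions M X \<alpha>) \<and> card (exponential_solutions M X \<alpha>) \<le> 2"
proof (rule card_le_2_if_no_3_chain)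
  fix l1 l2 l3
  assume S: "l1 \<in> exponential_solutions M X \<alpha>" "l2 \<in> exponential_solutions M X \<alpha>" "l3 \<in> exponential_solutions M X \<alpha>"
    and l: "l1 < l2" "l2 < l3"
  have [measurable]: "X 1 \<in> borel_measurable M" by (rule measurable_X) simp
  have [measurable]: "p 1 \<in> borel_measurable borel" by (rule density_measurable[OF td]) simp
  have int: "integrable M (\<lambda>\<omega>. exp (l * X 1 \<omega>))" "(LINT \<omega>|M. exp (l * X 1 \<omega>)) = exp \<alpha>"
    if "l \<in> exponential_solutions M X \<alpha>" for l
    using that unfolding exponential_solutions_def by (auto dest: spec[of _ "1::real"])
  have "AE x in law 1. x \<noteq> 0"
  proof -
    have 1: "law 1 = density lborel (\<lambda>x. ennreal (p 1 x))" by (rule density_measurable[OF td]) simp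
    have "AE x in lborel. 0 < ennreal (p 1 x) \<longrightarrow> x \<noteq> 0"
      using AE_lborel_singleton[of 0] by eventually_elim simp
    then show ?thesis unfolding 1 by (subst AE_density) auto
  qed
  then have ne: "AE \<omega> in M. X 1 \<omega> \<noteq> 0" by (subst (asm) AE_distr_iff) auto
  have "(LINT \<omega>|M. (l3 - l1) * exp (l2 * X 1 \<omega>)) < (LINT \<omega>|M. (l3 - l2) * exp (l1 * X 1 \<omega>) + (l2 - l1) * exp (l3 * X 1 \<omega>))"
  proof (rule integral_less_AE_space)
    show "AE \<omega> in M. (l3 - l1) * exp (l2 * X 1 \<omega>) < (l3 - l2) * exp (l1 * X 1 \<omega>) + (l2 - l1) * exp (l3 * X 1 \<omega>)"
      using ne by eventually_elim (rule exp_strictly_convex[OF l])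
  qed (use int S in \<open>auto simp: emeasure_space_1\<close>)
  also have "\<dots> = (l3 - l2) * exp \<alpha> + (l2 - l1) * exp \<alpha>"
    using int S by simp
  finally show False using int S by (simp add: algebra_simps)
qed

text \<open>At a time where \<open>X t > 0\<close> almost surely, \<open>E e^{l X t}\<close> is
  strictly increasing in \<open>l\<close>.\<close>

lemma exponential_solutions_unique_half_line:
  assumes td: "transition_density M X p" and half: "positive_on_half_line p"
    and S: "l1 \<in> exponential_solutions M X \<alpha>" "l2 \<in> exponential_solutions M X \<alpha>"
  shows "l1 = l2"
proof -
  obtain t where t: "t > 0" "\<And>x. x < 0 \<Longrightarrow> p t x = 0" using half unfolding positive_on_half_line_def by blast
  have [measurable]: "X t \<in> borel_measurable M" by (rule measurable_X) (use t in simp)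
  have "AE x in law t. 0 < x" by (rule AE_law_pos(1)[OF td t(1)]) (rule t(2))
  then have pos: "AE \<omega> in M. 0 < X t \<omega>" by (subst (asm) AE_distr_iff) auto
  have int: "integrable M (\<lambda>\<omega>. exp (l * X t \<omega>))" "(LINT \<omega>|M. exp (l * X t \<omega>)) = exp (\<alpha> * t)"
    if "l \<in> exponential_solutions M X \<alpha>" for l
    using that t unfolding exponential_solutions_def by auto
  have "\<not> a < b" if S: "a \<in> exponential_solutions M X \<alpha>" "b \<in> exponential_solutions M X \<alpha>" for a b
  proof
    assume "a < b"
    have "(LINT \<omega>|M. exp (a * X t \<omega>)) < (LINT \<omega>|M. exp (b * X t \<omega>))"
    proof (rule integral_less_AE_space)
      show "AE \<omega> in M. exp (a * X t \<omega>) < exp (b * X t \<omega>)"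
        using pos by eventually_elim (use \<open>a < b\<close> in auto)
    qed (use int S in \<open>auto simp: emeasure_space_1\<close>)
    then show False using int S by simp
  qed
  then show ?thesis using S by (meson linorder_neqE)
qed

end

section \<open>Dynkin's formula for Fourier transforms\<close>

lemma DERIV_integral_dominated:
  fixes f f' :: "real \<Rightarrow> 'a \<Rightarrow> real"
  assumes int: "\<And>y. integrable N (f y)"
    and der: "\<And>y z. ((\<lambda>y. f y z) has_real_derivative f' y z) (at y)"
    and meas: "\<And>y. f' y \<in> borel_measurable N"
    and bd: "\<And>y z. \<bar>f' y z\<bar> \<le> g z" and g: "integrable N g"
  shows "((\<lambda>y. \<integral>z. f y z \<partial>N) has_real_derivative (\<integral>z. f' y z \<partial>N)) (at y)"
  unfolding DERIV_def tendsto_at_iff_sequentially comp_def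
proof (intro allI impI)
  fix h :: "nat \<Rightarrow> real"
  assume h: "\<forall>i. h i \<in> UNIV - {0}" "h \<longlonglongrightarrow> 0"
  have eq: "((\<integral>z. f (y + h i) z \<partial>N) - (\<integral>z. f y z \<partial>N)) / h i = (\<integral>z. (f (y + h i) z - f y z) / h i \<partial>N)" for i
    using int by simp
  show "(\<lambda>i. ((\<integral>z. f (y + h i) z \<partial>N) - (\<integral>z. f y z \<partial>N)) / h i) \<longlonglongrightarrow> (\<integral>z. f' y z \<partial>N)"
    unfolding eq
  proof (rule integral_dominated_convergence[OF meas _ g])
    show "(\<lambda>z. (f (y + h i) z - f y z) / h i) \<in> borel_measurable N" for i
      using int by (intro borel_measurable_divide borel_measurable_diff borel_measurable_integrable) auto
    show "AE z in N. (\<lambda>i. (f (y + h i) z - f y z) / h i) \<longlonglongrightarrow> f' y z"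
      using der[of _ y] h unfolding DERIV_def tendsto_at_iff_sequentially comp_def by blast
    show "AE z in N. norm ((f (y + h i) z - f y z) / h i) \<le> g z" for i
    proof (rule AE_I2)
      fix z
      have "norm (f (y + h i) z - f y z) \<le> g z * norm (y + h i - y)"
        by (rule field_differentiable_bound[where S=UNIV and f'="\<lambda>y. f' y z"]) (use der bd in auto)
      then show "norm ((f (y + h i) z - f y z) / h i) \<le> g z" using h by (simp add: divide_le_eq)
    qed
  qed
qed

lemma (in pair_sigma_finite) integrable_pair_bounded:
  fixes f :: "'a \<Rightarrow> 'b \<Rightarrow> 'c::{banach, second_countable_topology}" and g :: "'a \<Rightarrow> real" and h :: "'b \<Rightarrow> real"
  assumes f: "case_prod f \<in> borel_measurable (M1 \<Otimes>\<^sub>M M2)" and g: "integrable M1 g" and h: "integrable M2 h"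
    and nn: "\<And>x. 0 \<le> g x" "\<And>y. 0 \<le> h y" and bd: "\<And>x y. norm (f x y) \<le> g x * h y"
  shows "integrable (M1 \<Otimes>\<^sub>M M2) (case_prod f)"
proof (rule Bochner_Integration.integrable_bound[OF _ f])
  have [measurable]: "g \<in> borel_measurable M1" "h \<in> borel_measurable M2" using g h by auto
  show "integrable (M1 \<Otimes>\<^sub>M M2) (\<lambda>(x, y). g x * h y)"
  proof (rule integrableI_nonneg)
    have "(\<integral>\<^sup>+z. ennreal (case z of (x, y) \<Rightarrow> g x * h y) \<partial>(M1 \<Otimes>\<^sub>M M2)) = (\<integral>\<^sup>+x. (\<integral>\<^sup>+y. ennreal (g x * h y) \<partial>M2) \<partial>M1)"
      by (subst M2.nn_integral_fst[symmetric]) auto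
    also have "\<dots> = (\<integral>\<^sup>+x. ennreal (g x) \<partial>M1) * (\<integral>\<^sup>+y. ennreal (h y) \<partial>M2)"
      using nn by (simp add: ennreal_mult nn_integral_cmult nn_integral_multc)
    also have "\<dots> < \<infinity>"
      using g h nn by (simp add: nn_integral_eq_integral ennreal_mult[symmetric] integral_nonneg)
    finally show "(\<integral>\<^sup>+z. ennreal (case z of (x, y) \<Rightarrow> g x * h y) \<partial>(M1 \<Otimes>\<^sub>M M2)) < \<infinity>" .
  qed (use nn in \<open>auto\<close>)
qed (use bd nn in auto)

lemma abs_le_one_plus_square: "\<bar>x\<bar> \<le> 1 + x\<^sup>2" for x :: real
proof -
  have "0 \<le> (\<bar>x\<bar> - 1)\<^sup>2" by simp
  then have "2 * \<bar>x\<bar> \<le> 1 + x\<^sup>2" by (simp add: power2_eq_square algebra_simps)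
  then show ?thesis by linarith
qed

lemma Re_mult_iexp: "Re (u * iexp x) = Re u * cos x - Im u * sin x"
  by (simp add: cis_conv_exp[symmetric])

section \<open>Levy measures and the characteristic exponent\<close>

lemma levy_measure_integrable:
  assumes "levy_measure \<nu>" shows "integrable \<nu> (\<lambda>z. min (z\<^sup>2) 1)"
proof (rule integrableI_nonneg)
  have [measurable_cong]: "sets \<nu> = sets borel" using assms by (simp add: levy_measure_def)
  show "(\<lambda>z. min (z\<^sup>2) 1) \<in> borel_measurable \<nu>" by measurable
qed (use assms in \<open>auto simp: levy_measure_def\<close>)

text \<open>The sets \<open>1 / Suc n <= |z|\<close> have finite mass by integrability of
  \<open>min (z^2) 1\<close>, and the remaining point 0 is null. Fubini over \<open>\<nu>\<close>
  rests on this.\<close>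

lemma levy_measure_sigma_finite:
  assumes "levy_measure \<nu>" shows "sigma_finite_measure \<nu>"
proof
  have sets[measurable_cong]: "sets \<nu> = sets borel" and z: "emeasure \<nu> {0} = 0"
    and fin: "(\<integral>\<^sup>+ y. ennreal (min (y\<^sup>2) 1) \<partial>\<nu>) < \<infinity>"
    using assms by (auto simp: levy_measure_def)
  define A where "A n = {z::real. 1 / Suc n \<le> \<bar>z\<bar>}" for n
  have [measurable]: "A n \<in> sets borel" for n unfolding A_def by measurable
  have A: "emeasure \<nu> (A n) \<noteq> \<infinity>" for n
  proof -
    define q where "q = (1 / real (Suc n))\<^sup>2"
    have q: "0 < q" "q \<le> 1" unfolding q_def by (auto simp: power_le_one)
    have "ennreal q * emeasure \<nu> (A n) = (\<integral>\<^sup>+z. ennreal q * indicator (A n) z \<partial>\<nu>)"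
      by (subst nn_integral_cmult_indicator) auto
    also have "\<dots> \<le> (\<integral>\<^sup>+ y. ennreal (min (y\<^sup>2) 1) \<partial>\<nu>)"
    proof (rule nn_integral_mono)
      fix z
      show "ennreal q * indicator (A n) z \<le> ennreal (min (z\<^sup>2) 1)"
      proof (cases "z \<in> A n")
        case True
        then have "q \<le> \<bar>z\<bar>\<^sup>2" unfolding q_def A_def by (intro power_mono) auto
        then show ?thesis using True q by (auto intro!: ennreal_leI)
      qed simp
    qed
    finally have "ennreal q * emeasure \<nu> (A n) < \<infinity>" using fin by (rule le_less_trans)
    then show ?thesis using q by (auto simp: ennreal_mult_top)
  qed
  have "\<exists>n. z \<in> A n" if "z \<noteq> 0" for z
    using nat_approx_posE[of "\<bar>z\<bar>"] that unfolding A_def by (auto intro: less_imp_le)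
  then have "\<Union>(insert {0} (range A)) = space \<nu>"
    using sets_eq_imp_space_eq[OF sets] by auto
  then show "\<exists>A. countable A \<and> A \<subseteq> sets \<nu> \<and> \<Union>A = space \<nu> \<and> (\<forall>a\<in>A. emeasure \<nu> a \<noteq> \<infinity>)"
    using A z by (intro exI[of _ "insert {0} (range A)"]) auto
qed

text \<open>Second-order Taylor remainder for small jumps, trivial bound for large ones. The product
  form separates the variables for Fubini, and its quadratic factor in \<open>\<xi>\<close> is the
  reason for asking two moments of frequency measures.\<close>

lemma levy_kernel_bound:
  "cmod (1 - iexp (z * \<xi>) + \<i> * complex_of_real (z * \<xi> * indicator {0<..<1} \<bar>z\<bar>)) \<le> 2 * (1 + \<xi>\<^sup>2) * min (z\<^sup>2) 1"
proof (cases "\<bar>z\<bar> < 1")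
  case True
  have z2: "z\<^sup>2 \<le> 1" using True by (simp add: abs_square_le_1)
  have "cmod (iexp (z * \<xi>) - (1 + \<i> * complex_of_real (z * \<xi>))) \<le> \<bar>z * \<xi>\<bar>\<^sup>2 / 2"
    using iexp_approx1[of "z * \<xi>" 1] by (simp add: numeral_2_eq_2)
  moreover have "1 - iexp (z * \<xi>) + \<i> * complex_of_real (z * \<xi> * indicator {0<..<1} \<bar>z\<bar>) = - (iexp (z * \<xi>) - (1 + \<i> * complex_of_real (z * \<xi>)))"
    using True by (cases "z = 0") (auto simp: indicator_def)
  ultimately have "cmod (1 - iexp (z * \<xi>) + \<i> * complex_of_real (z * \<xi> * indicator {0<..<1} \<bar>z\<bar>)) \<le> \<bar>z * \<xi>\<bar>\<^sup>2 / 2"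
    by (metis norm_minus_cancel)
  also have "\<dots> = \<xi>\<^sup>2 / 2 * z\<^sup>2" by (simp add: power_mult_distrib)
  also have "\<dots> \<le> 2 * (1 + \<xi>\<^sup>2) * z\<^sup>2" by (intro mult_right_mono) auto
  finally show ?thesis using z2 by (simp add: min_absorb1)
next
  case False
  then have z2: "min (z\<^sup>2) 1 = 1" using abs_le_square_iff[of 1 z] by (simp add: min_absorb2)
  have "cmod (1 - iexp (z * \<xi>)) \<le> cmod 1 + cmod (iexp (z * \<xi>))" by (rule norm_triangle_ineq4)
  also have "\<dots> = 2" by (simp only: norm_one norm_exp_i_times)
  also have "(2::real) \<le> 2 * (1 + \<xi>\<^sup>2) * 1" by simp
  finally show ?thesis using False unfolding z2 by (simp add: indicator_def)
qed

locale levy_triplet_process = levy_process +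
  fixes b \<sigma>2 :: real and \<nu> :: "real measure"
  assumes triplet: "levy_triplet M X b \<sigma>2 \<nu>"
begin

abbreviation \<psi> :: "real \<Rightarrow> complex" where "\<psi> \<equiv> levy_exponent b \<sigma>2 \<nu>"

lemma levy_nu: "levy_measure \<nu>" and sigma2_nonneg: "0 \<le> \<sigma>2"
  using triplet unfolding levy_triplet_def by auto

lemma sets_nu[measurable_cong]: "sets \<nu> = sets borel"
  using levy_nu unfolding levy_measure_def by simp

lemma char_law: "0 \<le> t \<Longrightarrow> char (law t) \<xi> = exp (- complex_of_real t * \<psi> \<xi>)"
  using triplet unfolding levy_triplet_def by simp

lemma psi_measurable[measurable]: "\<psi> \<in> borel_measurable borel"
proof -
  interpret \<nu>: sigma_finite_measure \<nu> by (rule levy_measure_sigma_finite[OF levy_nu])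
  show ?thesis unfolding levy_exponent_def by measurable
qed

lemma kernel_integrable:
  "integrable \<nu> (\<lambda>z. 1 - iexp (z * \<xi>) + \<i> * complex_of_real (z * \<xi> * indicator {0<..<1} \<bar>z\<bar>))"
proof (rule Bochner_Integration.integrable_bound)
  show "integrable \<nu> (\<lambda>z. 2 * (1 + \<xi>\<^sup>2) * min (z\<^sup>2) 1)"
    by (intro integrable_mult_right levy_measure_integrable levy_nu)
qed (measurable, use levy_kernel_bound in \<open>auto intro!: AE_I2 order_trans[OF levy_kernel_bound]\<close>)

lemma psi_bound: "\<exists>K\<ge>0. \<forall>\<xi>. cmod (\<psi> \<xi>) \<le> K * (1 + \<xi>\<^sup>2)"
proof -
  define J where "J = (LINT z|\<nu>. min (z\<^sup>2) 1)"
  have J: "J \<ge> 0" unfolding J_def by (intro Bochner_Integration.integral_nonneg) auto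
  have "cmod (\<psi> \<xi>) \<le> (\<bar>b\<bar> + \<sigma>2 + 2 * J) * (1 + \<xi>\<^sup>2)" for \<xi>
  proof -
    have "cmod (CLINT z|\<nu>. 1 - iexp (z * \<xi>) + \<i> * complex_of_real (z * \<xi> * indicator {0<..<1} \<bar>z\<bar>))
        \<le> (LINT z|\<nu>. 2 * (1 + \<xi>\<^sup>2) * min (z\<^sup>2) 1)"
      by (rule Bochner_Integration.integral_norm_bound_integral[OF kernel_integrable _ levy_kernel_bound])
        (intro integrable_mult_right levy_measure_integrable levy_nu)
    also have "\<dots> = 2 * J * (1 + \<xi>\<^sup>2)" unfolding J_def by simp
    finally have 1: "cmod (CLINT z|\<nu>. 1 - iexp (z * \<xi>) + \<i> * complex_of_real (z * \<xi> * indicator {0<..<1} \<bar>z\<bar>)) \<le> 2 * J * (1 + \<xi>\<^sup>2)" .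
    have 2: "cmod (- \<i> * complex_of_real (b * \<xi>)) \<le> \<bar>b\<bar> * (1 + \<xi>\<^sup>2)"
      using abs_le_one_plus_square[of \<xi>] by (simp add: norm_mult abs_mult mult_left_mono)
    have "\<sigma>2 * \<xi>\<^sup>2 / 2 \<le> \<sigma>2 * (1 + \<xi>\<^sup>2)" using sigma2_nonneg by (simp add: distrib_left add_increasing)
    then have 3: "cmod (complex_of_real (\<sigma>2 * \<xi>\<^sup>2 / 2)) \<le> \<sigma>2 * (1 + \<xi>\<^sup>2)"
      using sigma2_nonneg by (subst norm_of_real) simp
    show ?thesis unfolding levy_exponent_def distrib_right
      by (intro order_trans[OF norm_triangle_ineq] add_mono 1 2 3)
  qed
  then show ?thesis using J sigma2_nonneg by (intro exI[of _ "\<bar>b\<bar> + \<sigma>2 + 2 * J"]) auto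
qed

text \<open>Read off from \<open>|char| <= 1\<close> at time 1. It keeps
  \<open>e^{-t \<psi>}\<close> bounded by 1, which the dominations in Dynkin's formula and in the
  small-time limit use.\<close>

lemma Re_psi_nonneg: "0 \<le> Re (\<psi> \<xi>)"
proof -
  have p: "prob_space (law 1)" by (rule prob_space_law) simp
  interpret r: real_distribution "law 1"
    using p by (simp add: real_distribution_def real_distribution_axioms_def)
  have "exp (- Re (\<psi> \<xi>)) = cmod (char (law 1) \<xi>)" by (simp add: char_law)
  also have "\<dots> \<le> 1" by (rule r.cmod_char_le_1)
  finally show ?thesis by simp
qed

lemma cmod_exp_psi: "0 \<le> t \<Longrightarrow> cmod (exp (- complex_of_real t * \<psi> \<xi>)) \<le> 1"
  using Re_psi_nonneg[of \<xi>] by simp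

end

text \<open>\<open>F\<close> is the Fourier transform of a finite complex measure with two moments: the image of
  \<open>w dN\<close> under the frequency map \<open>s\<close>.\<close>

locale levy_fourier_function = levy_triplet_process +
  fixes N :: "real measure" and s :: "real \<Rightarrow> real" and w :: "real \<Rightarrow> complex" and B :: real and F :: "real \<Rightarrow> real"
  assumes prob_N: "prob_space N" and s_meas[measurable]: "s \<in> borel_measurable N" and w_meas[measurable]: "w \<in> borel_measurable N"
    and w_bound: "\<And>\<zeta>. cmod (w \<zeta>) \<le> B" and s2: "integrable N (\<lambda>\<zeta>. (s \<zeta>)\<^sup>2)"
    and F_eq: "\<And>y. complex_of_real (F y) = (CLINT \<zeta>|N. w \<zeta> * iexp (s \<zeta> * y))"
begin

interpretation N: prob_space N by (rule prob_N)
interpretation \<nu>: sigma_finite_measure \<nu> by (rule levy_measure_sigma_finite[OF levy_nu])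

lemma B_nonneg: "0 \<le> B" using w_bound[of 0] norm_ge_zero order_trans by blast

lemma w_integrable: "integrable N w"
  by (rule N.integrable_const_bound[of _ B]) (use w_bound in auto)

lemma one_plus_s2_integrable: "integrable N (\<lambda>\<zeta>. B * (c * (1 + (s \<zeta>)\<^sup>2)))"
  using s2 by auto

lemma dominated_integrable:
  fixes u :: "real \<Rightarrow> complex"
  assumes "u \<in> borel_measurable N" "\<And>\<zeta>. cmod (u \<zeta>) \<le> B * (c * (1 + (s \<zeta>)\<^sup>2))"
  shows "integrable N u"
  by (rule Bochner_Integration.integrable_bound[OF one_plus_s2_integrable[of c] assms(1)])
    (use assms(2) in \<open>auto intro!: AE_I2 intro: order_trans[OF _ abs_ge_self]\<close>)

lemma wpsi_integrable: "integrable N (\<lambda>\<zeta>. w \<zeta> * - \<psi> (s \<zeta>))"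
proof -
  obtain K where K: "K \<ge> 0" "\<And>\<xi>. cmod (\<psi> \<xi>) \<le> K * (1 + \<xi>\<^sup>2)" using psi_bound by blast
  show ?thesis
    by (rule dominated_integrable[of _ K]) (use K w_bound B_nonneg in \<open>auto simp: norm_mult intro!: mult_mono\<close>)
qed

lemma mult_bounded_integrable:
  fixes u v :: "real \<Rightarrow> complex"
  assumes "integrable N u" "v \<in> borel_measurable N" "\<And>\<zeta>. cmod (v \<zeta>) \<le> 1"
  shows "integrable N (\<lambda>\<zeta>. u \<zeta> * v \<zeta>)"
  by (rule Bochner_Integration.integrable_bound[OF assms(1)])
    (use assms in \<open>auto simp: norm_mult intro!: AE_I2 mult_left_le\<close>)

lemma integral_law_fourier:
  assumes u: "integrable N u" and t: "0 \<le> t"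
  shows "integrable (law t) (\<lambda>y. CLINT \<zeta>|N. u \<zeta> * iexp (s \<zeta> * y))"
    and "(CLINT y|law t. CLINT \<zeta>|N. u \<zeta> * iexp (s \<zeta> * y)) = (CLINT \<zeta>|N. u \<zeta> * exp (- complex_of_real t * \<psi> (s \<zeta>)))"
proof -
  have pl: "prob_space (law t)" by (rule prob_space_law[OF t])
  interpret l: prob_space "law t" by (rule pl)
  interpret pair_sigma_finite N "law t" ..
  have [measurable]: "u \<in> borel_measurable N" using u by auto
  have i: "integrable (N \<Otimes>\<^sub>M law t) (case_prod (\<lambda>\<zeta> y. u \<zeta> * iexp (s \<zeta> * y)))"
  proof (rule integrable_pair_bounded[where g="\<lambda>\<zeta>. cmod (u \<zeta>)" and h="\<lambda>_. 1"])
    show "norm (u x * iexp (s x * y)) \<le> cmod (u x) * 1" for x y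
      by (simp only: norm_mult norm_exp_i_times)
  qed (use u in auto)
  show "integrable (law t) (\<lambda>y. CLINT \<zeta>|N. u \<zeta> * iexp (s \<zeta> * y))"
    using integrable_snd[OF i] .
  have "(CLINT y|law t. CLINT \<zeta>|N. u \<zeta> * iexp (s \<zeta> * y)) = (CLINT \<zeta>|N. CLINT y|law t. u \<zeta> * iexp (s \<zeta> * y))"
    by (rule Fubini_integral[OF i])
  also have "\<dots> = (CLINT \<zeta>|N. u \<zeta> * char (law t) (s \<zeta>))"
    unfolding char_def by (intro Bochner_Integration.integral_cong refl) simp
  finally show "(CLINT y|law t. CLINT \<zeta>|N. u \<zeta> * iexp (s \<zeta> * y)) = (CLINT \<zeta>|N. u \<zeta> * exp (- complex_of_real t * \<psi> (s \<zeta>)))"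
    unfolding char_law[OF t] .
qed

text \<open>On the frequency \<open>\<xi>\<close> the generator acts as multiplication by
  \<open>- \<psi> \<xi>\<close>; this is \<open>F\<close> with that factor inserted. Dynkin's
  formula is accessible in this form, and \<open>G_eq_generator\<close> identifies it with the
  integro-differential operator afterwards.\<close>

definition G :: "real \<Rightarrow> real" where
  "G y = Re (CLINT \<zeta>|N. (w \<zeta> * - \<psi> (s \<zeta>)) * iexp (s \<zeta> * y))"

lemma integral_law_F:
  assumes "0 \<le> t"
  shows "integrable (law t) F" "(LINT y|law t. F y) = Re (CLINT \<zeta>|N. w \<zeta> * exp (- complex_of_real t * \<psi> (s \<zeta>)))"
proof -
  have F: "F = (\<lambda>y. Re (CLINT \<zeta>|N. w \<zeta> * iexp (s \<zeta> * y)))" unfolding F_eq[symmetric] by simp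
  show "integrable (law t) F" unfolding F by (intro integrable_Re integral_law_fourier w_integrable assms)
  show "(LINT y|law t. F y) = Re (CLINT \<zeta>|N. w \<zeta> * exp (- complex_of_real t * \<psi> (s \<zeta>)))"
    unfolding F by (subst integral_Re[OF integral_law_fourier(1)[OF w_integrable assms]])
      (simp only: integral_law_fourier(2)[OF w_integrable assms])
qed

lemma integral_law_G:
  assumes "0 \<le> t"
  shows "integrable (law t) G" "(LINT y|law t. G y) = Re (CLINT \<zeta>|N. (w \<zeta> * - \<psi> (s \<zeta>)) * exp (- complex_of_real t * \<psi> (s \<zeta>)))"
proof -
  have G: "G = (\<lambda>y. Re (CLINT \<zeta>|N. (w \<zeta> * - \<psi> (s \<zeta>)) * iexp (s \<zeta> * y)))" unfolding G_def ..
  show "integrable (law t) G" unfolding G by (intro integrable_Re integral_law_fourier wpsi_integrable assms)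
  show "(LINT y|law t. G y) = Re (CLINT \<zeta>|N. (w \<zeta> * - \<psi> (s \<zeta>)) * exp (- complex_of_real t * \<psi> (s \<zeta>)))"
    unfolding G by (subst integral_Re[OF integral_law_fourier(1)[OF wpsi_integrable assms]])
      (simp only: integral_law_fourier(2)[OF wpsi_integrable assms])
qed

lemma F_0: "F 0 = Re (CLINT \<zeta>|N. w \<zeta>)"
proof -
  have "F 0 = Re (complex_of_real (F 0))" by simp
  also have "\<dots> = Re (CLINT \<zeta>|N. w \<zeta>)" unfolding F_eq by simp
  finally show ?thesis .
qed

lemma exp_psi_integral:
  assumes "0 \<le> t"
  shows "has_bochner_integral lborel (\<lambda>r. indicator {0..t} r *\<^sub>R (- \<psi> \<xi> * exp (- complex_of_real r * \<psi> \<xi>)))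
    (exp (- complex_of_real t * \<psi> \<xi>) - 1)"
proof -
  have "has_bochner_integral lborel (\<lambda>r. indicator {0..t} r *\<^sub>R (- \<psi> \<xi> * exp (- complex_of_real r * \<psi> \<xi>)))
    (exp (- complex_of_real t * \<psi> \<xi>) - exp (- complex_of_real 0 * \<psi> \<xi>))"
  proof (rule has_bochner_integral_FTC_Icc[OF assms])
    show "((\<lambda>r. exp (- complex_of_real r * \<psi> \<xi>)) has_vector_derivative - \<psi> \<xi> * exp (- complex_of_real r * \<psi> \<xi>)) (at r within {0..t})" for r
    proof -
      have "((\<lambda>z. exp (- z * \<psi> \<xi>)) has_field_derivative - \<psi> \<xi> * exp (- complex_of_real r * \<psi> \<xi>)) (at (complex_of_real r))"
        by (auto intro!: derivative_eq_intros)
      from field_vector_diff_chain_at[OF has_vector_derivative_of_real[OF DERIV_ident] this]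
      show ?thesis by (auto simp: o_def intro: has_vector_derivative_at_within)
    qed
    show "continuous_on {0..t} (\<lambda>r. - \<psi> \<xi> * exp (- complex_of_real r * \<psi> \<xi>))" by (intro continuous_intros)
  qed
  then show ?thesis by simp
qed

text \<open>Taking the expectation at time \<open>r\<close> multiplies each frequency by the
  characteristic function \<open>e^{-r \<psi>}\<close>. So the formula is
  \<open>d/dr e^{-r \<psi>} = - \<psi> e^{-r \<psi>}\<close> integrated over \<open>[0, t]\<close>,
  combined with Fubini.\<close>

lemma Dynkin:
  assumes t: "0 \<le> t"
  shows "has_bochner_integral lborel (\<lambda>r. indicator {0..t} r * (LINT y|law r. G y)) ((LINT y|law t. F y) - F 0)"
proof -
  let ?f = "\<lambda>\<zeta> r. w \<zeta> * (indicator {0..t} r *\<^sub>R (- \<psi> (s \<zeta>) * exp (- complex_of_real r * \<psi> (s \<zeta>))))"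
  interpret lborel_N: pair_sigma_finite N lborel ..
  have i: "integrable (N \<Otimes>\<^sub>M lborel) (case_prod ?f)"
  proof (rule lborel_N.integrable_pair_bounded[where g="\<lambda>\<zeta>. cmod (w \<zeta> * - \<psi> (s \<zeta>))" and h="\<lambda>r. indicator {0..t} r"])
    show "integrable N (\<lambda>\<zeta>. cmod (w \<zeta> * - \<psi> (s \<zeta>)))" by (rule integrable_norm[OF wpsi_integrable])
    show "norm (?f \<zeta> r) \<le> cmod (w \<zeta> * - \<psi> (s \<zeta>)) * indicator {0..t} r" for \<zeta> r
      using cmod_exp_psi[of r "s \<zeta>"] by (auto simp: norm_mult indicator_def mult.assoc[symmetric] simp del: norm_exp_eq_Re intro!: mult_left_le)
  qed (auto simp: emeasure_lborel_Icc_eq)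
  have in1: "(CLINT r|lborel. ?f \<zeta> r) = w \<zeta> * (exp (- complex_of_real t * \<psi> (s \<zeta>)) - 1)" for \<zeta>
    using exp_psi_integral[OF t, of "s \<zeta>"] by (subst integral_mult_right_zero) (simp only: has_bochner_integral_iff)
  have in2: "(CLINT \<zeta>|N. ?f \<zeta> r) = indicator {0..t} r *\<^sub>R (CLINT \<zeta>|N. (w \<zeta> * - \<psi> (s \<zeta>)) * exp (- complex_of_real r * \<psi> (s \<zeta>)))" for r
    by (subst integral_scaleR_right[symmetric]) (auto simp: indicator_def mult.assoc)
  have in3: "Re (CLINT \<zeta>|N. ?f \<zeta> r) = indicator {0..t} r * (LINT y|law r. G y)" for r
    unfolding in2 using integral_law_G(2)[of r] by (auto simp: indicator_def)
  have "integrable lborel (\<lambda>r. Re (CLINT \<zeta>|N. ?f \<zeta> r))"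
    by (intro integrable_Re lborel_N.integrable_snd i)
  moreover have "(LINT r|lborel. Re (CLINT \<zeta>|N. ?f \<zeta> r)) = (LINT y|law t. F y) - F 0"
  proof -
    have "(LINT r|lborel. Re (CLINT \<zeta>|N. ?f \<zeta> r)) = Re (CLINT r|lborel. CLINT \<zeta>|N. ?f \<zeta> r)"
      by (intro integral_Re lborel_N.integrable_snd i)
    also have "\<dots> = Re (CLINT \<zeta>|N. CLINT r|lborel. ?f \<zeta> r)"
      by (subst lborel_N.Fubini_integral[OF i]) simp
    also have "\<dots> = Re (CLINT \<zeta>|N. w \<zeta> * exp (- complex_of_real t * \<psi> (s \<zeta>)) - w \<zeta>)"
      unfolding in1 by (simp only: right_diff_distrib mult_1_right)
    also have "\<dots> = Re ((CLINT \<zeta>|N. w \<zeta> * exp (- complex_of_real t * \<psi> (s \<zeta>))) - (CLINT \<zeta>|N. w \<zeta>))"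
      by (subst Bochner_Integration.integral_diff)
        (intro mult_bounded_integrable w_integrable cmod_exp_psi t, measurable, rule w_integrable, rule refl)
    finally show ?thesis unfolding integral_law_F(2)[OF t] F_0 by simp
  qed
  ultimately show ?thesis unfolding in3 by (simp add: has_bochner_integral_iff)
qed

text \<open>Dominated convergence over the frequencies: since \<open>|e^{-r \<psi>}| <= 1\<close>,
  the difference quotients of \<open>e^{-t \<psi>}\<close> at 0 are at most \<open>|\<psi>|\<close>,
  which is integrable against the weight by the two moments.\<close>

lemma small_time_limit:
  "(\<lambda>n. real (Suc n) * ((LINT y|law (1 / Suc n). F y) - F 0)) \<longlonglongrightarrow> G 0"
proof -
  let ?e = "\<lambda>n \<zeta>. exp (- complex_of_real (1 / Suc n) * \<psi> (s \<zeta>))"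
  have lim: "(\<lambda>n. of_nat (Suc n) * (exp (- complex_of_real (1 / Suc n) * z) - 1)) \<longlonglongrightarrow> - z" for z
  proof -
    have "((\<lambda>x::complex. exp (- x * z)) has_field_derivative - z * exp (- 0 * z)) (at 0)"
      by (auto intro!: derivative_eq_intros)
    then have "((\<lambda>h. (exp (- h * z) - 1) / h) \<longlongrightarrow> - z) (at 0)"
      by (simp add: DERIV_def)
    moreover have "filterlim (\<lambda>n. complex_of_real (1 / Suc n)) (at 0) sequentially"
      unfolding filterlim_at
    proof
      show "(\<lambda>n. complex_of_real (1 / Suc n)) \<longlonglongrightarrow> 0"
        using tendsto_of_real[OF LIMSEQ_Suc[OF lim_const_over_n[of "1::real"]], where 'a=complex] by simp
      have "complex_of_real (1 / Suc n) \<noteq> 0" for n by (simp only: of_real_eq_0_iff) simp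
      then show "\<forall>\<^sub>F n in sequentially. complex_of_real (1 / Suc n) \<in> UNIV \<and> complex_of_real (1 / Suc n) \<noteq> 0"
        by (intro always_eventually allI conjI UNIV_I)
    qed
    ultimately have "(\<lambda>n. (exp (- complex_of_real (1 / Suc n) * z) - 1) / complex_of_real (1 / Suc n)) \<longlonglongrightarrow> - z"
      by (rule filterlim_compose)
    moreover have "(exp (- complex_of_real (1 / Suc n) * z) - 1) / complex_of_real (1 / Suc n) = of_nat (Suc n) * (exp (- complex_of_real (1 / Suc n) * z) - 1)" for n
      by (simp add: mult.commute del: of_nat_Suc)
    ultimately show ?thesis by (simp only:)
  qed
  have bd: "cmod (of_nat (Suc n) * (?e n \<zeta> - 1)) \<le> cmod (\<psi> (s \<zeta>))" for n \<zeta>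
  proof -
    let ?t = "1 / real (Suc n)"
    have t: "0 \<le> ?t" by simp
    have "cmod (?e n \<zeta> - 1) = cmod (CLINT r|lborel. indicator {0..?t} r *\<^sub>R (- \<psi> (s \<zeta>) * exp (- complex_of_real r * \<psi> (s \<zeta>))))"
      using exp_psi_integral[OF t, of "s \<zeta>"] by (simp only: has_bochner_integral_iff)
    also have "\<dots> \<le> (LINT r|lborel. cmod (\<psi> (s \<zeta>)) * indicator {0..?t} r)"
    proof (rule Bochner_Integration.integral_norm_bound_integral)
      show "integrable lborel (\<lambda>r. indicator {0..?t} r *\<^sub>R (- \<psi> (s \<zeta>) * exp (- complex_of_real r * \<psi> (s \<zeta>))))"
        using exp_psi_integral[OF t, of "s \<zeta>"] by (simp only: has_bochner_integral_iff)
      show "norm (indicator {0..?t} r *\<^sub>R (- \<psi> (s \<zeta>) * exp (- complex_of_real r * \<psi> (s \<zeta>)))) \<le> cmod (\<psi> (s \<zeta>)) * indicator {0..?t} r" for r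
        using cmod_exp_psi[of r "s \<zeta>"] by (auto simp: norm_mult indicator_def simp del: norm_exp_eq_Re intro!: mult_left_le)
    qed (auto simp: emeasure_lborel_Icc_eq)
    also have "\<dots> = cmod (\<psi> (s \<zeta>)) * ?t" by simp
    finally have "real (Suc n) * cmod (?e n \<zeta> - 1) \<le> real (Suc n) * (cmod (\<psi> (s \<zeta>)) * ?t)" by (intro mult_left_mono) auto
    also have "\<dots> = cmod (\<psi> (s \<zeta>))" by simp
    finally show ?thesis by (simp only: norm_mult norm_of_nat)
  qed
  have "(\<lambda>n. CLINT \<zeta>|N. w \<zeta> * (of_nat (Suc n) * (?e n \<zeta> - 1))) \<longlonglongrightarrow> (CLINT \<zeta>|N. w \<zeta> * - \<psi> (s \<zeta>))"
  proof (rule integral_dominated_convergence[where w="\<lambda>\<zeta>. cmod (w \<zeta> * - \<psi> (s \<zeta>))"])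
    show "AE \<zeta> in N. (\<lambda>n. w \<zeta> * (of_nat (Suc n) * (?e n \<zeta> - 1))) \<longlonglongrightarrow> w \<zeta> * - \<psi> (s \<zeta>)"
      by (intro AE_I2 tendsto_mult_left lim)
    show "AE \<zeta> in N. norm (w \<zeta> * (of_nat (Suc n) * (?e n \<zeta> - 1))) \<le> cmod (w \<zeta> * - \<psi> (s \<zeta>))" for n
      unfolding norm_mult[of "w _"] norm_minus_cancel by (intro AE_I2 mult_left_mono bd) simp
    show "integrable N (\<lambda>\<zeta>. cmod (w \<zeta> * - \<psi> (s \<zeta>)))" by (rule integrable_norm[OF wpsi_integrable])
  qed measurable
  then have "(\<lambda>n. Re (CLINT \<zeta>|N. w \<zeta> * (of_nat (Suc n) * (?e n \<zeta> - 1)))) \<longlonglongrightarrow> Re (CLINT \<zeta>|N. w \<zeta> * - \<psi> (s \<zeta>))"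
    by (rule tendsto_Re)
  moreover have "Re (CLINT \<zeta>|N. w \<zeta> * (of_nat (Suc n) * (?e n \<zeta> - 1))) = real (Suc n) * ((LINT y|law (1 / Suc n). F y) - F 0)" for n
  proof -
    have "(CLINT \<zeta>|N. w \<zeta> * (of_nat (Suc n) * (?e n \<zeta> - 1))) = (CLINT \<zeta>|N. of_nat (Suc n) * (w \<zeta> * ?e n \<zeta> - w \<zeta>))"
      by (intro Bochner_Integration.integral_cong refl) (simp add: algebra_simps del: of_nat_Suc)
    also have "\<dots> = of_nat (Suc n) * (CLINT \<zeta>|N. w \<zeta> * ?e n \<zeta> - w \<zeta>)" by (rule integral_mult_right_zero)
    also have "(CLINT \<zeta>|N. w \<zeta> * ?e n \<zeta> - w \<zeta>) = (CLINT \<zeta>|N. w \<zeta> * ?e n \<zeta>) - (CLINT \<zeta>|N. w \<zeta>)"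
      by (rule Bochner_Integration.integral_diff)
        (intro mult_bounded_integrable w_integrable cmod_exp_psi, measurable, rule w_integrable)
    finally have e1: "(CLINT \<zeta>|N. w \<zeta> * (of_nat (Suc n) * (?e n \<zeta> - 1))) = of_nat (Suc n) * ((CLINT \<zeta>|N. w \<zeta> * ?e n \<zeta>) - (CLINT \<zeta>|N. w \<zeta>))" .
    have e2: "(LINT y|law (1 / Suc n). F y) = Re (CLINT \<zeta>|N. w \<zeta> * ?e n \<zeta>)"
      by (rule integral_law_F(2)) simp
    show ?thesis unfolding e1 e2 F_0 by (simp del: of_nat_Suc)
  qed
  moreover have "G 0 = Re (CLINT \<zeta>|N. w \<zeta> * - \<psi> (s \<zeta>))" unfolding G_def by simp
  ultimately show ?thesis by simp
qed

definition F1 :: "real \<Rightarrow> complex" where "F1 y = (CLINT \<zeta>|N. w \<zeta> * (\<i> * s \<zeta>) * iexp (s \<zeta> * y))"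
definition F2 :: "real \<Rightarrow> complex" where "F2 y = (CLINT \<zeta>|N. w \<zeta> * - complex_of_real ((s \<zeta>)\<^sup>2) * iexp (s \<zeta> * y))"

lemma ws_integrable: "integrable N (\<lambda>\<zeta>. w \<zeta> * (\<i> * s \<zeta>))"
  by (rule dominated_integrable[of _ 1])
    (use w_bound B_nonneg abs_le_one_plus_square in \<open>auto simp: norm_mult intro!: mult_mono\<close>)

lemma ws2_integrable: "integrable N (\<lambda>\<zeta>. w \<zeta> * - complex_of_real ((s \<zeta>)\<^sup>2))"
proof (rule dominated_integrable[of _ 1])
  show "cmod (w \<zeta> * - complex_of_real ((s \<zeta>)\<^sup>2)) \<le> B * (1 * (1 + (s \<zeta>)\<^sup>2))" for \<zeta>
  proof -
    have "cmod (w \<zeta> * - complex_of_real ((s \<zeta>)\<^sup>2)) = cmod (w \<zeta>) * (s \<zeta>)\<^sup>2"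
      unfolding norm_mult norm_minus_cancel norm_of_real by simp
    also have "\<dots> \<le> B * (1 * (1 + (s \<zeta>)\<^sup>2))" by (intro mult_mono w_bound B_nonneg) auto
    finally show ?thesis .
  qed
qed measurable

lemma iexp_mult_integrable:
  assumes "integrable N u" shows "integrable N (\<lambda>\<zeta>. u \<zeta> * iexp (s \<zeta> * y))"
proof (rule mult_bounded_integrable[OF assms])
  show "cmod (iexp (s \<zeta> * y)) \<le> 1" for \<zeta> by (simp only: norm_exp_i_times order_refl)
qed measurable

lemma F_derivative: "(F has_real_derivative Re (F1 y)) (at y)"
proof -
  have "((\<lambda>y. LINT \<zeta>|N. Re (w \<zeta> * iexp (s \<zeta> * y))) has_real_derivative (LINT \<zeta>|N. Re (w \<zeta> * (\<i> * s \<zeta>) * iexp (s \<zeta> * y)))) (at y)"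
  proof (rule DERIV_integral_dominated[where g="\<lambda>\<zeta>. B * (1 * (1 + (s \<zeta>)\<^sup>2))"])
    show "integrable N (\<lambda>\<zeta>. Re (w \<zeta> * iexp (s \<zeta> * y)))" for y
      by (intro integrable_Re iexp_mult_integrable w_integrable)
    show "((\<lambda>y. Re (w \<zeta> * iexp (s \<zeta> * y))) has_real_derivative Re (w \<zeta> * (\<i> * s \<zeta>) * iexp (s \<zeta> * y))) (at y)" for y \<zeta>
      unfolding Re_mult_iexp by (auto intro!: derivative_eq_intros simp: algebra_simps)
    show "\<bar>Re (w \<zeta> * (\<i> * s \<zeta>) * iexp (s \<zeta> * y))\<bar> \<le> B * (1 * (1 + (s \<zeta>)\<^sup>2))" for y \<zeta>
    proof (rule order_trans[OF abs_Re_le_cmod])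
      have "cmod (w \<zeta> * (\<i> * s \<zeta>) * iexp (s \<zeta> * y)) = cmod (w \<zeta>) * \<bar>s \<zeta>\<bar>"
        unfolding norm_mult norm_exp_i_times by simp
      also have "\<dots> \<le> B * (1 + (s \<zeta>)\<^sup>2)" by (intro mult_mono w_bound abs_le_one_plus_square B_nonneg) simp
      finally show "cmod (w \<zeta> * (\<i> * s \<zeta>) * iexp (s \<zeta> * y)) \<le> B * (1 * (1 + (s \<zeta>)\<^sup>2))" by simp
    qed
    show "integrable N (\<lambda>\<zeta>. B * (1 * (1 + (s \<zeta>)\<^sup>2)))" by (rule one_plus_s2_integrable)
    show "(\<lambda>\<zeta>. Re (w \<zeta> * (\<i> * s \<zeta>) * iexp (s \<zeta> * y))) \<in> borel_measurable N" for y by measurable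
  qed
  moreover have "(LINT \<zeta>|N. Re (w \<zeta> * iexp (s \<zeta> * y))) = F y" for y
    by (subst integral_Re[OF iexp_mult_integrable[OF w_integrable]]) (simp only: F_eq[symmetric] Re_complex_of_real)
  moreover have "(LINT \<zeta>|N. Re (w \<zeta> * (\<i> * s \<zeta>) * iexp (s \<zeta> * y))) = Re (F1 y)"
    unfolding F1_def by (rule integral_Re[OF iexp_mult_integrable[OF ws_integrable]])
  ultimately show ?thesis by simp
qed

lemma F1_derivative: "((\<lambda>y. Re (F1 y)) has_real_derivative Re (F2 y)) (at y)"
proof -
  have "((\<lambda>y. LINT \<zeta>|N. Re (w \<zeta> * (\<i> * s \<zeta>) * iexp (s \<zeta> * y))) has_real_derivative (LINT \<zeta>|N. Re (w \<zeta> * - complex_of_real ((s \<zeta>)\<^sup>2) * iexp (s \<zeta> * y)))) (at y)"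
  proof (rule DERIV_integral_dominated[where g="\<lambda>\<zeta>. B * (1 * (1 + (s \<zeta>)\<^sup>2))"])
    show "integrable N (\<lambda>\<zeta>. Re (w \<zeta> * (\<i> * s \<zeta>) * iexp (s \<zeta> * y)))" for y
      by (intro integrable_Re iexp_mult_integrable ws_integrable)
    show "((\<lambda>y. Re (w \<zeta> * (\<i> * s \<zeta>) * iexp (s \<zeta> * y))) has_real_derivative Re (w \<zeta> * - complex_of_real ((s \<zeta>)\<^sup>2) * iexp (s \<zeta> * y))) (at y)" for y \<zeta>
      unfolding Re_mult_iexp by (auto intro!: derivative_eq_intros simp: algebra_simps power2_eq_square)
    show "\<bar>Re (w \<zeta> * - complex_of_real ((s \<zeta>)\<^sup>2) * iexp (s \<zeta> * y))\<bar> \<le> B * (1 * (1 + (s \<zeta>)\<^sup>2))" for y \<zeta>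
    proof (rule order_trans[OF abs_Re_le_cmod])
      have "cmod (w \<zeta> * - complex_of_real ((s \<zeta>)\<^sup>2) * iexp (s \<zeta> * y)) = cmod (w \<zeta>) * (s \<zeta>)\<^sup>2"
        unfolding norm_mult norm_exp_i_times by (simp add: norm_power)
      also have "\<dots> \<le> B * (1 + (s \<zeta>)\<^sup>2)" by (intro mult_mono w_bound B_nonneg) auto
      finally show "cmod (w \<zeta> * - complex_of_real ((s \<zeta>)\<^sup>2) * iexp (s \<zeta> * y)) \<le> B * (1 * (1 + (s \<zeta>)\<^sup>2))" by simp
    qed
    show "integrable N (\<lambda>\<zeta>. B * (1 * (1 + (s \<zeta>)\<^sup>2)))" by (rule one_plus_s2_integrable)
    show "(\<lambda>\<zeta>. Re (w \<zeta> * - complex_of_real ((s \<zeta>)\<^sup>2) * iexp (s \<zeta> * y))) \<in> borel_measurable N" for y by measurable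
  qed
  moreover have "(LINT \<zeta>|N. Re (w \<zeta> * (\<i> * s \<zeta>) * iexp (s \<zeta> * y))) = Re (F1 y)" for y
    unfolding F1_def by (rule integral_Re[OF iexp_mult_integrable[OF ws_integrable]])
  moreover have "(LINT \<zeta>|N. Re (w \<zeta> * - complex_of_real ((s \<zeta>)\<^sup>2) * iexp (s \<zeta> * y))) = Re (F2 y)"
    unfolding F2_def by (rule integral_Re[OF iexp_mult_integrable[OF ws2_integrable]])
  ultimately show ?thesis by simp
qed

text \<open>The Levy-Khintchine formula is inserted under the frequency integral: drift and Gaussian
  part become \<open>F'\<close> and \<open>F''\<close>, and \<open>levy_kernel_bound\<close> permits
  exchanging the jump integral with the frequency integral. Integrability of the jump kernel falls
  out of the same Fubini step.\<close>

lemma G_eq_generator: "G y = generator b \<sigma>2 \<nu> F y"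
  and generator_kernel_integrable: "integrable \<nu> (\<lambda>z. F (y + z) - F y - z * deriv F y * indicator {0<..<1} \<bar>z\<bar>)"
proof -
  have dF: "deriv F = (\<lambda>y. Re (F1 y))" using DERIV_imp_deriv[OF F_derivative] by auto
  have ddF: "deriv (deriv F) = (\<lambda>y. Re (F2 y))" unfolding dF using DERIV_imp_deriv[OF F1_derivative] by auto
  let ?k = "\<lambda>\<xi> z. 1 - iexp (z * \<xi>) + \<i> * complex_of_real (z * \<xi> * indicator {0<..<1} \<bar>z\<bar>)"
  let ?f = "\<lambda>\<zeta> z. w \<zeta> * - ?k (s \<zeta>) z * iexp (s \<zeta> * y)"
  interpret Nnu: pair_sigma_finite N \<nu> ..
  have i: "integrable (N \<Otimes>\<^sub>M \<nu>) (case_prod ?f)"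
  proof (rule Nnu.integrable_pair_bounded[where g="\<lambda>\<zeta>. B * (2 * (1 + (s \<zeta>)\<^sup>2))" and h="\<lambda>z. min (z\<^sup>2) 1"])
    show "integrable N (\<lambda>\<zeta>. B * (2 * (1 + (s \<zeta>)\<^sup>2)))" by (rule one_plus_s2_integrable)
    show "integrable \<nu> (\<lambda>z. min (z\<^sup>2) 1)" by (rule levy_measure_integrable[OF levy_nu])
    show "norm (?f \<zeta> z) \<le> B * (2 * (1 + (s \<zeta>)\<^sup>2)) * min (z\<^sup>2) 1" for \<zeta> z
    proof -
      have "norm (?f \<zeta> z) = cmod (w \<zeta>) * cmod (?k (s \<zeta>) z)"
        unfolding norm_mult norm_exp_i_times norm_minus_cancel by simp
      also have "\<dots> \<le> B * (2 * (1 + (s \<zeta>)\<^sup>2) * min (z\<^sup>2) 1)"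
        by (intro mult_mono w_bound levy_kernel_bound B_nonneg) simp
      finally show ?thesis by (simp only: mult.assoc)
    qed
  qed (use B_nonneg in \<open>measurable, auto\<close>)
  have in2: "(CLINT \<zeta>|N. ?f \<zeta> z) = complex_of_real (F (y + z)) - complex_of_real (F y) - complex_of_real (z * indicator {0<..<1} \<bar>z\<bar>) * F1 y" for z
  proof -
    let ?c = "complex_of_real (z * indicator {0<..<1} \<bar>z\<bar>)"
    have "?f \<zeta> z = w \<zeta> * iexp (s \<zeta> * (y + z)) - w \<zeta> * iexp (s \<zeta> * y) - ?c * (w \<zeta> * (\<i> * s \<zeta>) * iexp (s \<zeta> * y))" for \<zeta>
    proof -
      have "iexp (s \<zeta> * (y + z)) = iexp (z * s \<zeta>) * iexp (s \<zeta> * y)"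
        unfolding exp_add[symmetric] by (simp add: algebra_simps)
      then show ?thesis by (simp add: algebra_simps)
    qed
    then have "(CLINT \<zeta>|N. ?f \<zeta> z) = (CLINT \<zeta>|N. w \<zeta> * iexp (s \<zeta> * (y + z)) - w \<zeta> * iexp (s \<zeta> * y) - ?c * (w \<zeta> * (\<i> * s \<zeta>) * iexp (s \<zeta> * y)))"
      by simp
    also have "\<dots> = (CLINT \<zeta>|N. w \<zeta> * iexp (s \<zeta> * (y + z))) - (CLINT \<zeta>|N. w \<zeta> * iexp (s \<zeta> * y)) - ?c * F1 y"
      unfolding F1_def
      by (subst Bochner_Integration.integral_diff, intro Bochner_Integration.integrable_diff iexp_mult_integrable w_integrable,
        intro integrable_mult_right iexp_mult_integrable ws_integrable,
        subst Bochner_Integration.integral_diff, (intro iexp_mult_integrable w_integrable)+, subst integral_mult_right_zero, rule refl)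
    finally show ?thesis unfolding F_eq .
  qed
  have re: "Re (CLINT \<zeta>|N. ?f \<zeta> z) = F (y + z) - F y - z * Re (F1 y) * indicator {0<..<1} \<bar>z\<bar>" for z
    unfolding in2 by simp
  have "integrable \<nu> (\<lambda>z. Re (CLINT \<zeta>|N. ?f \<zeta> z))" by (intro integrable_Re Nnu.integrable_snd i)
  then show int: "integrable \<nu> (\<lambda>z. F (y + z) - F y - z * deriv F y * indicator {0<..<1} \<bar>z\<bar>)"
    unfolding re dF .
  have psi: "w \<zeta> * - \<psi> (s \<zeta>) * iexp (s \<zeta> * y) = complex_of_real b * (w \<zeta> * (\<i> * s \<zeta>) * iexp (s \<zeta> * y))
     + complex_of_real (\<sigma>2 / 2) * (w \<zeta> * - complex_of_real ((s \<zeta>)\<^sup>2) * iexp (s \<zeta> * y)) + (CLINT z|\<nu>. ?f \<zeta> z)" for \<zeta>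
  proof -
    have "(CLINT z|\<nu>. ?f \<zeta> z) = (CLINT z|\<nu>. (- w \<zeta> * iexp (s \<zeta> * y)) * ?k (s \<zeta>) z)"
      by (intro Bochner_Integration.integral_cong refl) (simp only: mult_minus_left mult_minus_right mult_ac)
    also have "\<dots> = (- w \<zeta> * iexp (s \<zeta> * y)) * (CLINT z|\<nu>. ?k (s \<zeta>) z)" by (rule integral_mult_right_zero)
    finally show ?thesis unfolding levy_exponent_def by (simp add: algebra_simps)
  qed
  have in3: "integrable N (\<lambda>\<zeta>. CLINT z|\<nu>. ?f \<zeta> z)" by (rule Nnu.integrable_fst[OF i])
  have "(CLINT \<zeta>|N. w \<zeta> * - \<psi> (s \<zeta>) * iexp (s \<zeta> * y)) = complex_of_real b * F1 y + complex_of_real (\<sigma>2 / 2) * F2 y + (CLINT \<zeta>|N. CLINT z|\<nu>. ?f \<zeta> z)"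
    unfolding psi F1_def F2_def
    by (subst Bochner_Integration.integral_add, intro Bochner_Integration.integrable_add integrable_mult_right iexp_mult_integrable ws_integrable ws2_integrable,
        rule in3, subst Bochner_Integration.integral_add, (intro integrable_mult_right iexp_mult_integrable ws_integrable ws2_integrable)+,
        subst (1 2) integral_mult_right_zero, rule refl)
  also have "(CLINT \<zeta>|N. CLINT z|\<nu>. ?f \<zeta> z) = (CLINT z|\<nu>. CLINT \<zeta>|N. ?f \<zeta> z)"
    by (rule Nnu.Fubini_integral[OF i, symmetric])
  finally have "G y = b * Re (F1 y) + \<sigma>2 / 2 * Re (F2 y) + Re (CLINT z|\<nu>. CLINT \<zeta>|N. ?f \<zeta> z)"
    unfolding G_def by simp
  also have "Re (CLINT z|\<nu>. CLINT \<zeta>|N. ?f \<zeta> z) = (LINT z|\<nu>. Re (CLINT \<zeta>|N. ?f \<zeta> z))"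
    by (intro integral_Re[symmetric] Nnu.integrable_snd i)
  finally show "G y = generator b \<sigma>2 \<nu> F y" unfolding generator_def ddF re unfolding dF .
qed

end

section \<open>The Laplace exponent\<close>

lemma second_order_bound:
  fixes f f1 f2 :: "real \<Rightarrow> real"
  assumes d: "\<And>t. (f has_real_derivative f1 t) (at t)" "\<And>t. (f1 has_real_derivative f2 t) (at t)"
    and K: "\<And>t. \<bar>t - c\<bar> \<le> \<bar>h\<bar> \<Longrightarrow> \<bar>f2 t\<bar> \<le> K"
  shows "\<bar>f (c + h) - f c - h * f1 c\<bar> \<le> K / 2 * h\<^sup>2"
proof (cases "h = 0")
  case False
  \<comment> \<open>Taylor's theorem wants a sequence of derivatives; only the indices 0, 1 and 2
    are read.\<close>
  define diff where "diff m = (if m = 0 then f else if m = 1 then f1 else f2)" for m :: nat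
  have "\<exists>t. (if c + h < c then c + h < t \<and> t < c else c < t \<and> t < c + h) \<and>
      f (c + h) = (\<Sum>m<2. diff m c / fact m * (c + h - c) ^ m) + diff 2 t / fact 2 * (c + h - c) ^ 2"
    by (rule Taylor[of 2 diff f "c - \<bar>h\<bar>" "c + \<bar>h\<bar>"])
      (use False d in \<open>auto simp: diff_def less_2_cases_iff\<close>)
  then obtain t where t: "if c + h < c then c + h < t \<and> t < c else c < t \<and> t < c + h"
    and eq: "f (c + h) = (\<Sum>m<2. diff m c / fact m * (c + h - c) ^ m) + diff 2 t / fact 2 * (c + h - c) ^ 2" by blast
  have e1: "f (c + h) - f c - h * f1 c = f2 t / 2 * h\<^sup>2"
    using eq by (simp add: diff_def numeral_2_eq_2)
  have "\<bar>t - c\<bar> \<le> \<bar>h\<bar>" using t by (auto split: if_splits)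
  then have "\<bar>f2 t / 2 * h\<^sup>2\<bar> \<le> K / 2 * h\<^sup>2" using K[of t] by (simp add: abs_mult mult_right_mono)
  then show ?thesis unfolding e1 .
qed simp

section \<open>Tilted Gaussians as test functions\<close>

definition gauss :: "real \<Rightarrow> real \<Rightarrow> real \<Rightarrow> real" where
  "gauss a m y = exp (m * y - a * y\<^sup>2 / 2)"

lemma gauss_measurable[measurable]: "gauss a m \<in> borel_measurable borel"
  unfolding gauss_def by measurable

lemma gauss_derivative: "(gauss a m has_real_derivative (m - a * y) * gauss a m y) (at y)"
  unfolding gauss_def by (auto intro!: derivative_eq_intros)

lemma gauss_derivative2:
  "((\<lambda>y. (m - a * y) * gauss a m y) has_real_derivative ((m - a * y)\<^sup>2 - a) * gauss a m y) (at y)"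
  by (auto intro!: derivative_eq_intros gauss_derivative simp: power2_eq_square algebra_simps)

lemma deriv_gauss: "deriv (gauss a m) = (\<lambda>y. (m - a * y) * gauss a m y)"
  using DERIV_imp_deriv[OF gauss_derivative] by auto

lemma deriv2_gauss: "deriv (deriv (gauss a m)) = (\<lambda>y. ((m - a * y)\<^sup>2 - a) * gauss a m y)"
  unfolding deriv_gauss using DERIV_imp_deriv[OF gauss_derivative2] by auto

text \<open>Absorbs the factors \<open>a * y^2\<close> that appear on differentiating a
  Gaussian.\<close>

lemma mult_exp_neg_le:
  fixes u :: real assumes "0 \<le> u" shows "u * exp (- u / 2) \<le> 2"
proof -
  have "u \<le> 2 * exp (u / 2)" using exp_ge_add_one_self[of "u / 2"] assms by linarith
  then have "u * exp (- u / 2) \<le> 2 * exp (u / 2) * exp (- u / 2)" by (intro mult_right_mono) auto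
  then show ?thesis by (simp add: mult.assoc flip: exp_add)
qed

lemma gauss_le: "0 \<le> a \<Longrightarrow> gauss a m y \<le> exp (m * y)"
  unfolding gauss_def by simp

lemma gauss_split: "gauss a m y = exp (m * y) * exp (- (a * y\<^sup>2) / 2)"
  unfolding gauss_def exp_add[symmetric] by simp

text \<open>The factor \<open>a * |y|\<close> is unbounded, but at most \<open>a + a * y^2\<close>,
  and the Gaussian damping absorbs \<open>a * y^2\<close>. The resulting constant does not depend on
  \<open>a\<close>, so the bound survives the limit \<open>a\<close> to 0; the second derivative is
  treated alike.\<close>

lemma gauss_derivative_bound:
  assumes a: "0 \<le> a" "a \<le> 1"
  shows "\<bar>(m - a * y) * gauss a m y\<bar> \<le> (\<bar>m\<bar> + 3) * exp (m * y)"
proof -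
  let ?u = "a * y\<^sup>2" and ?e = "exp (- (a * y\<^sup>2) / 2)"
  have u: "0 \<le> ?u" using a by simp
  have e: "?e \<le> 1" using u by simp
  have ue: "?u * ?e \<le> 2" using mult_exp_neg_le[OF u] by simp
  have "a * \<bar>y\<bar> \<le> a * (1 + y\<^sup>2)" using a abs_le_one_plus_square by (intro mult_left_mono)
  then have "\<bar>m - a * y\<bar> \<le> \<bar>m\<bar> + 1 + ?u" using a by (simp add: distrib_left abs_le_iff) (smt (verit) abs_ge_self abs_ge_minus_self mult_minus_right mult_left_mono)
  then have "\<bar>m - a * y\<bar> * ?e \<le> (\<bar>m\<bar> + 1 + ?u) * ?e" by (intro mult_right_mono) auto
  also have "\<dots> = (\<bar>m\<bar> + 1) * ?e + ?u * ?e" by (simp add: algebra_simps)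
  also have "\<dots> \<le> (\<bar>m\<bar> + 1) * 1 + 2" by (intro add_mono mult_left_mono e ue) auto
  finally have "\<bar>m - a * y\<bar> * ?e \<le> \<bar>m\<bar> + 3" by simp
  then have "\<bar>m - a * y\<bar> * ?e * exp (m * y) \<le> (\<bar>m\<bar> + 3) * exp (m * y)" by (intro mult_right_mono) auto
  then show ?thesis unfolding gauss_split by (simp add: abs_mult mult_ac)
qed

lemma gauss_derivative2_bound:
  assumes a: "0 \<le> a" "a \<le> 1"
  shows "\<bar>((m - a * y)\<^sup>2 - a) * gauss a m y\<bar> \<le> (2 * m\<^sup>2 + 5) * exp (m * y)"
proof -
  let ?u = "a * y\<^sup>2" and ?e = "exp (- (a * y\<^sup>2) / 2)"
  have u: "0 \<le> ?u" using a by simp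
  have e: "?e \<le> 1" using u by simp
  have ue: "?u * ?e \<le> 2" using mult_exp_neg_le[OF u] by simp
  have "a * ?u \<le> 1 * ?u" using a u by (intro mult_right_mono) auto
  moreover have "(m - a * y)\<^sup>2 \<le> 2 * m\<^sup>2 + 2 * (a * ?u)"
  proof -
    have "0 \<le> (m + a * y)\<^sup>2" by simp
    then show ?thesis by (simp add: power2_eq_square algebra_simps)
  qed
  moreover have "0 \<le> (m - a * y)\<^sup>2" by simp
  ultimately have "\<bar>(m - a * y)\<^sup>2 - a\<bar> \<le> 2 * m\<^sup>2 + 1 + 2 * ?u" using a u unfolding abs_le_iff by (intro conjI; linarith)
  then have "\<bar>(m - a * y)\<^sup>2 - a\<bar> * ?e \<le> (2 * m\<^sup>2 + 1 + 2 * ?u) * ?e" by (intro mult_right_mono) auto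
  also have "\<dots> = (2 * m\<^sup>2 + 1) * ?e + 2 * (?u * ?e)" by (simp add: algebra_simps)
  also have "\<dots> \<le> (2 * m\<^sup>2 + 1) * 1 + 2 * 2" by (intro add_mono mult_left_mono e ue) auto
  finally have "\<bar>(m - a * y)\<^sup>2 - a\<bar> * ?e \<le> 2 * m\<^sup>2 + 5" by simp
  then have "\<bar>(m - a * y)\<^sup>2 - a\<bar> * ?e * exp (m * y) \<le> (2 * m\<^sup>2 + 5) * exp (m * y)" by (intro mult_right_mono) auto
  then show ?thesis unfolding gauss_split by (simp add: abs_mult mult_ac)
qed

context levy_triplet_process
begin

text \<open>Completing the square splits off the constant \<open>e^{m^2 / (2 a)}\<close> and leaves
  \<open>e^{- a (y - m/a)^2 / 2}\<close>, the characteristic function of the standard normal law at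
  \<open>sqrt a * (y - m / a)\<close>. The shift by \<open>m / a\<close> becomes a phase, so the
  weight has constant modulus. For nonzero \<open>m\<close> that modulus blows up as
  \<open>a\<close> tends to 0, so the bounds for the limit are made on the Gaussians
  themselves.\<close>

lemma gauss_fourier:
  assumes a: "0 < a"
  shows "levy_fourier_function M X b \<sigma>2 \<nu> std_normal_distribution (\<lambda>\<zeta>. sqrt a * \<zeta>)
    (\<lambda>\<zeta>. complex_of_real (exp (m\<^sup>2 / (2 * a))) * iexp (- (sqrt a * \<zeta> * (m / a)))) (exp (m\<^sup>2 / (2 * a))) (gauss a m)"
proof -
  interpret N: real_distribution std_normal_distribution by (rule real_dist_normal_dist)
  let ?c = "complex_of_real (exp (m\<^sup>2 / (2 * a)))"
  show ?thesis
  proof (unfold_locales)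
    show "cmod (?c * iexp (- (sqrt a * \<zeta> * (m / a)))) \<le> exp (m\<^sup>2 / (2 * a))" for \<zeta>
      unfolding norm_mult norm_exp_i_times norm_of_real by simp
    show "integrable std_normal_distribution (\<lambda>\<zeta>. (sqrt a * \<zeta>)\<^sup>2)"
      unfolding power_mult_distrib by (intro integrable_mult_right integrable_std_normal_distribution_moment)
    fix y
    let ?t = "sqrt a * (y - m / a)"
    have "(CLINT \<zeta>|std_normal_distribution. ?c * iexp (- (sqrt a * \<zeta> * (m / a))) * iexp (sqrt a * \<zeta> * y))
       = (CLINT \<zeta>|std_normal_distribution. ?c * iexp (?t * \<zeta>))"
    proof (intro Bochner_Integration.integral_cong refl)
      fix \<zeta>
      have "iexp (- (sqrt a * \<zeta> * (m / a))) * iexp (sqrt a * \<zeta> * y) = iexp (?t * \<zeta>)"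
        unfolding exp_add[symmetric] by (simp add: algebra_simps)
      then show "?c * iexp (- (sqrt a * \<zeta> * (m / a))) * iexp (sqrt a * \<zeta> * y) = ?c * iexp (?t * \<zeta>)" by (simp only: mult.assoc)
    qed
    also have "\<dots> = ?c * char std_normal_distribution ?t"
      unfolding char_def by (rule integral_mult_right_zero)
    also have "\<dots> = complex_of_real (exp (m\<^sup>2 / (2 * a)) * exp (- (?t\<^sup>2) / 2))"
      unfolding char_std_normal_distribution by simp
    also have "exp (m\<^sup>2 / (2 * a)) * exp (- (?t\<^sup>2) / 2) = gauss a m y"
      unfolding gauss_def exp_add[symmetric] using a
      by (simp add: power_mult_distrib power2_eq_square field_simps)
    finally show "complex_of_real (gauss a m y) = (CLINT \<zeta>|std_normal_distribution. ?c * iexp (- (sqrt a * \<zeta> * (m / a))) * iexp (sqrt a * \<zeta> * y))" ..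
  qed (auto intro: N.prob_space_axioms)
qed

lemma gauss_0[simp]: "gauss a m 0 = 1" by (simp add: gauss_def)

lemma
  assumes a: "0 < a"
  shows gauss_integrable: "0 \<le> t \<Longrightarrow> integrable (law t) (gauss a m)"
    and gauss_generator_integrable: "0 \<le> t \<Longrightarrow> integrable (law t) (generator b \<sigma>2 \<nu> (gauss a m))"
    and gauss_Dynkin: "0 \<le> t \<Longrightarrow> has_bochner_integral lborel
      (\<lambda>r. indicator {0..t} r * (LINT y|law r. generator b \<sigma>2 \<nu> (gauss a m) y)) ((LINT y|law t. gauss a m y) - 1)"
    and gauss_small_time: "(\<lambda>n. real (Suc n) * ((LINT y|law (1 / Suc n). gauss a m y) - 1)) \<longlonglongrightarrow> generator b \<sigma>2 \<nu> (gauss a m) 0"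
    and gauss_kernel_integrable: "integrable \<nu> (\<lambda>z. gauss a m (y + z) - gauss a m y - z * ((m - a * y) * gauss a m y) * indicator {0<..<1} \<bar>z\<bar>)"
proof -
  interpret levy_fourier_function M X b \<sigma>2 \<nu> std_normal_distribution "\<lambda>\<zeta>. sqrt a * \<zeta>"
    "\<lambda>\<zeta>. complex_of_real (exp (m\<^sup>2 / (2 * a))) * iexp (- (sqrt a * \<zeta> * (m / a)))" "exp (m\<^sup>2 / (2 * a))" "gauss a m"
    by (rule gauss_fourier[OF a])
  have G: "G = generator b \<sigma>2 \<nu> (gauss a m)" using G_eq_generator by auto
  show "0 \<le> t \<Longrightarrow> integrable (law t) (gauss a m)" by (rule integral_law_F)
  show "0 \<le> t \<Longrightarrow> integrable (law t) (generator b \<sigma>2 \<nu> (gauss a m))" using integral_law_G(1) unfolding G .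
  show "0 \<le> t \<Longrightarrow> has_bochner_integral lborel
      (\<lambda>r. indicator {0..t} r * (LINT y|law r. generator b \<sigma>2 \<nu> (gauss a m) y)) ((LINT y|law t. gauss a m y) - 1)"
    using Dynkin unfolding G by simp
  show "(\<lambda>n. real (Suc n) * ((LINT y|law (1 / Suc n). gauss a m y) - 1)) \<longlonglongrightarrow> generator b \<sigma>2 \<nu> (gauss a m) 0"
    using small_time_limit unfolding G by simp
  show "integrable \<nu> (\<lambda>z. gauss a m (y + z) - gauss a m y - z * ((m - a * y) * gauss a m y) * indicator {0<..<1} \<bar>z\<bar>)"
    using generator_kernel_integrable[of y] unfolding deriv_gauss .
qed

lemma levy_measure_exponential_moment:
  assumes mom: "\<And>t. 0 < t \<Longrightarrow> has_bochner_integral (law t) (\<lambda>y. exp (l * y)) (exp (\<alpha> * t))"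
  shows "integrable \<nu> (\<lambda>z. exp (l * z) * (1 - exp (- (z\<^sup>2) / 2)))"
proof -
  \<comment> \<open>The small-time limit of the expectation of \<open>e^{ly} - gauss 1 l y\<close>,
    divided by \<open>t\<close>: the first term contributes \<open>\<alpha>\<close> through
    \<open>mom\<close>, the second the generator at 0.\<close>
  define R where "R = \<alpha> - generator b \<sigma>2 \<nu> (gauss 1 l) 0"
  \<comment> \<open>\<open>?H e\<close> is a difference of Gaussians, so its small-time expectation is known, and it increases
    to \<open>exp (l * y) - gauss 1 l y\<close> as \<open>e\<close> tends to 0.\<close>
  let ?H = "\<lambda>e y. gauss e l y - gauss (1 + e) l y"
  have Heq: "?H e y = exp (- (e * y\<^sup>2) / 2) * (exp (l * y) * (1 - exp (- (y\<^sup>2) / 2)))" for e y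
  proof -
    have "exp (- ((1 + e) * y\<^sup>2) / 2) = exp (- (e * y\<^sup>2) / 2) * exp (- (y\<^sup>2) / 2)"
      unfolding exp_add[symmetric] by (simp add: field_simps)
    then show ?thesis unfolding gauss_split by (simp add: algebra_simps)
  qed
  have H0: "0 \<le> exp (l * y) * (1 - exp (- (y\<^sup>2) / 2))" for y by simp
  have Hnn: "0 \<le> ?H e y" for e y unfolding Heq by (intro mult_nonneg_nonneg H0) simp
  have Hle: "?H e y \<le> exp (l * y) - gauss 1 l y" if "0 < e" for e y
  proof -
    have "?H e y \<le> 1 * (exp (l * y) * (1 - exp (- (y\<^sup>2) / 2)))"
      unfolding Heq using that by (intro mult_right_mono H0) auto
    then show ?thesis unfolding gauss_split by (simp add: right_diff_distrib)
  qed
  have bound: "integrable \<nu> (?H e) \<and> (LINT z|\<nu>. ?H e z) \<le> R" if e: "0 < e" for e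
  proof -
    have e1: "0 < 1 + e" using e by simp
    let ?N = "\<lambda>n. real (Suc n)"
    have lim1: "(\<lambda>n. ?N n * ((LINT y|law (1 / Suc n). gauss e l y) - 1) - ?N n * ((LINT y|law (1 / Suc n). gauss (1 + e) l y) - 1))
        \<longlonglongrightarrow> generator b \<sigma>2 \<nu> (gauss e l) 0 - generator b \<sigma>2 \<nu> (gauss (1 + e) l) 0"
      by (intro tendsto_diff gauss_small_time e e1)
    have expl: "(\<lambda>n. ?N n * (exp (\<alpha> * (1 / Suc n)) - 1)) \<longlonglongrightarrow> \<alpha>"
    proof -
      have "((\<lambda>x::real. exp (\<alpha> * x)) has_real_derivative \<alpha>) (at 0)"
        by (auto intro!: derivative_eq_intros)
      then have "((\<lambda>h. (exp (\<alpha> * h) - 1) / h) \<longlongrightarrow> \<alpha>) (at 0)" by (simp add: DERIV_def)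
      moreover have "filterlim (\<lambda>n. 1 / ?N n) (at 0) sequentially"
        unfolding filterlim_at using LIMSEQ_Suc[OF lim_const_over_n[of "1::real"]] by auto
      ultimately have "(\<lambda>n. (exp (\<alpha> * (1 / ?N n)) - 1) / (1 / ?N n)) \<longlonglongrightarrow> \<alpha>" by (rule filterlim_compose)
      then show ?thesis by (simp add: mult.commute)
    qed
    have lim2: "(\<lambda>n. ?N n * (exp (\<alpha> * (1 / Suc n)) - 1) - ?N n * ((LINT y|law (1 / Suc n). gauss 1 l y) - 1)) \<longlonglongrightarrow> R"
      unfolding R_def by (intro tendsto_diff expl gauss_small_time) simp
    have le: "generator b \<sigma>2 \<nu> (gauss e l) 0 - generator b \<sigma>2 \<nu> (gauss (1 + e) l) 0 \<le> R"
    proof (rule LIMSEQ_le[OF lim1 lim2], intro exI allI impI)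
      fix n :: nat
      let ?t = "1 / real (Suc n)"
      have t: "0 \<le> ?t" "0 < ?t" by auto
      have "(LINT y|law ?t. ?H e y) \<le> (LINT y|law ?t. exp (l * y) - gauss 1 l y)"
        by (intro integral_mono Bochner_Integration.integrable_diff gauss_integrable t e e1 Hle)
          (use mom[OF t(2)] in \<open>auto simp: has_bochner_integral_iff\<close>)
      also have "\<dots> = exp (\<alpha> * ?t) - (LINT y|law ?t. gauss 1 l y)"
        using mom[OF t(2)] gauss_integrable[OF zero_less_one t(1)] by (simp add: has_bochner_integral_iff)
      also have "(LINT y|law ?t. ?H e y) = (LINT y|law ?t. gauss e l y) - (LINT y|law ?t. gauss (1 + e) l y)"
        by (intro Bochner_Integration.integral_diff gauss_integrable t e e1)
      finally have "?N n * ((LINT y|law ?t. gauss e l y) - (LINT y|law ?t. gauss (1 + e) l y)) \<le> ?N n * (exp (\<alpha> * ?t) - (LINT y|law ?t. gauss 1 l y))"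
        by (rule mult_left_mono) simp
      then show "?N n * ((LINT y|law ?t. gauss e l y) - 1) - ?N n * ((LINT y|law ?t. gauss (1 + e) l y) - 1)
         \<le> ?N n * (exp (\<alpha> * ?t) - 1) - ?N n * ((LINT y|law ?t. gauss 1 l y) - 1)"
        by (simp only: right_diff_distrib)
    qed
    let ?k = "\<lambda>e z. gauss e l (0 + z) - gauss e l 0 - z * ((l - e * 0) * gauss e l 0) * indicator {0<..<1} \<bar>z\<bar>"
    have kd: "?k e z - ?k (1 + e) z = ?H e z" for z by simp
    have int: "integrable \<nu> (?H e)" "(LINT z|\<nu>. ?H e z) = (LINT z|\<nu>. ?k e z) - (LINT z|\<nu>. ?k (1 + e) z)"
      unfolding kd[symmetric] by (intro Bochner_Integration.integrable_diff Bochner_Integration.integral_diff gauss_kernel_integrable e e1)+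
    \<comment> \<open>At 0 the two Gaussians share value and slope, so drift and compensator cancel.
      Their second derivatives differ by exactly 1; the resulting \<open>\<sigma>2 / 2\<close> is
      discarded as nonnegative.\<close>
    have "generator b \<sigma>2 \<nu> (gauss e l) 0 - generator b \<sigma>2 \<nu> (gauss (1 + e) l) 0 = \<sigma>2 / 2 + (LINT z|\<nu>. ?H e z)"
      unfolding int(2) generator_def deriv2_gauss unfolding deriv_gauss by (simp add: algebra_simps)
    then show ?thesis using le int(1) sigma2_nonneg by simp
  qed
  have "(\<integral>\<^sup>+z. ennreal (exp (l * z) * (1 - exp (- (z\<^sup>2) / 2))) \<partial>\<nu>) = (\<integral>\<^sup>+z. liminf (\<lambda>n. ennreal (?H (1 / Suc n) z)) \<partial>\<nu>)"
  proof (rule nn_integral_cong)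
    fix z
    have l0: "(\<lambda>n. 1 / real (Suc n)) \<longlonglongrightarrow> 0" by (rule LIMSEQ_Suc[OF lim_const_over_n])
    have "(\<lambda>n. exp (- (1 / Suc n * z\<^sup>2) / 2) * (exp (l * z) * (1 - exp (- (z\<^sup>2) / 2)))) \<longlonglongrightarrow> exp (- (0 * z\<^sup>2) / 2) * (exp (l * z) * (1 - exp (- (z\<^sup>2) / 2)))"
      by (intro tendsto_intros l0) simp
    then have "(\<lambda>n. ennreal (?H (1 / Suc n) z)) \<longlonglongrightarrow> ennreal (exp (l * z) * (1 - exp (- (z\<^sup>2) / 2)))"
      unfolding Heq by (intro tendsto_ennrealI) simp
    then show "ennreal (exp (l * z) * (1 - exp (- (z\<^sup>2) / 2))) = liminf (\<lambda>n. ennreal (?H (1 / Suc n) z))"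
      by (simp add: lim_imp_Liminf)
  qed
  also have "\<dots> \<le> liminf (\<lambda>n. \<integral>\<^sup>+z. ennreal (?H (1 / Suc n) z) \<partial>\<nu>)"
    by (rule nn_integral_liminf) measurable
  also have "\<dots> \<le> ennreal R"
  proof (rule order_trans[OF Liminf_le_Limsup Limsup_bounded])
    show "\<forall>\<^sub>F n in sequentially. (\<integral>\<^sup>+z. ennreal (?H (1 / Suc n) z) \<partial>\<nu>) \<le> ennreal R"
    proof (intro always_eventually allI)
      fix n :: nat
      have b: "integrable \<nu> (?H (1 / Suc n))" "(LINT z|\<nu>. ?H (1 / Suc n) z) \<le> R" using bound[of "1 / Suc n"] by auto
      have "(\<integral>\<^sup>+z. ennreal (?H (1 / Suc n) z) \<partial>\<nu>) = ennreal (LINT z|\<nu>. ?H (1 / Suc n) z)"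
        by (rule nn_integral_eq_integral[OF b(1)]) (use Hnn in auto)
      then show "(\<integral>\<^sup>+z. ennreal (?H (1 / Suc n) z) \<partial>\<nu>) \<le> ennreal R" using b(2) by (simp add: ennreal_leI)
    qed
  qed simp
  finally show ?thesis by (intro integrableI_nonneg) (auto intro: le_less_trans)
qed

text \<open>This is \<open>- \<psi>\<close> continued formally to
  \<open>\<xi> = - \<i> l\<close>.\<close>

definition laplace_exponent :: "real \<Rightarrow> real" where
  "laplace_exponent l = b * l + \<sigma>2 / 2 * l\<^sup>2 + (LINT z|\<nu>. exp (l * z) - 1 - z * l * indicator {0<..<1} \<bar>z\<bar>)"

text \<open>In the limit, Dynkin's formula on \<open>[0, 1]\<close> says that
  \<open>laplace_exponent l * e^{\<alpha> r}\<close> has integral \<open>e^\<alpha> - 1\<close>,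
  which is also the integral of \<open>\<alpha> e^{\<alpha> r}\<close>. The work lies in a majorant
  that is uniform in the Gaussian parameter.\<close>

lemma laplace_exponent_eq:
  assumes mom: "\<And>t. 0 < t \<Longrightarrow> has_bochner_integral (law t) (\<lambda>y. exp (l * y)) (exp (\<alpha> * t))"
  shows "laplace_exponent l = \<alpha>"
proof -
  \<comment> \<open>The minimum of \<open>1 - e^{-z^2/2}\<close> over \<open>|z| >= 1\<close>; for
    large jumps \<open>e^{lz}\<close> is thus at most \<open>?H z / q\<close>, which is
    \<open>\<nu>\<close>-integrable.\<close>
  define q where "q = 1 - exp (- 1 / 2 :: real)"
  have q: "q > 0" unfolding q_def by simp
  let ?H = "\<lambda>z. exp (l * z) * (1 - exp (- (z\<^sup>2) / 2))"
  have H0: "0 \<le> ?H z" for z by simp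
  \<comment> \<open>Majorant of the jump kernel after division by \<open>e^{ly}\<close>. The first
    term carries the second-derivative bound for small jumps and, through the added 1, the value
    \<open>gauss a l y\<close> for large ones; the last term handles
    \<open>gauss a l (y + z)\<close>.\<close>
  define Q where "Q z = ((2 * l\<^sup>2 + 5) * exp \<bar>l\<bar> + 1) * min (z\<^sup>2) 1 + ?H z / q" for z
  have intQ: "integrable \<nu> Q"
    unfolding Q_def using levy_measure_exponential_moment[OF mom]
    by (intro Bochner_Integration.integrable_add integrable_mult_right integrable_divide levy_measure_integrable levy_nu) auto
  have kb: "\<bar>gauss a l (y + z) - gauss a l y - z * ((l - a * y) * gauss a l y) * indicator {0<..<1} \<bar>z\<bar>\<bar> \<le> exp (l * y) * Q z"
    if a: "0 \<le> a" "a \<le> 1" for a y z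
  proof (cases "\<bar>z\<bar> < 1")
    case True
    have z2: "z\<^sup>2 \<le> 1" using True by (simp add: abs_square_le_1)
    have i: "z * ((l - a * y) * gauss a l y) * indicator {0<..<1} \<bar>z\<bar> = z * ((l - a * y) * gauss a l y)"
      using True by (cases "z = 0") (auto simp: indicator_def)
    let ?K = "(2 * l\<^sup>2 + 5) * (exp \<bar>l\<bar> * exp (l * y))"
    have "\<bar>gauss a l (y + z) - gauss a l y - z * ((l - a * y) * gauss a l y)\<bar> \<le> ?K / 2 * z\<^sup>2"
    proof (rule second_order_bound[OF gauss_derivative gauss_derivative2])
      fix t assume t: "\<bar>t - y\<bar> \<le> \<bar>z\<bar>"
      have "l * (t - y) \<le> \<bar>l\<bar> * \<bar>t - y\<bar>" by (metis abs_ge_self abs_mult)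
      also have "\<dots> \<le> \<bar>l\<bar> * 1" using t True by (intro mult_left_mono) auto
      finally have "exp (l * t) \<le> exp (\<bar>l\<bar> + l * y)" by (simp add: algebra_simps)
      then have "exp (l * t) \<le> exp \<bar>l\<bar> * exp (l * y)" by (simp add: exp_add)
      then have "(2 * l\<^sup>2 + 5) * exp (l * t) \<le> ?K" by (intro mult_left_mono) auto
      then show "\<bar>((l - a * t)\<^sup>2 - a) * gauss a l t\<bar> \<le> ?K"
        using gauss_derivative2_bound[OF a, of l t] by linarith
    qed
    also have "\<dots> \<le> exp (l * y) * (((2 * l\<^sup>2 + 5) * exp \<bar>l\<bar> + 1) * z\<^sup>2)"
    proof -
      have "?K / 2 \<le> exp (l * y) * ((2 * l\<^sup>2 + 5) * exp \<bar>l\<bar> + 1)" by (simp add: distrib_left mult_ac add_increasing2)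
      from mult_right_mono[OF this, of "z\<^sup>2"] show ?thesis by (simp add: mult.assoc)
    qed
    also have "\<dots> \<le> exp (l * y) * Q z"
      unfolding Q_def using z2 q H0[of z] by (intro mult_left_mono) (auto simp: min_absorb1)
    finally show ?thesis unfolding i .
  next
    case False
    then have z2: "1 \<le> z\<^sup>2" using abs_le_square_iff[of 1 z] by simp
    have "exp (- (z\<^sup>2) / 2) \<le> exp (- 1 / 2)" using z2 by simp
    then have "q \<le> 1 - exp (- (z\<^sup>2) / 2)" unfolding q_def by simp
    then have "exp (l * z) * q \<le> ?H z" by (intro mult_left_mono) auto
    then have e: "exp (l * z) \<le> ?H z / q" using q by (simp add: le_divide_eq)
    have "\<bar>gauss a l (y + z) - gauss a l y\<bar> \<le> gauss a l (y + z) + gauss a l y"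
      by (simp add: gauss_def abs_le_iff add_increasing add_increasing2)
    also have "\<dots> \<le> exp (l * (y + z)) + exp (l * y)" by (intro add_mono gauss_le a)
    also have "\<dots> = exp (l * y) * (exp (l * z) + 1)" by (simp add: exp_add algebra_simps)
    also have "\<dots> \<le> exp (l * y) * Q z"
    proof (rule mult_left_mono)
      have "1 * 1 \<le> ((2 * l\<^sup>2 + 5) * exp \<bar>l\<bar> + 1) * min (z\<^sup>2) 1" using z2 by (intro mult_mono) (auto simp: min_absorb2)
      then show "exp (l * z) + 1 \<le> Q z" unfolding Q_def using e by simp
    qed simp
    finally show ?thesis using False by (simp add: indicator_def)
  qed
  define e where "e n = 1 / real (Suc n)" for n
  have e: "0 < e n" "0 \<le> e n" "e n \<le> 1" for n unfolding e_def by auto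
  have e0: "e \<longlonglongrightarrow> 0" unfolding e_def by (rule LIMSEQ_Suc[OF lim_const_over_n])
  let ?gen = "generator b \<sigma>2 \<nu>"
  define Cb where "Cb = \<bar>b\<bar> * (\<bar>l\<bar> + 3) + \<sigma>2 / 2 * (2 * l\<^sup>2 + 5) + (LINT z|\<nu>. Q z)"
  have gb: "\<bar>?gen (gauss (e n) l) y\<bar> \<le> Cb * exp (l * y)" for n y
  proof -
    have 1: "\<bar>b * deriv (gauss (e n) l) y\<bar> \<le> \<bar>b\<bar> * ((\<bar>l\<bar> + 3) * exp (l * y))"
      unfolding abs_mult[of b] deriv_gauss by (intro mult_left_mono gauss_derivative_bound e) simp
    have 2: "\<bar>\<sigma>2 / 2 * deriv (deriv (gauss (e n) l)) y\<bar> \<le> \<sigma>2 / 2 * ((2 * l\<^sup>2 + 5) * exp (l * y))"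
      unfolding abs_mult[of "\<sigma>2 / 2"] deriv2_gauss using sigma2_nonneg by (intro mult_mono gauss_derivative2_bound e) auto
    have "norm (LINT z|\<nu>. gauss (e n) l (y + z) - gauss (e n) l y - z * ((l - e n * y) * gauss (e n) l y) * indicator {0<..<1} \<bar>z\<bar>) \<le> (LINT z|\<nu>. exp (l * y) * Q z)"
      by (rule Bochner_Integration.integral_norm_bound_integral[OF gauss_kernel_integrable[OF e(1)]])
        (use kb[OF e(2,3)] intQ in auto)
    then have 3: "\<bar>LINT z|\<nu>. gauss (e n) l (y + z) - gauss (e n) l y - z * deriv (gauss (e n) l) y * indicator {0<..<1} \<bar>z\<bar>\<bar> \<le> (LINT z|\<nu>. exp (l * y) * Q z)"
      unfolding deriv_gauss real_norm_def .
    have "\<bar>a1 + a2 + a3\<bar> \<le> B1 + B2 + B3" if "\<bar>a1\<bar> \<le> B1" "\<bar>a2\<bar> \<le> B2" "\<bar>a3\<bar> \<le> B3" for a1 a2 a3 B1 B2 B3 :: real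
      using that by linarith
    from this[OF 1 2 3] have "\<bar>?gen (gauss (e n) l) y\<bar>
        \<le> \<bar>b\<bar> * ((\<bar>l\<bar> + 3) * exp (l * y)) + \<sigma>2 / 2 * ((2 * l\<^sup>2 + 5) * exp (l * y)) + (LINT z|\<nu>. exp (l * y) * Q z)"
      unfolding generator_def .
    also have "\<dots> = Cb * exp (l * y)" unfolding Cb_def by (simp add: algebra_simps)
    finally show ?thesis .
  qed
  have glim: "(\<lambda>n. ?gen (gauss (e n) l) y) \<longlonglongrightarrow> laplace_exponent l * exp (l * y)" for y
  proof -
    have g: "(\<lambda>n. gauss (e n) l y) \<longlonglongrightarrow> exp (l * y)" for y
    proof -
      have "(\<lambda>n. gauss (e n) l y) \<longlonglongrightarrow> exp (l * y - 0 * y\<^sup>2 / 2)"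
        unfolding gauss_def by (intro tendsto_intros e0) simp
      then show ?thesis by simp
    qed
    have g1: "(\<lambda>n. (l - e n * y) * gauss (e n) l y) \<longlonglongrightarrow> (l - 0 * y) * exp (l * y)" by (intro tendsto_intros e0 g)
    have g2: "(\<lambda>n. ((l - e n * y)\<^sup>2 - e n) * gauss (e n) l y) \<longlonglongrightarrow> ((l - 0 * y)\<^sup>2 - 0) * exp (l * y)" by (intro tendsto_intros e0 g)
    have "(\<lambda>n. LINT z|\<nu>. gauss (e n) l (y + z) - gauss (e n) l y - z * ((l - e n * y) * gauss (e n) l y) * indicator {0<..<1} \<bar>z\<bar>)
      \<longlonglongrightarrow> (LINT z|\<nu>. exp (l * (y + z)) - exp (l * y) - z * ((l - 0 * y) * exp (l * y)) * indicator {0<..<1} \<bar>z\<bar>)"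
    proof (rule integral_dominated_convergence[where w="\<lambda>z. exp (l * y) * Q z"])
      show "AE z in \<nu>. (\<lambda>n. gauss (e n) l (y + z) - gauss (e n) l y - z * ((l - e n * y) * gauss (e n) l y) * indicator {0<..<1} \<bar>z\<bar>)
        \<longlonglongrightarrow> exp (l * (y + z)) - exp (l * y) - z * ((l - 0 * y) * exp (l * y)) * indicator {0<..<1} \<bar>z\<bar>"
        by (intro AE_I2 tendsto_intros g g1)
      show "AE z in \<nu>. norm (gauss (e n) l (y + z) - gauss (e n) l y - z * ((l - e n * y) * gauss (e n) l y) * indicator {0<..<1} \<bar>z\<bar>) \<le> exp (l * y) * Q z" for n
        using kb[OF e(2,3)] by auto
      show "integrable \<nu> (\<lambda>z. exp (l * y) * Q z)" using intQ by simp
    qed measurable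
    also have "(LINT z|\<nu>. exp (l * (y + z)) - exp (l * y) - z * ((l - 0 * y) * exp (l * y)) * indicator {0<..<1} \<bar>z\<bar>)
      = (LINT z|\<nu>. exp (l * y) * (exp (l * z) - 1 - z * l * indicator {0<..<1} \<bar>z\<bar>))"
      by (intro Bochner_Integration.integral_cong refl) (simp add: exp_add algebra_simps)
    also have "\<dots> = exp (l * y) * (LINT z|\<nu>. exp (l * z) - 1 - z * l * indicator {0<..<1} \<bar>z\<bar>)"
      by (rule integral_mult_right_zero)
    finally have g3: "(\<lambda>n. LINT z|\<nu>. gauss (e n) l (y + z) - gauss (e n) l y - z * ((l - e n * y) * gauss (e n) l y) * indicator {0<..<1} \<bar>z\<bar>)
      \<longlonglongrightarrow> exp (l * y) * (LINT z|\<nu>. exp (l * z) - 1 - z * l * indicator {0<..<1} \<bar>z\<bar>)" .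
    have "(\<lambda>n. ?gen (gauss (e n) l) y) \<longlonglongrightarrow> b * ((l - 0 * y) * exp (l * y)) + \<sigma>2 / 2 * (((l - 0 * y)\<^sup>2 - 0) * exp (l * y))
      + exp (l * y) * (LINT z|\<nu>. exp (l * z) - 1 - z * l * indicator {0<..<1} \<bar>z\<bar>)"
      unfolding generator_def deriv2_gauss unfolding deriv_gauss
      by (intro tendsto_add tendsto_mult_left g1 g2 g3)
    then show ?thesis unfolding laplace_exponent_def by (simp add: algebra_simps)
  qed
  have Cb0: "0 \<le> Cb"
  proof -
    have "0 \<le> Cb * exp (l * 0)" using gb[of 0 0] by (meson abs_ge_zero order_trans)
    then show ?thesis by simp
  qed
  have elim_law: "(\<lambda>n. LINT y|law r. ?gen (gauss (e n) l) y) \<longlonglongrightarrow> laplace_exponent l * exp (\<alpha> * r)" if r: "0 < r" for r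
  proof -
    have m: "integrable (law r) (\<lambda>y. exp (l * y))" "(LINT y|law r. exp (l * y)) = exp (\<alpha> * r)"
      using mom[OF r] by (auto simp: has_bochner_integral_iff)
    have "(\<lambda>n. LINT y|law r. ?gen (gauss (e n) l) y) \<longlonglongrightarrow> (LINT y|law r. laplace_exponent l * exp (l * y))"
    proof (rule integral_dominated_convergence[where w="\<lambda>y. Cb * exp (l * y)"])
      show "?gen (gauss (e n) l) \<in> borel_measurable (law r)" for n
        by (rule borel_measurable_integrable[OF gauss_generator_integrable[OF e(1)]]) (use r in simp)
      show "integrable (law r) (\<lambda>y. Cb * exp (l * y))" using m by simp
    qed (use gb glim in auto)
    then show ?thesis using m by simp
  qed
  have lbound: "\<bar>LINT y|law r. ?gen (gauss (e n) l) y\<bar> \<le> Cb * exp (\<alpha> * r)" if r: "0 < r" for r n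
  proof -
    have m: "integrable (law r) (\<lambda>y. exp (l * y))" "(LINT y|law r. exp (l * y)) = exp (\<alpha> * r)"
      using mom[OF r] by (auto simp: has_bochner_integral_iff)
    have "norm (LINT y|law r. ?gen (gauss (e n) l) y) \<le> (LINT y|law r. Cb * exp (l * y))"
      by (rule Bochner_Integration.integral_norm_bound_integral[OF gauss_generator_integrable[OF e(1)]])
        (use r m gb in auto)
    then show ?thesis using m by simp
  qed
  \<comment> \<open>\<open>mom\<close> speaks of positive times only; the single time 0 is Lebesgue
    null.\<close>
  have AE0: "AE r in lborel. r \<noteq> (0::real)" by (rule AE_lborel_singleton)
  have J: "has_bochner_integral lborel (\<lambda>r. indicator {0..1} r *\<^sub>R (\<alpha> * exp (\<alpha> * r))) (exp (\<alpha> * 1) - exp (\<alpha> * 0))"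
    by (rule has_bochner_integral_FTC_Icc)
      (auto intro!: derivative_eq_intros continuous_intros simp flip: has_real_derivative_iff_has_vector_derivative)
  have iexp: "integrable lborel (\<lambda>r. indicator {0..1} r * exp (\<alpha> * r))"
  proof -
    have "integrable lborel (\<lambda>r. indicator {0..1} r *\<^sub>R exp (\<alpha> * r))"
      by (rule borel_integrable_compact) (auto intro!: continuous_intros)
    then show ?thesis by simp
  qed
  have "(\<lambda>n. LINT r|lborel. indicator {0..1} r * (LINT y|law r. ?gen (gauss (e n) l) y))
    \<longlonglongrightarrow> (LINT r|lborel. indicator {0..1} r * (laplace_exponent l * exp (\<alpha> * r)))"
  proof (rule integral_dominated_convergence[where w="\<lambda>r. Cb * (indicator {0..1} r * exp (\<alpha> * r))"])
    show "(\<lambda>r. indicator {0..1} r * (LINT y|law r. ?gen (gauss (e n) l) y)) \<in> borel_measurable lborel" for n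
      using gauss_Dynkin[OF e(1), of 1 n l] by (auto simp: has_bochner_integral_iff)
    show "AE r in lborel. (\<lambda>n. indicator {0..1} r * (LINT y|law r. ?gen (gauss (e n) l) y)) \<longlonglongrightarrow> indicator {0..1} r * (laplace_exponent l * exp (\<alpha> * r))"
      using AE0
    proof eventually_elim
      case (elim r)
      then show ?case using elim_law[of r] by (cases "r \<in> {0..1}") (auto intro!: tendsto_mult_left)
    qed
    show "AE r in lborel. norm (indicator {0..1} r * (LINT y|law r. ?gen (gauss (e n) l) y)) \<le> Cb * (indicator {0..1} r * exp (\<alpha> * r))" for n
      using AE0
    proof eventually_elim
      case (elim r)
      then show ?case using lbound[of r n] by (cases "r \<in> {0..1}") auto
    qed
    show "integrable lborel (\<lambda>r. Cb * (indicator {0..1} r * exp (\<alpha> * r)))" using iexp by simp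
  qed measurable
  moreover have "(LINT r|lborel. indicator {0..1} r * (LINT y|law r. ?gen (gauss (e n) l) y)) = (LINT y|law 1. gauss (e n) l y) - 1" for n
    using gauss_Dynkin[OF e(1), of 1 n l] by (simp add: has_bochner_integral_iff)
  moreover have "(\<lambda>n. (LINT y|law 1. gauss (e n) l y) - 1) \<longlonglongrightarrow> exp \<alpha> - 1"
  proof -
    have m: "integrable (law 1) (\<lambda>y. exp (l * y))" "(LINT y|law 1. exp (l * y)) = exp \<alpha>"
      using mom[of 1] by (auto simp: has_bochner_integral_iff)
    have "(\<lambda>n. LINT y|law 1. gauss (e n) l y) \<longlonglongrightarrow> (LINT y|law 1. exp (l * y))"
    proof (rule integral_dominated_convergence[OF _ _ m(1)])
      show "AE y in law 1. (\<lambda>n. gauss (e n) l y) \<longlonglongrightarrow> exp (l * y)"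
      proof (rule AE_I2)
        fix y
        have "(\<lambda>n. gauss (e n) l y) \<longlonglongrightarrow> exp (l * y - 0 * y\<^sup>2 / 2)"
          unfolding gauss_def by (intro tendsto_intros e0) simp
        then show "(\<lambda>n. gauss (e n) l y) \<longlonglongrightarrow> exp (l * y)" by simp
      qed
      show "AE y in law 1. norm (gauss (e n) l y) \<le> exp (l * y)" for n
        using gauss_le[OF e(2), of n l] by (auto simp: gauss_def)
    qed measurable
    then show ?thesis unfolding m by (intro tendsto_intros)
  qed
  ultimately have "(LINT r|lborel. indicator {0..1} r * (laplace_exponent l * exp (\<alpha> * r))) = exp \<alpha> - 1"
    using LIMSEQ_unique by auto
  moreover have "(LINT r|lborel. indicator {0..1} r * (laplace_exponent l * exp (\<alpha> * r))) = laplace_exponent l * (LINT r|lborel. indicator {0..1} r * exp (\<alpha> * r))"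
    by (subst integral_mult_right_zero[symmetric]) (simp add: mult_ac)
  moreover have "(LINT r|lborel. indicator {0..1} r *\<^sub>R (\<alpha> * exp (\<alpha> * r))) = \<alpha> * (LINT r|lborel. indicator {0..1} r * exp (\<alpha> * r))"
    by (subst integral_mult_right_zero[symmetric]) (simp add: mult_ac)
  moreover have "(LINT r|lborel. indicator {0..1} r *\<^sub>R (\<alpha> * exp (\<alpha> * r))) = exp \<alpha> - 1"
    using J by (simp add: has_bochner_integral_iff)
  \<comment> \<open>Both sides are multiples of this integral, so its positivity permits cancelling
    without a division by \<open>\<alpha>\<close>, which may be 0.\<close>
  moreover have "(LINT r|lborel. indicator {0..1} r * exp (\<alpha> * r)) > 0"
  proof -
    have "(LINT r|lborel. indicator {0..1::real} r * exp (- \<bar>\<alpha>\<bar>)) \<le> (LINT r|lborel. indicator {0..1} r * exp (\<alpha> * r))"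
    proof (rule integral_mono[OF _ iexp])
      fix r :: real
      show "indicator {0..1} r * exp (- \<bar>\<alpha>\<bar>) \<le> indicator {0..1} r * exp (\<alpha> * r)"
      proof (cases "r \<in> {0..1}")
        case True
        have "- (\<alpha> * r) \<le> \<bar>\<alpha>\<bar> * \<bar>r\<bar>" by (metis abs_ge_minus_self abs_mult)
        also have "\<dots> \<le> \<bar>\<alpha>\<bar> * 1" using True by (intro mult_left_mono) auto
        finally show ?thesis using True by simp
      qed simp
    qed (auto simp: emeasure_lborel_Icc_eq)
    moreover have "(LINT r|lborel. indicator {0..1::real} r * exp (- \<bar>\<alpha>\<bar>)) = exp (- \<bar>\<alpha>\<bar>)" by simp
    ultimately show ?thesis using exp_gt_zero[of "- \<bar>\<alpha>\<bar>"] by linarith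
  qed
  ultimately have "laplace_exponent l * (LINT r|lborel. indicator {0..1} r * exp (\<alpha> * r)) = \<alpha> * (LINT r|lborel. indicator {0..1} r * exp (\<alpha> * r))"
    "(LINT r|lborel. indicator {0..1} r * exp (\<alpha> * r)) \<noteq> 0" by auto
  then show ?thesis by simp
qed

end

section \<open>The weak generator on exponentials\<close>

lemma integrable_compact_support:
  fixes f :: "real \<Rightarrow> real"
  assumes "continuous_on UNIV f" "\<And>x. R < \<bar>x\<bar> \<Longrightarrow> f x = 0"
  shows "integrable lborel f"
proof -
  have "integrable lborel (\<lambda>x. indicator {- R..R} x *\<^sub>R f x)"
    by (rule borel_integrable_compact) (use assms in \<open>auto intro: continuous_on_subset\<close>)
  moreover have "(\<lambda>x. indicator {- R..R} x *\<^sub>R f x) = f"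
  proof
    fix x show "indicator {- R..R} x *\<^sub>R f x = f x"
      using assms(2)[of x] by (cases "R < \<bar>x\<bar>") (auto simp: indicator_def)
  qed
  ultimately show ?thesis by simp
qed

lemma integral_derivative_compact_support:
  fixes f f' :: "real \<Rightarrow> real"
  assumes d: "\<And>x. (f has_real_derivative f' x) (at x)" and c: "continuous_on UNIV f'"
    and z: "\<And>x. R < \<bar>x\<bar> \<Longrightarrow> f x = 0" "\<And>x. R < \<bar>x\<bar> \<Longrightarrow> f' x = 0"
  shows "(LINT x|lborel. f' x) = 0"
proof -
  define S where "S = \<bar>R\<bar> + 1"
  have "has_bochner_integral lborel (\<lambda>x. indicator {- S..S} x *\<^sub>R f' x) (f S - f (- S))"
    by (rule has_bochner_integral_FTC_Icc)
      (use d c in \<open>auto simp: S_def intro: continuous_on_subset has_field_derivative_at_within simp flip: has_real_derivative_iff_has_vector_derivative\<close>)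
  moreover have "(\<lambda>x. indicator {- S..S} x *\<^sub>R f' x) = f'"
  proof
    fix x show "indicator {- S..S} x *\<^sub>R f' x = f' x"
      using z(2)[of x] by (cases "R < \<bar>x\<bar>") (auto simp: indicator_def S_def)
  qed
  moreover have "f S = 0" "f (- S) = 0" using z(1) by (auto simp: S_def)
  ultimately show ?thesis by (simp add: has_bochner_integral_iff)
qed

text \<open>On the open set \<open>R < |x|\<close> the function is locally zero, so its derivatives
  vanish there too and one radius serves \<open>\<phi>\<close> and both derivatives.\<close>

lemma test_function_facts:
  assumes "test_function \<phi>"
  obtains R where "0 \<le> R" "\<And>x. (\<phi> has_real_derivative deriv \<phi> x) (at x)"
    "\<And>x. (deriv \<phi> has_real_derivative deriv (deriv \<phi>) x) (at x)"
    "continuous_on UNIV \<phi>" "continuous_on UNIV (deriv \<phi>)" "continuous_on UNIV (deriv (deriv \<phi>))"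
    "\<And>x. R < \<bar>x\<bar> \<Longrightarrow> \<phi> x = 0" "\<And>x. R < \<bar>x\<bar> \<Longrightarrow> deriv \<phi> x = 0" "\<And>x. R < \<bar>x\<bar> \<Longrightarrow> deriv (deriv \<phi>) x = 0"
proof -
  have fd: "((deriv ^^ n) \<phi>) field_differentiable at x" for n x
    using assms unfolding test_function_def by blast
  have d0: "(\<phi> has_real_derivative deriv \<phi> x) (at x)" for x using fd[of 0 x] by (simp add: DERIV_deriv_iff_field_differentiable)
  have d1: "(deriv \<phi> has_real_derivative deriv (deriv \<phi>) x) (at x)" for x using fd[of 1 x] by (simp add: DERIV_deriv_iff_field_differentiable)
  have c: "continuous_on UNIV ((deriv ^^ n) \<phi>)" for n
    using fd field_differentiable_imp_continuous_at by (intro continuous_at_imp_continuous_on) blast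
  have cs: "continuous_on UNIV \<phi>" "continuous_on UNIV (deriv \<phi>)" "continuous_on UNIV (deriv (deriv \<phi>))"
    using c[of 0] c[of 1] c[of 2] by (auto simp: numeral_2_eq_2)
  have "bounded {x. \<phi> x \<noteq> 0}"
    using assms unfolding test_function_def by (meson bounded_subset closure_subset compact_imp_bounded)
  then obtain R where R: "\<And>x. \<phi> x \<noteq> 0 \<Longrightarrow> \<bar>x\<bar> \<le> R" unfolding bounded_iff by auto
  define R' where "R' = \<bar>R\<bar>"
  have z0: "\<phi> x = 0" if "R' < \<bar>x\<bar>" for x using R[of x] that unfolding R'_def by force
  have op: "open {x::real. R' < \<bar>x\<bar>}" by (intro open_Collect_less continuous_intros)
  have zero: "f' x = 0" if f: "\<And>x. (f has_real_derivative f' x) (at x)" and z: "\<And>x. R' < \<bar>x\<bar> \<Longrightarrow> f x = 0" and x: "R' < \<bar>x\<bar>"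
    for f f' :: "real \<Rightarrow> real" and x
  proof -
    have "((\<lambda>_. 0) has_real_derivative f' x) (at x)"
      by (rule has_field_derivative_transform_within_open[OF f op]) (use x z in auto)
    then show ?thesis using DERIV_unique DERIV_const by blast
  qed
  have z1: "deriv \<phi> x = 0" if "R' < \<bar>x\<bar>" for x by (rule zero[OF d0 z0 that])
  have z2: "deriv (deriv \<phi>) x = 0" if "R' < \<bar>x\<bar>" for x by (rule zero[OF d1 z1 that])
  show thesis by (rule that[of R', OF _ d0 d1 cs z0 z1 z2]) (simp_all add: R'_def)
qed

lemma weak_generator_eq_linear:
  assumes "weak_generator_eq b \<sigma>2 \<nu> f (\<lambda>x. \<alpha> * f x)" "weak_generator_eq b \<sigma>2 \<nu> h (\<lambda>x. \<alpha> * h x)"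
  shows "weak_generator_eq b \<sigma>2 \<nu> (\<lambda>x. a1 * f x + a2 * h x) (\<lambda>x. \<alpha> * (a1 * f x + a2 * h x))"
  unfolding weak_generator_eq_def
proof (intro allI impI)
  fix \<phi> assume \<phi>: "test_function \<phi>"
  let ?A = "adjoint_generator b \<sigma>2 \<nu> \<phi>"
  have f: "integrable lborel (\<lambda>x. f x * ?A x)" "integrable lborel (\<lambda>x. \<alpha> * f x * \<phi> x)" "(LINT x|lborel. f x * ?A x) = (LINT x|lborel. \<alpha> * f x * \<phi> x)"
    and h: "integrable lborel (\<lambda>x. h x * ?A x)" "integrable lborel (\<lambda>x. \<alpha> * h x * \<phi> x)" "(LINT x|lborel. h x * ?A x) = (LINT x|lborel. \<alpha> * h x * \<phi> x)"
    using assms \<phi> unfolding weak_generator_eq_def by auto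
  have e1: "(\<lambda>x. (a1 * f x + a2 * h x) * ?A x) = (\<lambda>x. a1 * (f x * ?A x) + a2 * (h x * ?A x))"
    and e2: "(\<lambda>x. \<alpha> * (a1 * f x + a2 * h x) * \<phi> x) = (\<lambda>x. a1 * (\<alpha> * f x * \<phi> x) + a2 * (\<alpha> * h x * \<phi> x))"
    by (auto simp: algebra_simps)
  show "integrable lborel (\<lambda>x. (a1 * f x + a2 * h x) * ?A x) \<and> integrable lborel (\<lambda>x. \<alpha> * (a1 * f x + a2 * h x) * \<phi> x) \<and>
    (LINT x|lborel. (a1 * f x + a2 * h x) * ?A x) = (LINT x|lborel. \<alpha> * (a1 * f x + a2 * h x) * \<phi> x)"
    unfolding e1 e2
  proof (intro conjI)
    have "(LINT x|lborel. a1 * (f x * ?A x) + a2 * (h x * ?A x)) = a1 * (LINT x|lborel. f x * ?A x) + a2 * (LINT x|lborel. h x * ?A x)"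
      by (subst Bochner_Integration.integral_add) (use f(1) h(1) in \<open>simp_all only: integrable_mult_right integral_mult_right_zero\<close>)
    moreover have "(LINT x|lborel. a1 * (\<alpha> * f x * \<phi> x) + a2 * (\<alpha> * h x * \<phi> x)) = a1 * (LINT x|lborel. \<alpha> * f x * \<phi> x) + a2 * (LINT x|lborel. \<alpha> * h x * \<phi> x)"
      by (subst Bochner_Integration.integral_add) (use f(2) h(2) in \<open>simp_all only: integrable_mult_right integral_mult_right_zero\<close>)
    ultimately show "(LINT x|lborel. a1 * (f x * ?A x) + a2 * (h x * ?A x)) = (LINT x|lborel. a1 * (\<alpha> * f x * \<phi> x) + a2 * (\<alpha> * h x * \<phi> x))"
      using f(3) h(3) by simp
  qed (use f h in \<open>auto intro!: Bochner_Integration.integrable_add integrable_mult_right\<close>)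
qed

section \<open>Exponentials as weak eigenfunctions\<close>

context levy_triplet_process
begin

lemma levy_measure_exp_tail:
  assumes mom: "\<And>t. 0 < t \<Longrightarrow> has_bochner_integral (law t) (\<lambda>y. exp (l * y)) (exp (\<alpha> * t))"
  shows "integrable \<nu> (\<lambda>y. indicator {y. 1 \<le> \<bar>y\<bar>} y * exp (l * y))"
proof -
  define q where "q = 1 - exp (- 1 / 2 :: real)"
  have q: "q > 0" unfolding q_def by simp
  show ?thesis
  proof (rule Bochner_Integration.integrable_bound)
    show "integrable \<nu> (\<lambda>y. exp (l * y) * (1 - exp (- (y\<^sup>2) / 2)) / q)"
      using levy_measure_exponential_moment[OF mom] by simp
    show "AE y in \<nu>. norm (indicator {y. 1 \<le> \<bar>y\<bar>} y * exp (l * y)) \<le> norm (exp (l * y) * (1 - exp (- (y\<^sup>2) / 2)) / q)"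
    proof (rule AE_I2)
      fix y
      show "norm (indicator {y. 1 \<le> \<bar>y\<bar>} y * exp (l * y)) \<le> norm (exp (l * y) * (1 - exp (- (y\<^sup>2) / 2)) / q)"
      proof (cases "1 \<le> \<bar>y\<bar>")
        case True
        then have "1 \<le> y\<^sup>2" using abs_le_square_iff[of 1 y] by simp
        then have "exp (- (y\<^sup>2) / 2) \<le> exp (- 1 / 2)" by simp
        then have "q \<le> 1 - exp (- (y\<^sup>2) / 2)" unfolding q_def by simp
        then have "exp (l * y) * q \<le> exp (l * y) * (1 - exp (- (y\<^sup>2) / 2))" by (intro mult_left_mono) auto
        then have "exp (l * y) \<le> exp (l * y) * (1 - exp (- (y\<^sup>2) / 2)) / q" using q by (simp add: le_divide_eq)
        then show ?thesis using True q by simp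
      qed simp
    qed
  qed measurable
qed

text \<open>Paired with \<open>e^{lx}\<close>, a shift of \<open>\<phi>\<close> by \<open>y\<close>
  becomes the factor \<open>e^{ly}\<close> and each derivative a factor \<open>- l\<close>; the
  signs in the adjoint turn these into the Laplace exponent at \<open>l\<close>. Exchanging the
  integrals over \<open>x\<close> and \<open>y\<close> takes joint absolute integrability, for which
  the exponential tail of \<open>\<nu>\<close> is needed.\<close>

lemma weak_generator_exponential:
  assumes mom: "\<And>t. 0 < t \<Longrightarrow> has_bochner_integral (law t) (\<lambda>y. exp (l * y)) (exp (\<alpha> * t))"
  shows "weak_generator_eq b \<sigma>2 \<nu> (\<lambda>x. exp (l * x)) (\<lambda>x. \<alpha> * exp (l * x))"
  unfolding weak_generator_eq_def
proof (intro allI impI)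
  fix \<phi> assume "test_function \<phi>"
  then obtain R where R: "0 \<le> R" and d0: "\<And>x. (\<phi> has_real_derivative deriv \<phi> x) (at x)"
    and d1: "\<And>x. (deriv \<phi> has_real_derivative deriv (deriv \<phi>) x) (at x)"
    and c0: "continuous_on UNIV \<phi>" and c1: "continuous_on UNIV (deriv \<phi>)" and c2: "continuous_on UNIV (deriv (deriv \<phi>))"
    and z0: "\<And>x. R < \<bar>x\<bar> \<Longrightarrow> \<phi> x = 0" and z1: "\<And>x. R < \<bar>x\<bar> \<Longrightarrow> deriv \<phi> x = 0" and z2: "\<And>x. R < \<bar>x\<bar> \<Longrightarrow> deriv (deriv \<phi>) x = 0"
    by (rule test_function_facts) blast
  define f1 where "f1 = deriv \<phi>"
  define f2 where "f2 = deriv (deriv \<phi>)"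
  note d0 = d0[folded f1_def] and d1 = d1[folded f1_def f2_def, unfolded f1_def[symmetric]]
  note c1 = c1[folded f1_def] and c2 = c2[folded f2_def] and z1 = z1[folded f1_def] and z2 = z2[folded f2_def]
  have [measurable]: "\<phi> \<in> borel_measurable borel" "f1 \<in> borel_measurable borel" "f2 \<in> borel_measurable borel"
    using c0 c1 c2 by (auto intro: borel_measurable_continuous_onI)
  let ?h = "\<lambda>x. exp (l * x)"
  let ?I = "\<lambda>y. indicator {0<..<1} \<bar>y\<bar> :: real"
  \<comment> \<open>The jump kernel of the adjoint with the reflection of \<open>\<nu>\<close>
    carried out, so that \<open>y\<close> runs through the jumps of \<open>X\<close> itself.\<close>
  define k where "k y x = \<phi> (x - y) - \<phi> x + y * f1 x * ?I y" for y x
  have A: "adjoint_generator b \<sigma>2 \<nu> \<phi> x = - b * f1 x + \<sigma>2 / 2 * f2 x + (LINT y|\<nu>. k y x)" for x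
  proof -
    have "(LINT y|distr \<nu> borel uminus. \<phi> (x + y) - \<phi> x - y * f1 x * ?I y) = (LINT y|\<nu>. \<phi> (x + - y) - \<phi> x - (- y) * f1 x * ?I (- y))"
      by (subst integral_distr) auto
    also have "\<dots> = (LINT y|\<nu>. k y x)" unfolding k_def by (intro Bochner_Integration.integral_cong refl) simp
    finally show ?thesis unfolding adjoint_generator_def generator_def f1_def f2_def by simp
  qed
  have ih: "integrable lborel (\<lambda>x. ?h x * f x)" if "continuous_on UNIV f" "\<And>x. R < \<bar>x\<bar> \<Longrightarrow> f x = 0" for f :: "real \<Rightarrow> real"
    by (rule integrable_compact_support[of _ R]) (use that in \<open>auto intro!: continuous_intros\<close>)
  define P where "P = (LINT x|lborel. ?h x * \<phi> x)"
  have parts: "(LINT x|lborel. ?h x * f' x) = - l * (LINT x|lborel. ?h x * f x)"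
    if d: "\<And>x. (f has_real_derivative f' x) (at x)" and cf: "continuous_on UNIV f" and cf': "continuous_on UNIV f'"
      and zf: "\<And>x. R < \<bar>x\<bar> \<Longrightarrow> f x = 0" and zf': "\<And>x. R < \<bar>x\<bar> \<Longrightarrow> f' x = 0" for f f' :: "real \<Rightarrow> real"
  proof -
    have "(LINT x|lborel. l * (?h x * f x) + ?h x * f' x) = 0"
    proof (rule integral_derivative_compact_support[where f="\<lambda>x. ?h x * f x" and R=R])
      show "((\<lambda>x. ?h x * f x) has_real_derivative l * (?h x * f x) + ?h x * f' x) (at x)" for x
        by (auto intro!: derivative_eq_intros d)
      show "continuous_on UNIV (\<lambda>x. l * (?h x * f x) + ?h x * f' x)" by (intro continuous_intros cf cf')
    qed (use zf zf' in auto)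
    moreover have "(LINT x|lborel. l * (?h x * f x) + ?h x * f' x) = l * (LINT x|lborel. ?h x * f x) + (LINT x|lborel. ?h x * f' x)"
      by (subst Bochner_Integration.integral_add) (use ih[OF cf zf] ih[OF cf' zf'] in auto)
    ultimately show ?thesis by simp
  qed
  have P1: "(LINT x|lborel. ?h x * f1 x) = - l * P" unfolding P_def by (rule parts[OF d0 c0 c1 z0 z1])
  have P2: "(LINT x|lborel. ?h x * f2 x) = l\<^sup>2 * P"
    using parts[OF d1 c1 c2 z1 z2] unfolding P1 by (simp add: power2_eq_square)
  have ishift: "integrable lborel (\<lambda>x. ?h x * f (x - y))" "(LINT x|lborel. ?h x * f (x - y)) = exp (l * y) * (LINT x|lborel. ?h x * f x)"
    if cf: "continuous_on UNIV f" and zf: "\<And>x. R < \<bar>x\<bar> \<Longrightarrow> f x = 0" for y and f :: "real \<Rightarrow> real"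
  proof -
    have e: "?h (y + 1 * x) * f (y + 1 * x - y) = exp (l * y) * (?h x * f x)" for x
      by (simp add: distrib_left exp_add)
    have "continuous_on UNIV (\<lambda>x. f (x - y))" by (rule continuous_on_compose2[OF cf]) (auto intro!: continuous_intros)
    then show "integrable lborel (\<lambda>x. ?h x * f (x - y))"
      by (intro integrable_compact_support[of _ "R + \<bar>y\<bar>"] continuous_intros) (use zf in auto)
    have "(LINT x|lborel. ?h x * f (x - y)) = (LINT x|lborel. ?h (y + 1 * x) * f (y + 1 * x - y))"
      by (subst lborel_integral_real_affine[where c=1 and t=y]) auto
    then show "(LINT x|lborel. ?h x * f (x - y)) = exp (l * y) * (LINT x|lborel. ?h x * f x)"
      unfolding e by simp
  qed
  have intk: "integrable lborel (\<lambda>x. ?h x * k y x)" for y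
  proof -
    have "integrable lborel (\<lambda>x. ?h x * \<phi> (x - y) - ?h x * \<phi> x + (y * ?I y) * (?h x * f1 x))"
      by (intro Bochner_Integration.integrable_add Bochner_Integration.integrable_diff ishift ih integrable_mult_right c0 c1 z0 z1)
    then show ?thesis unfolding k_def by (simp add: algebra_simps)
  qed
  have valk: "(LINT x|lborel. ?h x * k y x) = (exp (l * y) - 1 - y * l * ?I y) * P" for y
  proof -
    have "(LINT x|lborel. ?h x * k y x) = (LINT x|lborel. (?h x * \<phi> (x - y) - ?h x * \<phi> x) + (y * ?I y) * (?h x * f1 x))"
      unfolding k_def by (intro Bochner_Integration.integral_cong refl) (simp add: algebra_simps)
    also have "\<dots> = (LINT x|lborel. ?h x * \<phi> (x - y)) - (LINT x|lborel. ?h x * \<phi> x) + (y * ?I y) * (LINT x|lborel. ?h x * f1 x)"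
    proof -
      have j1: "integrable lborel (\<lambda>x. ?h x * \<phi> (x - y))" by (rule ishift(1)[OF c0 z0])
      have j2: "integrable lborel (\<lambda>x. ?h x * \<phi> x)" by (rule ih[OF c0 z0])
      have j3: "integrable lborel (\<lambda>x. (y * ?I y) * (?h x * f1 x))" by (rule integrable_mult_right[OF ih[OF c1 z1]])
      show ?thesis
        by (simp only: Bochner_Integration.integral_add[OF Bochner_Integration.integrable_diff[OF j1 j2] j3]
          Bochner_Integration.integral_diff[OF j1 j2] integral_mult_right_zero)
    qed
    also have "(LINT x|lborel. ?h x * \<phi> (x - y)) = exp (l * y) * P" unfolding P_def by (rule ishift(2)[OF c0 z0])
    also have "exp (l * y) * P - (LINT x|lborel. ?h x * \<phi> x) + (y * ?I y) * (LINT x|lborel. ?h x * f1 x) = (exp (l * y) - 1 - y * l * ?I y) * P"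
      unfolding P1 P_def[symmetric] by (simp add: algebra_simps)
    finally show ?thesis .
  qed
  interpret nu: sigma_finite_measure \<nu> by (rule levy_measure_sigma_finite[OF levy_nu])
  interpret nul: pair_sigma_finite \<nu> lborel ..
  obtain K where K: "\<And>x. \<bar>f2 x\<bar> \<le> K"
  proof -
    have "bounded (f2 ` {- R..R})"
      by (intro compact_imp_bounded compact_continuous_image continuous_on_subset[OF c2]) auto
    then obtain K where K: "\<forall>x\<in>{- R..R}. \<bar>f2 x\<bar> \<le> K" unfolding bounded_iff by auto
    have "\<bar>f2 x\<bar> \<le> \<bar>K\<bar>" for x
    proof (cases "R < \<bar>x\<bar>")
      case False
      then have "x \<in> {- R..R}" by auto
      then show ?thesis using K by force
    qed (simp add: z2)
    then show thesis by (rule that)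
  qed
  have K0: "0 \<le> K" using K[of 0] by linarith
  define D where "D = (LINT x|lborel. ?h x * indicator {- (R + 1)..R + 1} x)"
  have intD: "integrable lborel (\<lambda>x. ?h x * indicator {- (R + 1)..R + 1} x)"
  proof -
    have "integrable lborel (\<lambda>x. indicator {- (R + 1)..R + 1} x *\<^sub>R ?h x)"
      by (rule borel_integrable_compact) (auto intro!: continuous_intros)
    then show ?thesis by (simp add: mult.commute)
  qed
  define P' where "P' = (LINT x|lborel. ?h x * \<bar>\<phi> x\<bar>)"
  have cabs: "continuous_on UNIV (\<lambda>x. \<bar>\<phi> x\<bar>)" by (intro continuous_intros c0)
  \<comment> \<open>Bounds the \<open>x\<close>-integral of \<open>e^{lx} |k y x|\<close>. For
    \<open>|y| < 1\<close> the kernel is at most \<open>K / 2 * y^2\<close> by Taylor and lives on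
    \<open>[-(R+1), R+1]\<close>, whence \<open>K / 2 * D\<close>. For \<open>|y| >= 1\<close> its
    two terms give \<open>P' e^{ly}\<close> and \<open>P'\<close>, the latter written as a multiple
    of \<open>min (y^2) 1\<close>.\<close>
  define q where "q y = (K / 2 * D + P') * min (y\<^sup>2) 1 + P' * (indicator {y. 1 \<le> \<bar>y\<bar>} y * exp (l * y))" for y
  have D0: "0 \<le> D" unfolding D_def by (intro Bochner_Integration.integral_nonneg) auto
  have P'0: "0 \<le> P'" unfolding P'_def by (intro Bochner_Integration.integral_nonneg) auto
  have intq: "integrable \<nu> q" unfolding q_def
    by (intro Bochner_Integration.integrable_add integrable_mult_right levy_measure_integrable levy_nu levy_measure_exp_tail[OF mom])
  have normk: "(LINT x|lborel. norm (?h x * k y x)) \<le> q y" for y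
  proof (cases "\<bar>y\<bar> < 1")
    case True
    have y2: "y\<^sup>2 \<le> 1" using True by (simp add: abs_square_le_1)
    have "(LINT x|lborel. norm (?h x * k y x)) \<le> (LINT x|lborel. (K / 2 * y\<^sup>2) * (?h x * indicator {- (R + 1)..R + 1} x))"
    proof (rule integral_mono)
      show "integrable lborel (\<lambda>x. norm (?h x * k y x))" by (rule integrable_norm[OF intk])
      show "integrable lborel (\<lambda>x. (K / 2 * y\<^sup>2) * (?h x * indicator {- (R + 1)..R + 1} x))" by (rule integrable_mult_right[OF intD])
      fix x
      have "k y x = \<phi> (x + - y) - \<phi> x - (- y) * f1 x"
        unfolding k_def using True by (cases "y = 0") (auto simp: indicator_def)
      then have kb: "\<bar>k y x\<bar> \<le> K / 2 * y\<^sup>2"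
        using second_order_bound[OF d0 d1, of x "- y" K] K by simp
      show "norm (?h x * k y x) \<le> (K / 2 * y\<^sup>2) * (?h x * indicator {- (R + 1)..R + 1} x)"
      proof (cases "x \<in> {- (R + 1)..R + 1}")
        case True
        then show ?thesis using mult_left_mono[OF kb, of "?h x"] by (simp add: abs_mult mult_ac)
      next
        case False
        then have "R < \<bar>x\<bar>" "R < \<bar>x - y\<bar>" using True R by auto
        then have "k y x = 0" unfolding k_def using z0 z1 by simp
        then show ?thesis using K0 by simp
      qed
    qed
    also have "\<dots> = K / 2 * D * y\<^sup>2" unfolding D_def by simp
    also have "\<dots> \<le> q y"
      unfolding q_def using y2 P'0 by (simp add: min_absorb1 distrib_right)
    finally show ?thesis .
  next
    case False
    then have y2: "1 \<le> y\<^sup>2" using abs_le_square_iff[of 1 y] by simp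
    have "(LINT x|lborel. norm (?h x * k y x)) \<le> (LINT x|lborel. ?h x * \<bar>\<phi> (x - y)\<bar> + ?h x * \<bar>\<phi> x\<bar>)"
    proof (rule integral_mono)
      show "integrable lborel (\<lambda>x. norm (?h x * k y x))" by (rule integrable_norm[OF intk])
      show "integrable lborel (\<lambda>x. ?h x * \<bar>\<phi> (x - y)\<bar> + ?h x * \<bar>\<phi> x\<bar>)"
        by (intro Bochner_Integration.integrable_add ishift(1)[OF cabs] ih[OF cabs]) (use z0 in auto)
      fix x
      have "\<bar>k y x\<bar> \<le> \<bar>\<phi> (x - y)\<bar> + \<bar>\<phi> x\<bar>" unfolding k_def using False by (simp add: indicator_def abs_triangle_ineq4)
      then have "?h x * \<bar>k y x\<bar> \<le> ?h x * (\<bar>\<phi> (x - y)\<bar> + \<bar>\<phi> x\<bar>)" by (rule mult_left_mono) simp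
      then show "norm (?h x * k y x) \<le> ?h x * \<bar>\<phi> (x - y)\<bar> + ?h x * \<bar>\<phi> x\<bar>" by (simp add: abs_mult distrib_left)
    qed
    also have "\<dots> = exp (l * y) * P' + P'"
      unfolding P'_def
      by (subst Bochner_Integration.integral_add) (use ishift[OF cabs, of y] ih[OF cabs] z0 in auto)
    also have "\<dots> \<le> q y"
      unfolding q_def using y2 False D0 K0 by (simp add: min_absorb2 indicator_def mult.commute)
    finally show ?thesis .
  qed
  have i: "integrable (\<nu> \<Otimes>\<^sub>M lborel) (case_prod (\<lambda>y x. ?h x * k y x))"
  proof (rule nul.Fubini_integrable)
    show "case_prod (\<lambda>y x. ?h x * k y x) \<in> borel_measurable (\<nu> \<Otimes>\<^sub>M lborel)"
      unfolding k_def by measurable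
    show "integrable \<nu> (\<lambda>y. LINT x|lborel. norm (case (y, x) of (y, x) \<Rightarrow> ?h x * k y x))"
    proof (rule Bochner_Integration.integrable_bound[OF intq])
      show "(\<lambda>y. LINT x|lborel. norm (case (y, x) of (y, x) \<Rightarrow> ?h x * k y x)) \<in> borel_measurable \<nu>"
        unfolding k_def by measurable
      show "AE y in \<nu>. norm (LINT x|lborel. norm (case (y, x) of (y, x) \<Rightarrow> ?h x * k y x)) \<le> norm (q y)"
      proof (rule AE_I2)
        fix y
        have "0 \<le> (LINT x|lborel. norm (?h x * k y x))" by (intro Bochner_Integration.integral_nonneg) auto
        then show "norm (LINT x|lborel. norm (case (y, x) of (y, x) \<Rightarrow> ?h x * k y x)) \<le> norm (q y)"
          using normk[of y] by simp
      qed
    qed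
    show "AE y in \<nu>. integrable lborel (\<lambda>x. case (y, x) of (y, x) \<Rightarrow> ?h x * k y x)" using intk by simp
  qed
  have i2: "integrable lborel (\<lambda>x. ?h x * (LINT y|\<nu>. k y x))"
    using nul.integrable_snd[OF i] by simp
  have v2: "(LINT x|lborel. ?h x * (LINT y|\<nu>. k y x)) = (LINT y|\<nu>. exp (l * y) - 1 - y * l * ?I y) * P"
  proof -
    have "(LINT x|lborel. ?h x * (LINT y|\<nu>. k y x)) = (LINT x|lborel. LINT y|\<nu>. ?h x * k y x)" by simp
    also have "\<dots> = (LINT y|\<nu>. LINT x|lborel. ?h x * k y x)" by (rule nul.Fubini_integral[OF i])
    also have "\<dots> = (LINT y|\<nu>. exp (l * y) - 1 - y * l * ?I y) * P" unfolding valk by simp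
    finally show ?thesis .
  qed
  have eq: "?h x * adjoint_generator b \<sigma>2 \<nu> \<phi> x = (- b) * (?h x * f1 x) + (\<sigma>2 / 2) * (?h x * f2 x) + ?h x * (LINT y|\<nu>. k y x)" for x
    unfolding A by (simp add: algebra_simps)
  have i1: "integrable lborel (\<lambda>x. (- b) * (?h x * f1 x))" "integrable lborel (\<lambda>x. (\<sigma>2 / 2) * (?h x * f2 x))"
    by (rule integrable_mult_right[OF ih[OF c1 z1]], assumption) (rule integrable_mult_right[OF ih[OF c2 z2]])
  show "integrable lborel (\<lambda>x. exp (l * x) * adjoint_generator b \<sigma>2 \<nu> \<phi> x) \<and>
        integrable lborel (\<lambda>x. \<alpha> * exp (l * x) * \<phi> x) \<and>
        (LINT x|lborel. exp (l * x) * adjoint_generator b \<sigma>2 \<nu> \<phi> x) = (LINT x|lborel. \<alpha> * exp (l * x) * \<phi> x)"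
  proof (intro conjI)
    show "integrable lborel (\<lambda>x. exp (l * x) * adjoint_generator b \<sigma>2 \<nu> \<phi> x)"
      unfolding eq by (intro Bochner_Integration.integrable_add i1 i2)
    show "integrable lborel (\<lambda>x. \<alpha> * exp (l * x) * \<phi> x)"
      using integrable_mult_right[OF ih[OF c0 z0], of \<alpha>] by (simp add: mult.assoc)
    have "(LINT x|lborel. exp (l * x) * adjoint_generator b \<sigma>2 \<nu> \<phi> x)
      = (- b) * (LINT x|lborel. ?h x * f1 x) + (\<sigma>2 / 2) * (LINT x|lborel. ?h x * f2 x) + (LINT x|lborel. ?h x * (LINT y|\<nu>. k y x))"
      unfolding eq
      by (simp only: Bochner_Integration.integral_add[OF Bochner_Integration.integrable_add[OF i1] i2]
          Bochner_Integration.integral_add[OF i1] integral_mult_right_zero)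
    also have "\<dots> = laplace_exponent l * P"
      unfolding P1 P2 v2 laplace_exponent_def by (simp add: algebra_simps)
    also have "\<dots> = \<alpha> * P" by (simp only: laplace_exponent_eq[OF mom])
    also have "\<dots> = (LINT x|lborel. \<alpha> * exp (l * x) * \<phi> x)" unfolding P_def by (simp add: mult.assoc)
    finally show "(LINT x|lborel. exp (l * x) * adjoint_generator b \<sigma>2 \<nu> \<phi> x) = (LINT x|lborel. \<alpha> * exp (l * x) * \<phi> x)" .
  qed
qed

end

text \<open>The two rates from the classification may coincide although the equation has a second
  solution; \<open>m\<close> is then that solution, or a repetition of \<open>l1\<close> if there is
  none.\<close>

lemma card_le_2_eq_pair:
  assumes "finite S" "card S \<le> 2" "l1 \<in> S" "l2 \<in> S"
  shows "\<exists>m. S = {l1, m} \<and> (l1 \<noteq> l2 \<longrightarrow> m = l2)"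
proof (cases "\<exists>m\<in>S. m \<noteq> l1")
  case True
  then obtain m where m: "m \<in> S" "m \<noteq> l1" "l1 \<noteq> l2 \<longrightarrow> m = l2" using assms(4) by metis
  have "{l1, m} = S" by (rule card_seteq) (use assms m in auto)
  then show ?thesis using m(3) by (intro exI[of _ m]) simp
next
  case False
  have "S = {l1, l1}" using False assms(3) by blast
  moreover have "l1 = l2" using False assms(4) by metis
  ultimately show ?thesis by blast
qed

theorem theorem3p4:
  fixes M :: "'a measure" and X :: "real \<Rightarrow> 'a \<Rightarrow> real"
    and b \<sigma>2 :: real and \<nu> :: "real measure"
    and p :: "real \<Rightarrow> real \<Rightarrow> real"
    and g :: "real \<Rightarrow> real" and c \<kappa> :: real
  assumes "levy_process M X"
    and "levy_triplet M X b \<sigma>2 \<nu>"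
    and "transition_density M X p"
    and "g \<in> borel_measurable borel"
    and "\<And>x. 0 < g x"
    and "0 < c" and "0 \<le> \<kappa>"
    and "\<And>x. \<bar>g x\<bar> \<le> c * exp (\<kappa> * \<bar>x\<bar>)"
    and "\<And>t. 0 \<le> t \<Longrightarrow> integrable M (\<lambda>\<omega>. exp (\<kappa> * \<bar>X t \<omega>\<bar>))"
    and "positive_on_line p \<or> positive_on_half_line p"
    and "martingale M (natural_filtration M X)
           (\<lambda>t \<omega>. g (X t \<omega>) / (LINT \<omega>'|M. g (X t \<omega>')))"
  shows "\<exists>g' \<alpha>.
    continuous_on UNIV g' \<and>
    (AE x\<in>state_space p in lborel. g x = g' x) \<and>
    weak_generator_eq b \<sigma>2 \<nu> g' (\<lambda>x. \<alpha> * g' x) \<and>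
    finite (exponential_solutions M X \<alpha>) \<and>
    card (exponential_solutions M X \<alpha>) \<le> 2 \<and>
    (positive_on_half_line p \<longrightarrow> card (exponential_solutions M X \<alpha>) \<le> 1) \<and>
    (exponential_solutions M X \<alpha> \<noteq> {} \<longrightarrow>
       (\<exists>l1 l2 a1 a2. exponential_solutions M X \<alpha> = {l1, l2} \<and> 0 \<le> a1 \<and> 0 \<le> a2 \<and>
          (AE x\<in>state_space p in lborel. g x = a1 * exp (l1 * x) + a2 * exp (l2 * x)))) \<and>
    (exponential_solutions M X \<alpha> = {} \<longrightarrow> (\<forall>x. g x = 0))"
proof -
  interpret levy_process M X by fact
  interpret levy_triplet_process M X b \<sigma>2 \<nu> by unfold_locales fact
  note td = assms(3) and gm[measurable] = assms(4) and gpos = assms(5)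
  interpret g: exp_bounded_function g c \<kappa> "\<kappa> + 1"
  proof
    show "g x \<le> c * exp (\<kappa> * \<bar>x\<bar>)" for x using assms(8)[of x] gpos[of x] by simp
  qed (use assms in auto)
  have gint: "integrable M (\<lambda>\<omega>. g (X t \<omega>))" if t: "0 \<le> t" for t
  proof (rule Bochner_Integration.integrable_bound)
    show "integrable M (\<lambda>\<omega>. c * exp (\<kappa> * \<bar>X t \<omega>\<bar>))" using assms(9)[OF t] by simp
    show "(\<lambda>\<omega>. g (X t \<omega>)) \<in> borel_measurable M" using measurable_X[OF t] by measurable
  qed (use assms in auto)
  define I where "I = state_space p"
  have I: "I = UNIV \<or> I = {0<..}" unfolding I_def state_space_def by simp
  have "\<exists>t>0. (\<forall>x\<in>I. 0 < p t x) \<and> (AE y in law (t + t). y \<in> I)"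
  proof (cases "positive_on_half_line p")
    case True
    then obtain t where t: "t > 0" "\<And>x. x < 0 \<Longrightarrow> p t x = 0" "\<And>x. x > 0 \<Longrightarrow> 0 < p t x"
      unfolding positive_on_half_line_def by blast
    have "AE y in law (t + t). 0 < y" by (rule AE_law_pos(2)[OF td t(1)]) (rule t(2))
    then show ?thesis using True t by (intro exI[of _ t]) (simp add: I_def state_space_def)
  next
    case False
    then obtain t where "t > 0" "\<And>x. 0 < p t x" using assms(10) unfolding positive_on_line_def by blast
    then show ?thesis using False by (intro exI[of _ t]) (simp add: I_def state_space_def)
  qed
  then obtain t where t: "t > 0" and pos: "\<And>x. x \<in> I \<Longrightarrow> 0 < p t x" and AE_I: "AE y in law (t + t). y \<in> I" by blast
  have T: "0 \<le> t + t" "0 < t + t" using t by auto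
  obtain C where C: "0 < C" and harm: "AE x in lborel. 0 < p t x \<longrightarrow> (\<integral>\<^sup>+y. ennreal (g (x + y)) \<partial>law (t + t)) = ennreal (C * g x)"
    by (rule martingale_harmonic[OF td t T(1) gm gpos gint assms(11)])
  have harm': "AE x in lborel. x \<in> I \<longrightarrow> (\<integral>\<^sup>+y. ennreal (g (x + y)) \<partial>law (t + t)) = ennreal (C * g x)"
    using harm by eventually_elim (use pos in blast)
  obtain l1 l2 a1 a2 where a: "0 \<le> a1" "0 \<le> a2"
    and mix: "AE x in lborel. x \<in> I \<longrightarrow> g x = a1 * exp (l1 * x) + a2 * exp (l2 * x)"
    and l: "has_bochner_integral (law (t + t)) (\<lambda>y. exp (l1 * y)) C" "has_bochner_integral (law (t + t)) (\<lambda>y. exp (l2 * y)) C"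
    by (rule g.harmonic_classification[OF _ prob_space_law[OF T(1)] I AE_I law_double_minorized[OF td t I pos] C harm']) simp_all
  \<comment> \<open>Both rates have the same moment \<open>C\<close> at time \<open>t + t\<close>,
    hence one \<open>\<alpha>\<close> serves both, and a mixture of the two exponentials is again an
    eigenfunction.\<close>
  define \<alpha> where "\<alpha> = ln C / (t + t)"
  have mom: "has_bochner_integral M (\<lambda>\<omega>. exp (l * X s \<omega>)) (exp (\<alpha> * s))"
    if "l = l1 \<or> l = l2" "0 \<le> s" for l s
    unfolding \<alpha>_def by (rule exp_moment_all_times[OF T(2) _ C that(2)]) (use l that in auto)
  have mom_law: "has_bochner_integral (law s) (\<lambda>y. exp (l * y)) (exp (\<alpha> * s))"
    if "l = l1 \<or> l = l2" "0 < s" for l s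
    using mom[OF that(1), of s] that(2) measurable_X[of s]
    by (auto simp: has_bochner_integral_iff integrable_distr_eq integral_distr)
  let ?S = "exponential_solutions M X \<alpha>"
  have S: "l1 \<in> ?S" "l2 \<in> ?S"
    using mom unfolding exponential_solutions_def by (auto simp: has_bochner_integral_iff)
  have card: "finite ?S" "card ?S \<le> 2" using exponential_solutions_card[OF td] by auto
  obtain m where m: "?S = {l1, m}" "l1 \<noteq> l2 \<Longrightarrow> m = l2"
    using card_le_2_eq_pair[OF card S] by blast
  define g' where "g' x = a1 * exp (l1 * x) + a2 * exp (l2 * x)" for x
  have mix': "AE x\<in>state_space p in lborel. g x = g' x" using mix unfolding I_def g'_def .
  \<comment> \<open>Rewrites the mixture over the full solution set \<open>{l1, m}\<close>. If
    \<open>l1 = l2\<close>, the coefficients merge on \<open>l1\<close>, and \<open>m\<close>,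
    possibly a further solution, gets coefficient 0.\<close>
  have "\<exists>b1 b2. 0 \<le> b1 \<and> 0 \<le> b2 \<and> (\<forall>x. g' x = b1 * exp (l1 * x) + b2 * exp (m * x))"
  proof (cases "l1 = l2")
    case True
    then show ?thesis using a unfolding g'_def
      by (intro exI[of _ "a1 + a2"] exI[of _ "0::real"]) (simp add: distrib_right)
  next
    case False
    then show ?thesis using a m(2) unfolding g'_def by blast
  qed
  then obtain b1 b2 where b: "0 \<le> b1" "0 \<le> b2" "\<And>x. g' x = b1 * exp (l1 * x) + b2 * exp (m * x)" by blast
  show ?thesis
  proof (rule exI[of _ g'], rule exI[of _ \<alpha>], intro conjI impI)
    show "continuous_on UNIV g'" unfolding g'_def by (intro continuous_intros)
    show "AE x\<in>state_space p in lborel. g x = g' x" by (rule mix')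
    show "weak_generator_eq b \<sigma>2 \<nu> g' (\<lambda>x. \<alpha> * g' x)"
      unfolding g'_def by (intro weak_generator_eq_linear weak_generator_exponential mom_law) auto
    show "finite ?S" "card ?S \<le> 2" by (rule card)+
    show "card ?S \<le> 1" if "positive_on_half_line p"
      using exponential_solutions_unique_half_line[OF td that] card_le_Suc0_iff_eq[OF card(1)] by auto
    show "\<exists>l1 l2 a1 a2. ?S = {l1, l2} \<and> 0 \<le> a1 \<and> 0 \<le> a2 \<and>
          (AE x\<in>state_space p in lborel. g x = a1 * exp (l1 * x) + a2 * exp (l2 * x))"
      using mix' unfolding b(3) by (intro exI[of _ l1] exI[of _ m] exI[of _ b1] exI[of _ b2] conjI m(1) b(1,2))
    \<comment> \<open>Vacuous: \<open>l1\<close> solves the equation, so for a positive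
      \<open>g\<close> the case without solutions does not occur.\<close>
    show "\<forall>x. g x = 0" if "?S = {}" using that S by simp
  qed
qed

end
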